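(* Let $L,M\ge 0$ be integers, $\beta\neq 0$, ${\bf c}=(c_1,\dots,c_L)$, ${\bf d}=(d_1,\dots,d_M)$ nonzero complex parameters (generic, so that all the Gamma-function values and the quantities $\rho_i$ below are defined and nonzero, and the pole sets described below are separated by the contours), and let $$G_{{\bf c},{\bf d}}(z)=\frac{\prod_{i=1}^L(1+c_iz)}{\prod_{j=1}^M(1-d_jz)},\qquad \kappa_{{\bf c},{\bf d}}=(-1)^M\frac{\prod_{l=1}^L\beta c_l}{\prod_{m=1}^M\beta d_m}.$$ For $k\in\mathbf Z$ define the Laurent series $$\phi_k^{({\bf c},{\bf d},\beta)}(x)=\beta x^{1-k}\sum_{j=0}^\infty\frac{\rho_{j-k}}{j!}\Big(\frac{x}{\beta}\Big)^j,$$ and the functions $$\tilde\phi_k^{({\bf c},{\bf d},\beta)}(x)=\frac{C_k}{2\pi i}\int_{\mathcal C_k}\frac{\Gamma(1-k-s)\prod_{l=1}^L\Gamma\big(s+\frac1{\beta c_l}\big)\,(-\kappa_{{\bf c},{\bf d}}x)^s}{\prod_{m=1}^M\Gamma\big(s-\frac1{\beta d_m}\big)}\,ds,\qquad C_k=\frac{\prod_{j=1}^M\Gamma(-\frac1{\beta d_j})}{(-\beta)^{k-1}\prod_{l=1}^L\Gamma(\frac1{\beta c_l})},$$ (i.e. $C_k$ times the Meijer $G$-function $G^{1,L}_{L,M+1}\big({1-\frac1{\beta c_1},\dots,1-\frac1{\beta c_L}\atop 1-k,\,1+\frac1{\beta d_1},\dots,1+\frac1{\beta d_M}}\big|-\kappa_{{\bf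 c},{\bf d}}x\big)$), where the contour $\mathcal C_k$ separates the poles $1-k,2-k,3-k,\dots$ (to its right) from the poles $\{-i-\frac1{\beta c_j}\}_{j=1,\dots,L,\ i\in\mathbf N}$ (to its left); for $L\le M+1$ it starts at $+\infty$ below the real axis, encircles the poles on the real axis clockwise and returns to $+\infty$, while for $L\ge M+1$ it may be taken to run from $-i\infty$ to $+i\infty$ (the integral then converging for $|\arg(-\kappa_{{\bf c},{\bf d}}x)|<\frac{(L-M+1)\pi}{2}$). Then the functions $\tilde\phi_k=\tilde\phi_k^{({\bf c},{\bf d},\beta)}$ satisfy, for all $k\in\mathbf Z$, $$\beta(\mathcal D+k-1)\tilde\phi_k=\tilde\phi_{k-1},\qquad \beta x\,G_{{\bf c},{\bf d}}(\beta\mathcal D)\tilde\phi_k=\tilde\phi_{k-1},\qquad \big(xG_{{\bf c},{\bf d}}(\beta\mathcal D)-\mathcal D\big)\tilde\phi_k=(k-1)\tilde\phi_k,$$ where $\mathcal D=x\frac{d}{dx}$. Moreover: (i) if $L\le M$, the Laurent series $\phi_k^{({\bf c},{\bf d},\beta)}(x)$ converges absolutely for all $x\in\mathbf C\setminus\{0\}$ and $\tilde\phi_k^{({\bf c},{\bf d},\beta)}(x)=\phi_k^{({\bf c},{\bf d},\beta)}(x)$; (ii) if $L=M+1$, the series $\phi_k^{({\bf c},{\bf d},\beta)}(x)$ converges to $\tilde\phi_k^{({\bf c},{\bf d},\beta)}(x)$ in the punctured disc $0<|\kappa_{{\bf c},{\bf d}}x|<1$; (iii) if $L>M+1$, the (formal)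 series $\phi_k^{({\bf c},{\bf d},\beta)}(x)$ is the asymptotic series (in the sense of Poincaré, as $x\to0$) of $\tilde\phi_k^{({\bf c},{\bf d},\beta)}(x)$ within the angular sector $0<\arg(-\kappa_{{\bf c},{\bf d}}x)<(L-M+1)\frac{\pi}{2}$.
   Context: Set $r_i=\beta G_{{\bf c},{\bf d}}(i\beta)$ for $i\in\mathbf Z$ (assumed nonzero), $\rho_0=1$, $\rho_i=\prod_{k=1}^i r_k$ and $\rho_{-i}=\prod_{k=0}^{i-1}r_{-k}^{-1}$ for $i\in\mathbf N^+$; explicitly $\rho_i=\beta^i\prod_{k=1}^i\frac{\prod_l(1+k\beta c_l)}{\prod_m(1-k\beta d_m)}$ and $\rho_{-i}=\beta^{-i}\prod_{k=1}^{i-1}\frac{\prod_m(1+k\beta d_m)}{\prod_l(1-k\beta c_l)}$. The operator $G_{{\bf c},{\bf d}}(\beta\mathcal D)$ acts on powers by $G_{{\bf c},{\bf d}}(\beta\mathcal D)x^s=G_{{\bf c},{\bf d}}(\beta s)x^s$ (equivalently, $\prod_l(1+\beta c_l\mathcal D)$ composed with the inverse of $\prod_m(1-\beta d_m\mathcal D)$), and is applied under the integral sign for $\tilde\phi_k$. Up to the prefactor $\beta\rho_{-k}(\kappa_{{\bf c},{\bf d}}x)^{1-k}$, the series $\phi_k^{({\bf c},{\bf d},\beta)}$ is the generalized hypergeometric series ${}_LF_M\big({1-k+\frac1{\beta c_1},\dots,1-k+\frac1{\beta c_L}\atop 1-k-\frac1{\beta d_1},\dots,1-k-\frac1{\beta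 d_M}}\big|\kappa_{{\bf c},{\bf d}}x\big)$. *)

theory Defs
  imports "HOL-Complex_Analysis.Complex_Analysis" "HOL-Library.Landau_Symbols"
begin

text \<open>Parameters: L M :: nat, beta :: complex, c d :: nat => complex
  (c_1..c_L is represented by c 0 .. c (L-1), likewise for d).\<close>

definition Gcd :: "nat \<Rightarrow> nat \<Rightarrow> (nat \<Rightarrow> complex) \<Rightarrow> (nat \<Rightarrow> complex) \<Rightarrow> complex \<Rightarrow> complex" where
  "Gcd L M c d z = (\<Prod>i<L. 1 + c i * z) / (\<Prod>j<M. 1 - d j * z)"

definition kappa :: "nat \<Rightarrow> nat \<Rightarrow> complex \<Rightarrow> (nat \<Rightarrow> complex) \<Rightarrow> (nat \<Rightarrow> complex) \<Rightarrow> complex" where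
  "kappa L M \<beta> c d = (-1) ^ M * (\<Prod>l<L. \<beta> * c l) / (\<Prod>m<M. \<beta> * d m)"

definition rr :: "nat \<Rightarrow> nat \<Rightarrow> complex \<Rightarrow> (nat \<Rightarrow> complex) \<Rightarrow> (nat \<Rightarrow> complex) \<Rightarrow> int \<Rightarrow> complex" where
  "rr L M \<beta> c d i = \<beta> * Gcd L M c d (of_int i * \<beta>)"

definition rho :: "nat \<Rightarrow> nat \<Rightarrow> complex \<Rightarrow> (nat \<Rightarrow> complex) \<Rightarrow> (nat \<Rightarrow> complex) \<Rightarrow> int \<Rightarrow> complex" where
  "rho L M \<beta> c d i =
     (if 0 \<le> i then (\<Prod>k\<in>{1..nat i}. rr L M \<beta> c d (int k))
      else (\<Prod>k\<in>{0..<nat (- i)}. inverse (rr L M \<beta> c d (- int k))))"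

definition phi_term :: "nat \<Rightarrow> nat \<Rightarrow> complex \<Rightarrow> (nat \<Rightarrow> complex) \<Rightarrow> (nat \<Rightarrow> complex) \<Rightarrow> int \<Rightarrow> complex \<Rightarrow> nat \<Rightarrow> complex" where
  "phi_term L M \<beta> c d k x j =
     \<beta> * x powi (1 - k) * (rho L M \<beta> c d (int j - k) / fact j) * (x / \<beta>) ^ j"

definition phi :: "nat \<Rightarrow> nat \<Rightarrow> complex \<Rightarrow> (nat \<Rightarrow> complex) \<Rightarrow> (nat \<Rightarrow> complex) \<Rightarrow> int \<Rightarrow> complex \<Rightarrow> complex" where
  "phi L M \<beta> c d k x = (\<Sum>j. phi_term L M \<beta> c d k x j)"

text \<open>The variable: zeta is a logarithm of -kappa x (a point of the universal cover of C-{0}),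
  so (-kappa x)^s = exp (s zeta), x = - exp zeta / kappa, and D = x d/dx = d/dzeta.\<close>
definition xof :: "nat \<Rightarrow> nat \<Rightarrow> complex \<Rightarrow> (nat \<Rightarrow> complex) \<Rightarrow> (nat \<Rightarrow> complex) \<Rightarrow> complex \<Rightarrow> complex" where
  "xof L M \<beta> c d \<zeta> = - exp \<zeta> / kappa L M \<beta> c d"

definition Ck :: "nat \<Rightarrow> nat \<Rightarrow> complex \<Rightarrow> (nat \<Rightarrow> complex) \<Rightarrow> (nat \<Rightarrow> complex) \<Rightarrow> int \<Rightarrow> complex" where
  "Ck L M \<beta> c d k = (\<Prod>j<M. Gamma (- 1 / (\<beta> * d j)))
       / ((- \<beta>) powi (k - 1) * (\<Prod>l<L. Gamma (1 / (\<beta> * c l))))"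

text \<open>Mellin-Barnes integrand; exp (s * zeta) stands for (-kappa x)^s.\<close>
definition integrand :: "nat \<Rightarrow> nat \<Rightarrow> complex \<Rightarrow> (nat \<Rightarrow> complex) \<Rightarrow> (nat \<Rightarrow> complex) \<Rightarrow> int \<Rightarrow> complex \<Rightarrow> complex \<Rightarrow> complex" where
  "integrand L M \<beta> c d k \<zeta> s =
     Gamma (1 - of_int k - s) * (\<Prod>l<L. Gamma (s + 1 / (\<beta> * c l))) * exp (s * \<zeta>)
       / (\<Prod>m<M. Gamma (s - 1 / (\<beta> * d m)))"

definition line_integral :: "(complex \<Rightarrow> complex) \<Rightarrow> (real \<Rightarrow> complex) \<Rightarrow> complex" where
  "line_integral f \<gamma> = integral UNIV (\<lambda>t. f (\<gamma> t) * vector_derivative \<gamma> (at t))"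

definition phitilde :: "nat \<Rightarrow> nat \<Rightarrow> complex \<Rightarrow> (nat \<Rightarrow> complex) \<Rightarrow> (nat \<Rightarrow> complex) \<Rightarrow> (real \<Rightarrow> complex) \<Rightarrow> int \<Rightarrow> complex \<Rightarrow> complex" where
  "phitilde L M \<beta> c d \<gamma> k \<zeta> =
     Ck L M \<beta> c d k / (2 * of_real pi * \<i>) * line_integral (integrand L M \<beta> c d k \<zeta>) \<gamma>"

text \<open>G(beta D) phitilde_k, with G(beta D) applied under the integral sign (G(beta D) x^s = G(beta s) x^s).\<close>
definition GD_phitilde :: "nat \<Rightarrow> nat \<Rightarrow> complex \<Rightarrow> (nat \<Rightarrow> complex) \<Rightarrow> (nat \<Rightarrow> complex) \<Rightarrow> (real \<Rightarrow> complex) \<Rightarrow> int \<Rightarrow> complex \<Rightarrow> complex" where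
  "GD_phitilde L M \<beta> c d \<gamma> k \<zeta> =
     Ck L M \<beta> c d k / (2 * of_real pi * \<i>) *
       line_integral (\<lambda>s. Gcd L M c d (\<beta> * s) * integrand L M \<beta> c d k \<zeta> s) \<gamma>"

definition right_poles :: "int \<Rightarrow> complex set" where
  "right_poles k = {of_int (1 - k) + of_nat n | n. True}"

definition left_poles :: "nat \<Rightarrow> complex \<Rightarrow> (nat \<Rightarrow> complex) \<Rightarrow> complex set" where
  "left_poles L \<beta> c = {- of_nat i - 1 / (\<beta> * c l) | i l. l < L}"

definition regular_contour :: "(real \<Rightarrow> complex) \<Rightarrow> bool" where
  "regular_contour \<gamma> \<longleftrightarrow> (\<forall>T. \<gamma> piecewise_C1_differentiable_on {-T..T})"

definition trunc_path :: "(real \<Rightarrow> complex) \<Rightarrow> real \<Rightarrow> real \<Rightarrow> complex" where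
  "trunc_path \<gamma> R = (\<lambda>u. \<gamma> (- R + 2 * R * u))"

definition hankel_contour :: "nat \<Rightarrow> complex \<Rightarrow> (nat \<Rightarrow> complex) \<Rightarrow> int \<Rightarrow> (real \<Rightarrow> complex) \<Rightarrow> bool" where
  "hankel_contour L \<beta> c k \<gamma> \<longleftrightarrow>
     regular_contour \<gamma> \<and>
     (\<forall>p \<in> right_poles k \<union> left_poles L \<beta> c. p \<notin> range \<gamma>) \<and>
     (\<exists>T \<eta>. 0 < T \<and> 0 < \<eta> \<and> (\<forall>t\<ge>T. \<gamma> t = of_real t + \<i> * of_real \<eta>)
                                \<and> (\<forall>t\<le>-T. \<gamma> t = of_real (- t) - \<i> * of_real \<eta>)) \<and>
     (\<forall>p \<in> right_poles k. eventually (\<lambda>R.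
          winding_number (trunc_path \<gamma> R +++ linepath (\<gamma> R) (\<gamma> (- R))) p = -1) at_top) \<and>
     (\<forall>p \<in> left_poles L \<beta> c. eventually (\<lambda>R.
          winding_number (trunc_path \<gamma> R +++ linepath (\<gamma> R) (\<gamma> (- R))) p = 0) at_top)"

definition vclose :: "(real \<Rightarrow> complex) \<Rightarrow> real \<Rightarrow> real \<Rightarrow> complex" where
  "vclose \<gamma> R = trunc_path \<gamma> R +++ linepath (\<gamma> R) (Complex R R) +++
                 linepath (Complex R R) (Complex R (- R)) +++ linepath (Complex R (- R)) (\<gamma> (- R))"

definition vertical_contour :: "nat \<Rightarrow> complex \<Rightarrow> (nat \<Rightarrow> complex) \<Rightarrow> int \<Rightarrow> (real \<Rightarrow> complex) \<Rightarrow> bool" where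
  "vertical_contour L \<beta> c k \<gamma> \<longleftrightarrow>
     regular_contour \<gamma> \<and>
     (\<forall>p \<in> right_poles k \<union> left_poles L \<beta> c. p \<notin> range \<gamma>) \<and>
     (\<exists>T a. 0 < T \<and> (\<forall>t. T \<le> \<bar>t\<bar> \<longrightarrow> \<gamma> t = Complex a t)) \<and>
     (\<forall>p \<in> right_poles k. eventually (\<lambda>R. winding_number (vclose \<gamma> R) p = -1) at_top) \<and>
     (\<forall>p \<in> left_poles L \<beta> c. eventually (\<lambda>R. winding_number (vclose \<gamma> R) p = 0) at_top)"

definition relations_hold :: "nat \<Rightarrow> nat \<Rightarrow> complex \<Rightarrow> (nat \<Rightarrow> complex) \<Rightarrow> (nat \<Rightarrow> complex)
     \<Rightarrow> (int \<Rightarrow> real \<Rightarrow> complex) \<Rightarrow> complex set \<Rightarrow> bool" where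
  "relations_hold L M \<beta> c d \<gamma> \<Omega> \<longleftrightarrow>
     (\<forall>k. \<forall>\<zeta>\<in>\<Omega>.
        phitilde L M \<beta> c d (\<gamma> k) k field_differentiable (at \<zeta>) \<and>
        \<beta> * (deriv (phitilde L M \<beta> c d (\<gamma> k) k) \<zeta> + of_int (k - 1) * phitilde L M \<beta> c d (\<gamma> k) k \<zeta>)
          = phitilde L M \<beta> c d (\<gamma> (k - 1)) (k - 1) \<zeta> \<and>
        \<beta> * xof L M \<beta> c d \<zeta> * GD_phitilde L M \<beta> c d (\<gamma> k) k \<zeta>
          = phitilde L M \<beta> c d (\<gamma> (k - 1)) (k - 1) \<zeta> \<and>
        xof L M \<beta> c d \<zeta> * GD_phitilde L M \<beta> c d (\<gamma> k) k \<zeta> - deriv (phitilde L M \<beta> c d (\<gamma> k) k) \<zeta>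
          = of_int (k - 1) * phitilde L M \<beta> c d (\<gamma> k) k \<zeta>)"

end

theory Submission
  imports Defs
begin

text \<open>
  Write the integrand as \<open>\<Gamma>(1 - k - s) H(s)\<close> with \<open>H\<close> holomorphic off the left poles. By the residue
  theorem the integral over a Hankel contour truncated at a half-integer \<open>b\<close> is, up to a vertical
  segment at \<open>Re s = b\<close>, the sum of the residues at the right poles below \<open>b\<close>. The reflection formula
  and the ratio of the integrand at \<open>s + 1\<close> and \<open>s\<close> give geometric decay, so that the contour integral
  equals the full residue series, which is \<open>\<phi>\<^sub>k\<close>. For a vertical contour the same argument moves the
  contour to the line \<open>Re s = b\<close> at the cost of finitely many residues, where exponential decay of the
  Gamma function in vertical strips replaces the geometric decay. The line integral is then
  differentiated under the integral sign, tends to 0 as \<open>b\<close> grows if \<open>L = M + 1\<close>, and is the remainder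
  of the asymptotic series if \<open>L > M + 1\<close>. The three relations are the functional equations of the Gamma
  factors, since every contour that separates the poles yields the same residue expansion.
\<close>

section \<open>Decay of the Gamma function in vertical strips\<close>

text \<open>The contours for different k are independent and constrained only by winding numbers of
  closed truncations, so phitilde_k and phitilde_(k-1) cannot be compared along one path. Both sides
  are brought to a form that no longer mentions a contour: the series (Hankel), or a straight line
  integral plus finitely many residues (vertical). Derivatives are taken only there, since the
  bounded part of a contour may have infinite length. Everything rests on \<open>mb_core\<close>,
  which satisfies G(beta s) core(s) = kappa core(s + 1). Hence rho_i = (beta kappa)^i core(i + 1) /
  core(1), C_k turns residues into terms of the series, and G(beta D) acts as the shift s -> s + 1.
  Together with Gamma(1 - k - s) and exp(s zeta), this shift multiplies the integrand by -exp(zeta)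
  times a rational function of degree L - M - 1, with limit 0 at infinity for L <= M and 1 for L = M
  + 1; this is the origin of |kappa x| < 1. Half-integers b avoid the right poles and give |sin(pi
  (k + s))| >= 1 on Re s = b.\<close>

text \<open>Termwise comparison of the Euler products of \<open>z\<close> and \<open>Re z\<close>. Together with the explicit
  value of the modulus on the line \<open>Re z = 1/2\<close> it replaces Stirling's formula.\<close>

lemma norm_Gamma_mult_le_shift:
  fixes z :: complex and \<delta> :: real
  assumes "Re z > 0" "\<delta> \<ge> 0"
  shows "norm (Gamma z) * Gamma (Re z + \<delta>) \<le> norm (Gamma (z + of_real \<delta>)) * Gamma (Re z)"
proof (rule LIMSEQ_le)
  show "(\<lambda>n. norm (Gamma_series z n) * Gamma_series (Re z + \<delta>) n) \<longlonglongrightarrow> norm (Gamma z) * Gamma (Re z + \<delta>)"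
    by (intro tendsto_intros)
  show "(\<lambda>n. norm (Gamma_series (z + of_real \<delta>) n) * Gamma_series (Re z) n)
          \<longlonglongrightarrow> norm (Gamma (z + of_real \<delta>)) * Gamma (Re z)"
    by (intro tendsto_intros)
  show "\<exists>N. \<forall>n\<ge>N. norm (Gamma_series z n) * Gamma_series (Re z + \<delta>) n
          \<le> norm (Gamma_series (z + of_real \<delta>) n) * Gamma_series (Re z) n"
  proof (intro exI allI impI)
    fix n :: nat
    \<comment> \<open>The Pochhammer symbols are denominators of the Euler products, which reverses
      the inequality. Factor by factor it comes down to Re z <= |z|.\<close>
    have *: "norm (pochhammer (z + of_real \<delta>) (n+1)) * pochhammer (Re z) (n+1)
          \<le> norm (pochhammer z (n+1)) * pochhammer (Re z + \<delta>) (n+1)"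
      unfolding pochhammer_prod prod_norm [symmetric] prod.distrib [symmetric]
    proof (rule prod_mono, intro conjI)
      fix i assume "i \<in> {0..<n+1}"
      have 1: "norm (z + of_real \<delta> + of_nat i) \<le> norm (z + of_nat i) + \<delta>"
        using norm_triangle_ineq[of "z + of_nat i" "of_real \<delta>"] assms by (simp add: add_ac)
      have 2: "Re z + real i \<le> norm (z + of_nat i)"
        using complex_Re_le_cmod[of "z + of_nat i"] by simp
      have "norm (z + of_real \<delta> + of_nat i) * (Re z + real i) \<le> (norm (z + of_nat i) + \<delta>) * (Re z + real i)"
        using 1 assms by (intro mult_right_mono) auto
      also have "\<dots> \<le> norm (z + of_nat i) * (Re z + \<delta> + real i)"
        using mult_left_mono[OF 2 assms(2)] by (simp add: algebra_simps)
      finally show "norm (z + of_real \<delta> + of_nat i) * (Re z + of_nat i)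
                    \<le> norm (z + of_nat i) * (Re z + \<delta> + of_nat i)" by simp
      show "0 \<le> norm (z + of_real \<delta> + of_nat i) * (Re z + of_nat i)"
        using assms by auto
    qed
    have p: "pochhammer (Re z) (n+1) > 0" "pochhammer (Re z + \<delta>) (n+1) > 0"
      using assms by (auto intro!: pochhammer_pos)
    have nz: "norm (pochhammer w (n+1)) > 0" if "Re w > 0" for w :: complex
      using that by (auto simp del: pochhammer_Suc simp: pochhammer_eq_0_iff)
    have q: "norm (pochhammer z (n+1)) > 0" "norm (pochhammer (z + of_real \<delta>) (n+1)) > 0"
      using nz[of z] nz[of "z + of_real \<delta>"] assms by auto
    define X where "X = exp (Re z * ln (real n)) * exp ((Re z + \<delta>) * ln (real n)) * fact n * fact n"
    have e1: "norm (Gamma_series w n) = fact n * exp (Re w * ln (real n)) / norm (pochhammer w (n+1))" for w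
      by (simp add: Gamma_series_def norm_mult norm_divide)
    have "norm (Gamma_series z n) * Gamma_series (Re z + \<delta>) n =
            X / (norm (pochhammer z (n+1)) * pochhammer (Re z + \<delta>) (n+1))"
      unfolding e1 unfolding Gamma_series_def X_def by simp
    also have "\<dots> \<le> X / (norm (pochhammer (z + of_real \<delta>) (n+1)) * pochhammer (Re z) (n+1))"
      by (rule divide_left_mono[OF *]) (use p q in \<open>auto simp: X_def simp del: pochhammer_Suc\<close>)
    also have "\<dots> = norm (Gamma_series (z + of_real \<delta>) n) * Gamma_series (Re z) n"
      unfolding e1 unfolding Gamma_series_def X_def by simp
    finally show "norm (Gamma_series z n) * Gamma_series (Re z + \<delta>) n
          \<le> norm (Gamma_series (z + of_real \<delta>) n) * Gamma_series (Re z) n" .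
  qed
qed

lemma norm_Gamma_half_le:
  "norm (Gamma (Complex (1/2) t)) \<le> sqrt (2 * pi) * exp (- (pi/2) * \<bar>t\<bar>)"
proof -
  let ?z = "Complex (1/2) t"
  have "1 - ?z = cnj ?z" by (simp add: complex_eq_iff)
  hence "Gamma ?z * cnj (Gamma ?z) = of_real pi / sin (of_real pi * ?z)"
    using Gamma_reflection_complex[of ?z] by (simp add: cnj_Gamma)
  moreover have "sin (of_real pi * ?z) = of_real (cosh (pi * t))"
  proof -
    have "of_real pi * ?z = of_real pi / 2 - - (\<i> * of_real (pi * t))"
      by (simp add: complex_eq_iff)
    also have "sin \<dots> = cos (\<i> * of_real (pi * t))"
      by (simp only: sin_diff) (simp flip: of_real_divide add: sin_of_real cos_of_real)
    also have "\<dots> = of_real (cosh (pi * t))"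
      by (simp add: cosh_def cos_exp_eq scaleR_conv_of_real exp_minus flip: exp_of_real)
    finally show ?thesis .
  qed
  ultimately have "of_real ((norm (Gamma ?z))^2) = complex_of_real (pi / cosh (pi * t))"
    by (simp add: complex_norm_square del: of_real_power)
  hence sq: "(norm (Gamma ?z))^2 = pi / cosh (pi * t)"
    using of_real_eq_iff by blast
  have "cosh (pi * t) = cosh (pi * \<bar>t\<bar>)"
    by (metis cosh_real_abs abs_mult abs_of_pos pi_gt_zero)
  also have "\<dots> \<ge> exp (pi * \<bar>t\<bar>) / 2"
    by (simp add: cosh_def)
  finally have "pi / cosh (pi * t) \<le> pi / (exp (pi * \<bar>t\<bar>) / 2)"
    by (intro divide_left_mono) auto
  also have "\<dots> = (sqrt (2 * pi) * exp (- (pi/2) * \<bar>t\<bar>))^2"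
  proof -
    have e: "(exp (- (pi/2) * \<bar>t\<bar>))\<^sup>2 = exp (- (pi * \<bar>t\<bar>))"
      unfolding exp_double[symmetric] by (rule arg_cong[where f = exp]) simp
    have s: "(sqrt (2 * pi))\<^sup>2 = 2 * pi" by simp
    show ?thesis unfolding power_mult_distrib e s
      by (simp only: exp_minus divide_inverse inverse_mult_distrib inverse_inverse_eq mult_ac)
  qed
  finally have "(norm (Gamma ?z))\<^sup>2 \<le> (sqrt (2 * pi) * exp (- (pi/2) * \<bar>t\<bar>))\<^sup>2"
    unfolding sq .
  thus ?thesis
    by (rule power2_le_imp_le) simp
qed

text \<open>One term of the exponential series. It trades a polynomial factor for an arbitrarily
  small loss of exponential rate.\<close>

lemma power_le_fact_mult_exp:
  fixes x :: real
  assumes "x \<ge> 0"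
  shows "x ^ m \<le> fact m * exp x"
proof -
  have "(\<Sum>n<Suc m. x ^ n /\<^sub>R fact n) \<le> exp x"
    unfolding exp_def using assms by (intro sum_le_suminf summable_exp_generic) auto
  moreover have "x ^ m /\<^sub>R fact m \<le> (\<Sum>n<Suc m. x ^ n /\<^sub>R fact n)"
    using assms by (auto intro!: sum_nonneg)
  ultimately have "x ^ m /\<^sub>R fact m \<le> exp x" by linarith
  thus ?thesis by (simp add: field_simps)
qed

text \<open>Only rates \<open>\<nu> < \<mu>\<close> are required, so that polynomial factors are absorbed.\<close>

definition strip_decay :: "real \<Rightarrow> (complex \<Rightarrow> complex) \<Rightarrow> bool" where
  "strip_decay \<mu> h \<longleftrightarrow> (\<forall>\<nu><\<mu>. \<forall>S. \<exists>C T. \<forall>s. \<bar>Re s\<bar> \<le> S \<longrightarrow> T \<le> \<bar>Im s\<bar> \<longrightarrow>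
     norm (h s) \<le> C * exp (- \<nu> * \<bar>Im s\<bar>))"

lemma strip_decayD:
  assumes "strip_decay \<mu> h" "\<nu> < \<mu>"
  obtains C T where "C > 0" "T > 0"
    "\<And>s. \<bar>Re s\<bar> \<le> S \<Longrightarrow> T \<le> \<bar>Im s\<bar> \<Longrightarrow> norm (h s) \<le> C * exp (- \<nu> * \<bar>Im s\<bar>)"
proof -
  obtain C T where CT: "\<And>s. \<bar>Re s\<bar> \<le> S \<Longrightarrow> T \<le> \<bar>Im s\<bar> \<Longrightarrow> norm (h s) \<le> C * exp (- \<nu> * \<bar>Im s\<bar>)"
    using assms unfolding strip_decay_def by blast
  show ?thesis
  proof (rule that[of "\<bar>C\<bar> + 1" "\<bar>T\<bar> + 1"])
    fix s assume "\<bar>Re s\<bar> \<le> S" "\<bar>T\<bar> + 1 \<le> \<bar>Im s\<bar>"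
    hence "norm (h s) \<le> C * exp (- \<nu> * \<bar>Im s\<bar>)" by (intro CT) auto
    also have "\<dots> \<le> (\<bar>C\<bar> + 1) * exp (- \<nu> * \<bar>Im s\<bar>)" by (intro mult_right_mono) auto
    finally show "norm (h s) \<le> (\<bar>C\<bar> + 1) * exp (- \<nu> * \<bar>Im s\<bar>)" .
  qed auto
qed

lemma strip_decay_mult:
  assumes "strip_decay \<mu> f" "strip_decay \<mu>' g"
  shows "strip_decay (\<mu> + \<mu>') (\<lambda>s. f s * g s)"
  unfolding strip_decay_def
proof (intro allI impI)
  fix \<nu> S assume \<nu>: "\<nu> < \<mu> + \<mu>'"
  \<comment> \<open>Each factor gives up half of the available slack.\<close>
  define e where "e = (\<mu> + \<mu>' - \<nu>) / 2"
  have e: "e > 0" "(\<mu> - e) + (\<mu>' - e) = \<nu>" using \<nu> by (auto simp: e_def field_simps)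
  obtain C T where 1: "C > 0" "T > 0"
    "\<And>s. \<bar>Re s\<bar> \<le> S \<Longrightarrow> T \<le> \<bar>Im s\<bar> \<Longrightarrow> norm (f s) \<le> C * exp (- (\<mu> - e) * \<bar>Im s\<bar>)"
    using strip_decayD[OF assms(1), of "\<mu> - e" S] e by auto
  obtain C' T' where 2: "C' > 0" "T' > 0"
    "\<And>s. \<bar>Re s\<bar> \<le> S \<Longrightarrow> T' \<le> \<bar>Im s\<bar> \<Longrightarrow> norm (g s) \<le> C' * exp (- (\<mu>' - e) * \<bar>Im s\<bar>)"
    using strip_decayD[OF assms(2), of "\<mu>' - e" S] e by auto
  show "\<exists>C T. \<forall>s. \<bar>Re s\<bar> \<le> S \<longrightarrow> T \<le> \<bar>Im s\<bar> \<longrightarrow> norm (f s * g s) \<le> C * exp (- \<nu> * \<bar>Im s\<bar>)"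
  proof (rule exI[of _ "C * C'"], rule exI[of _ "max T T'"], intro allI impI)
    fix s assume s: "\<bar>Re s\<bar> \<le> S" "max T T' \<le> \<bar>Im s\<bar>"
    have "norm (f s * g s) \<le> (C * exp (- (\<mu> - e) * \<bar>Im s\<bar>)) * (C' * exp (- (\<mu>' - e) * \<bar>Im s\<bar>))"
      unfolding norm_mult using s 1 2 by (intro mult_mono) auto
    also have "\<dots> = C * C' * exp (- (\<mu> - e) * \<bar>Im s\<bar> + - (\<mu>' - e) * \<bar>Im s\<bar>)"
      unfolding exp_add by simp
    also have "\<dots> = C * C' * exp (- \<nu> * \<bar>Im s\<bar>)"
      unfolding e(2)[symmetric] by (simp add: algebra_simps)
    finally show "norm (f s * g s) \<le> C * C' * exp (- \<nu> * \<bar>Im s\<bar>)" .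
  qed
qed

lemma strip_decay_prod:
  fixes h :: "nat \<Rightarrow> complex \<Rightarrow> complex"
  assumes "\<And>l. strip_decay \<mu> (h l)"
  shows "strip_decay (real n * \<mu>) (\<lambda>s. \<Prod>l<n. h l s)"
proof (induction n)
  case 0
  show ?case unfolding strip_decay_def
    by (auto intro!: exI[of _ 1] simp: mult_nonneg_nonneg mult_nonpos_nonneg)
next
  case (Suc n)
  have "strip_decay (real n * \<mu> + \<mu>) (\<lambda>s. (\<Prod>l<n. h l s) * h n s)"
    by (intro strip_decay_mult Suc assms)
  thus ?case by (simp add: algebra_simps)
qed

text \<open>Moving |Im s| by at most r costs only the constant factor exp(|nu| r), and the strip is
  widened by r. Translations and reflections of the argument are the two cases of interest.\<close>

lemma strip_decay_compose:
  fixes h :: "complex \<Rightarrow> complex" and g :: "complex \<Rightarrow> complex"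
  assumes h: "strip_decay \<mu> h" and Re: "\<And>s. \<bar>Re (g s)\<bar> \<le> \<bar>Re s\<bar> + r"
    and Im: "\<And>s. \<bar>\<bar>Im (g s)\<bar> - \<bar>Im s\<bar>\<bar> \<le> r"
  shows "strip_decay \<mu> (\<lambda>s. h (g s))"
  unfolding strip_decay_def
proof (intro allI impI)
  fix \<nu> S assume \<nu>: "\<nu> < \<mu>"
  obtain C T where 1: "C > 0" "T > 0"
    "\<And>s. \<bar>Re s\<bar> \<le> S + r \<Longrightarrow> T \<le> \<bar>Im s\<bar> \<Longrightarrow> norm (h s) \<le> C * exp (- \<nu> * \<bar>Im s\<bar>)"
    using strip_decayD[OF h \<nu>] by metis
  show "\<exists>C T. \<forall>s. \<bar>Re s\<bar> \<le> S \<longrightarrow> T \<le> \<bar>Im s\<bar> \<longrightarrow> norm (h (g s)) \<le> C * exp (- \<nu> * \<bar>Im s\<bar>)"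
  proof (rule exI[of _ "C * exp (\<bar>\<nu>\<bar> * r)"], rule exI[of _ "T + r"], intro allI impI)
    fix s assume s: "\<bar>Re s\<bar> \<le> S" "T + r \<le> \<bar>Im s\<bar>"
    have "norm (h (g s)) \<le> C * exp (- \<nu> * \<bar>Im (g s)\<bar>)"
      using s Re[of s] Im[of s] by (intro 1) auto
    moreover have "- \<nu> * \<bar>Im (g s)\<bar> \<le> \<bar>\<nu>\<bar> * r + - \<nu> * \<bar>Im s\<bar>"
    proof -
      have "- \<nu> * (\<bar>Im (g s)\<bar> - \<bar>Im s\<bar>) \<le> \<bar>\<nu>\<bar> * \<bar>\<bar>Im (g s)\<bar> - \<bar>Im s\<bar>\<bar>"
        using abs_ge_self[of "- \<nu> * (\<bar>Im (g s)\<bar> - \<bar>Im s\<bar>)"] by (simp only: abs_mult abs_minus_cancel)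
      also have "\<dots> \<le> \<bar>\<nu>\<bar> * r" using Im by (intro mult_left_mono) auto
      finally show ?thesis by (simp add: algebra_simps)
    qed
    hence "C * exp (- \<nu> * \<bar>Im (g s)\<bar>) \<le> C * exp (\<bar>\<nu>\<bar> * r + - \<nu> * \<bar>Im s\<bar>)"
      using 1 by (intro mult_left_mono) auto
    ultimately show "norm (h (g s)) \<le> C * exp (\<bar>\<nu>\<bar> * r) * exp (- \<nu> * \<bar>Im s\<bar>)"
      unfolding exp_add mult.assoc by (rule order_trans)
  qed
qed

lemma strip_decay_shift:
  assumes "strip_decay \<mu> h" shows "strip_decay \<mu> (\<lambda>s. h (s + a))"
proof (rule strip_decay_compose[OF assms, where r = "norm a"])
  fix s
  show "\<bar>Re (s + a)\<bar> \<le> \<bar>Re s\<bar> + norm a" using abs_Re_le_cmod[of a] by simp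
  show "\<bar>\<bar>Im (s + a)\<bar> - \<bar>Im s\<bar>\<bar> \<le> norm a" using abs_Im_le_cmod[of a] by simp
qed

lemma strip_decay_reflect:
  assumes "strip_decay \<mu> h" shows "strip_decay \<mu> (\<lambda>s. h (a - s))"
proof (rule strip_decay_compose[OF assms, where r = "norm a"])
  fix s
  show "\<bar>Re (a - s)\<bar> \<le> \<bar>Re s\<bar> + norm a" using abs_Re_le_cmod[of a] by simp
  show "\<bar>\<bar>Im (a - s)\<bar> - \<bar>Im s\<bar>\<bar> \<le> norm a" using abs_Im_le_cmod[of a] by simp
qed

text \<open>A negative rate permits growth. Added to the rate of the Gamma factors, it produces the
  sector condition on Im zeta, the argument of -kappa x.\<close>

lemma strip_decay_exp: "strip_decay (- \<bar>Im \<zeta>\<bar>) (\<lambda>s. exp (s * \<zeta>))"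
  unfolding strip_decay_def
proof (intro allI impI exI)
  fix \<nu> S and s :: complex assume \<nu>: "\<nu> < - \<bar>Im \<zeta>\<bar>" and s: "\<bar>Re s\<bar> \<le> S" "0 \<le> \<bar>Im s\<bar>"
  have "Re s * Re \<zeta> \<le> \<bar>Re s\<bar> * \<bar>Re \<zeta>\<bar>"
    using abs_ge_self[of "Re s * Re \<zeta>"] by (simp only: abs_mult)
  moreover have "\<bar>Re s\<bar> * \<bar>Re \<zeta>\<bar> \<le> S * \<bar>Re \<zeta>\<bar>"
    using s by (intro mult_right_mono) auto
  moreover have "- Im s * Im \<zeta> \<le> \<bar>Im s\<bar> * \<bar>Im \<zeta>\<bar>"
    using abs_ge_self[of "- Im s * Im \<zeta>"] by (simp only: abs_mult abs_minus_cancel)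
  moreover have "\<bar>Im s\<bar> * \<bar>Im \<zeta>\<bar> \<le> \<bar>Im s\<bar> * (- \<nu>)"
    using \<nu> by (intro mult_left_mono) auto
  ultimately have "Re (s * \<zeta>) \<le> S * \<bar>Re \<zeta>\<bar> + - \<nu> * \<bar>Im s\<bar>" by (simp add: mult_ac)
  thus "norm (exp (s * \<zeta>)) \<le> exp (S * \<bar>Re \<zeta>\<bar>) * exp (- \<nu> * \<bar>Im s\<bar>)"
    by (simp flip: exp_add)
qed

text \<open>The point is moved right into Re >= 1, compared at equal height with the abscissa m +
  1/2, and brought back to Re = 1/2 by the functional equation. The last move costs a polynomial in
  |t|, which exp(\<open>\<epsilon>\<close> |t|) absorbs.\<close>

lemma strip_decay_Gamma: "strip_decay (pi/2) Gamma"
  unfolding strip_decay_def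
proof (intro allI impI)
  fix \<nu> S :: real assume \<nu>: "\<nu> < pi/2"
  define \<epsilon> where "\<epsilon> = pi/2 - \<nu>"
  have \<epsilon>: "\<epsilon> > 0" using \<nu> by (simp add: \<epsilon>_def)
  \<comment> \<open>Adding n carries the strip |Re z| <= S into 1 <= Re <= 2 n = m, where the real
    Gamma function is bounded.\<close>
  define n where "n = nat \<lceil>\<bar>S\<bar>\<rceil> + 1"
  have n: "real n \<ge> \<bar>S\<bar> + 1" unfolding n_def by linarith
  define m where "m = 2 * n"
  have "bounded (Gamma ` {1..real m})"
    by (rule compact_imp_bounded, intro compact_continuous_image continuous_intros) (auto elim!: nonpos_Ints_cases)
  then obtain K where K: "\<And>x. x \<in> {1..real m} \<Longrightarrow> norm (Gamma x) \<le> K"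
    unfolding bounded_iff by (metis imageI)
  have "1 \<in> {1..real m}" using n by (simp add: m_def)
  hence K0: "K \<ge> 0" using K norm_ge_zero order_trans by blast
  define C where "C = fact m * exp (\<epsilon> * (real m + 1)) / \<epsilon> ^ m * sqrt (2 * pi) * K / Gamma (real m + 1/2)"
  show "\<exists>C T. \<forall>s. \<bar>Re s\<bar> \<le> S \<longrightarrow> T \<le> \<bar>Im s\<bar> \<longrightarrow> norm (Gamma s) \<le> C * exp (- \<nu> * \<bar>Im s\<bar>)"
  proof (rule exI[of _ C], rule exI[of _ 1], intro allI impI)
    fix z :: complex assume z: "\<bar>Re z\<bar> \<le> S" "1 \<le> \<bar>Im z\<bar>"
    define t where "t = Im z"
    have nz: "z \<notin> \<int>\<^sub>\<le>\<^sub>0" using z by (auto elim!: nonpos_Ints_cases)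
    \<comment> \<open>For |Im z| >= 1 every factor z + i has modulus at least 1, so shifting to the
      right can only increase |Gamma|.\<close>
    have "1 \<le> norm (pochhammer z n)"
      unfolding pochhammer_prod prod_norm[symmetric]
    proof (rule prod_ge_1)
      fix i show "1 \<le> norm (z + of_nat i)" using abs_Im_le_cmod[of "z + of_nat i"] z by simp
    qed
    moreover have "pochhammer z n * Gamma z = Gamma (z + of_nat n)"
      using pochhammer_Gamma[OF nz, of n] Gamma_nonzero[OF nz] by simp
    ultimately have 1: "norm (Gamma z) \<le> norm (Gamma (z + of_nat n))"
      by (metis mult_right_mono norm_ge_zero norm_mult mult_1)
    define w where "w = z + of_nat n"
    have w: "Re w \<ge> 1" "Re w \<le> real m" "Im w = t" using z n by (auto simp: w_def m_def t_def)
    \<comment> \<open>The shift that lands on the abscissa m + 1/2, an integer distance away from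
      the line where the modulus is known.\<close>
    define \<delta> where "\<delta> = real m + 1/2 - Re w"
    have \<delta>: "\<delta> \<ge> 0" "Re w + \<delta> = real m + 1/2" using w by (auto simp: \<delta>_def)
    have wd: "w + of_real \<delta> = Complex (1/2) t + of_nat m"
      using w by (simp add: complex_eq_iff \<delta>_def)
    have 2: "norm (Gamma w) * Gamma (real m + 1/2) \<le> norm (Gamma (Complex (1/2) t + of_nat m)) * K"
    proof -
      have "norm (Gamma w) * Gamma (Re w + \<delta>) \<le> norm (Gamma (w + of_real \<delta>)) * Gamma (Re w)"
        using w \<delta> by (intro norm_Gamma_mult_le_shift) auto
      also have "\<dots> \<le> norm (Gamma (w + of_real \<delta>)) * K"
        using K[of "Re w"] w by (intro mult_left_mono) auto
      finally show ?thesis unfolding wd \<delta>(2) .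
    qed
    have hz: "Complex (1/2) t \<notin> \<int>\<^sub>\<le>\<^sub>0" using z by (auto elim!: nonpos_Ints_cases simp: t_def complex_eq_iff)
    have "norm (pochhammer (Complex (1/2) t) m) \<le> (\<Prod>i=0..<m. real m + 1 + \<bar>t\<bar>)"
      unfolding pochhammer_prod prod_norm[symmetric]
    proof (rule prod_mono, intro conjI)
      fix i assume "i \<in> {0..<m}"
      have "norm (Complex (1/2) t + of_nat i) \<le> \<bar>Re (Complex (1/2) t + of_nat i)\<bar> + \<bar>Im (Complex (1/2) t + of_nat i)\<bar>"
        by (rule cmod_le)
      also have "\<dots> \<le> real m + 1 + \<bar>t\<bar>" using \<open>i \<in> {0..<m}\<close> by simp
      finally show "norm (Complex (1/2) t + of_nat i) \<le> real m + 1 + \<bar>t\<bar>" .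
    qed auto
    also have "\<dots> = (\<epsilon> * (real m + 1 + \<bar>t\<bar>)) ^ m / \<epsilon> ^ m"
      using \<epsilon> by (simp add: power_mult_distrib)
    also have "\<dots> \<le> fact m * exp (\<epsilon> * (real m + 1 + \<bar>t\<bar>)) / \<epsilon> ^ m"
      using \<epsilon> by (intro divide_right_mono power_le_fact_mult_exp) auto
    finally have 3: "norm (pochhammer (Complex (1/2) t) m) \<le> fact m * exp (\<epsilon> * (real m + 1 + \<bar>t\<bar>)) / \<epsilon> ^ m" .
    have "Gamma (Complex (1/2) t + of_nat m) = pochhammer (Complex (1/2) t) m * Gamma (Complex (1/2) t)"
      using pochhammer_Gamma[OF hz, of m] Gamma_nonzero[OF hz] by simp
    hence "norm (Gamma (Complex (1/2) t + of_nat m)) \<le>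
       (fact m * exp (\<epsilon> * (real m + 1 + \<bar>t\<bar>)) / \<epsilon> ^ m) * (sqrt (2 * pi) * exp (- (pi/2) * \<bar>t\<bar>))"
      unfolding norm_mult[symmetric] using 3 norm_Gamma_half_le[of t] \<epsilon>
      by (simp only: norm_mult) (intro mult_mono, auto)
    also have "\<dots> = fact m * exp (\<epsilon> * (real m + 1)) / \<epsilon> ^ m * sqrt (2 * pi) * exp (- \<nu> * \<bar>t\<bar>)"
    proof -
      have "exp (\<epsilon> * (real m + 1 + \<bar>t\<bar>)) * exp (- (pi/2) * \<bar>t\<bar>) = exp (\<epsilon> * (real m + 1)) * exp (- \<nu> * \<bar>t\<bar>)"
        unfolding exp_add[symmetric] by (simp add: \<epsilon>_def algebra_simps)
      thus ?thesis by (simp add: mult_ac)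
    qed
    finally have "norm (Gamma (Complex (1/2) t + of_nat m)) * K \<le>
       fact m * exp (\<epsilon> * (real m + 1)) / \<epsilon> ^ m * sqrt (2 * pi) * exp (- \<nu> * \<bar>t\<bar>) * K"
      by (rule mult_right_mono[OF _ K0])
    hence "norm (Gamma w) * Gamma (real m + 1/2) \<le> C * exp (- \<nu> * \<bar>t\<bar>) * Gamma (real m + 1/2)"
      using 2 Gamma_real_pos[of "real m + 1/2"] by (simp add: C_def mult_ac)
    hence "norm (Gamma w) \<le> C * exp (- \<nu> * \<bar>t\<bar>)"
      using Gamma_real_pos[of "real m + 1/2"] by (simp add: mult_le_cancel_right)
    thus "norm (Gamma z) \<le> C * exp (- \<nu> * \<bar>Im z\<bar>)" using 1 by (simp add: w_def t_def)
  qed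
qed

lemma norm_sin_le_exp: "norm (sin z) \<le> exp \<bar>Im (z::complex)\<bar>"
proof -
  have "sin z = (exp (\<i> * z) - exp (- \<i> * z)) / (2 * \<i>)"
    using sin_exp_eq by simp
  hence "norm (sin z) \<le> (norm (exp (\<i> * z)) + norm (exp (- \<i> * z))) / 2"
    using norm_triangle_ineq4[of "exp (\<i> * z)" "exp (- \<i> * z)"]
    by (simp add: norm_divide norm_mult)
  also have "\<dots> = (exp (- Im z) + exp (Im z)) / 2" by simp
  also have "\<dots> \<le> (exp \<bar>Im z\<bar> + exp \<bar>Im z\<bar>) / 2"
    by (intro divide_right_mono add_mono) auto
  finally show ?thesis by simp
qed

lemma rGamma_conv_Gamma_reflect:
  assumes "(1 - z :: complex) \<notin> \<int>\<^sub>\<le>\<^sub>0"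
  shows "rGamma z = Gamma (1 - z) * sin (of_real pi * z) / of_real pi"
proof -
  have "rGamma (1 - z) * Gamma (1 - z) = 1"
    using Gamma_nonzero[OF assms] by (simp add: rGamma_inverse_Gamma)
  thus ?thesis using rGamma_reflection_complex[of z] by (simp add: field_simps)
    (metis mult.assoc mult.commute mult_1)
qed

text \<open>By reflection the reciprocal is Gamma(1 - z) sin(pi z) / pi: decay of rate pi/2 against
  growth of rate pi leaves growth of rate pi/2.\<close>

lemma strip_decay_rGamma: "strip_decay (- pi/2) rGamma"
proof -
  have s: "strip_decay (-pi) (\<lambda>z. sin (of_real pi * z) / of_real pi)"
    unfolding strip_decay_def
  proof (intro allI impI exI)
    fix \<nu> S and s :: complex assume \<nu>: "\<nu> < -pi"
    have "norm (sin (of_real pi * s) / of_real pi) \<le> exp (pi * \<bar>Im s\<bar>) / pi"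
      using norm_sin_le_exp[of "of_real pi * s"] by (simp add: norm_divide divide_right_mono abs_mult)
    also have "\<dots> \<le> exp (-\<nu> * \<bar>Im s\<bar>) / pi"
      using mult_right_mono[of pi "-\<nu>" "\<bar>Im s\<bar>"] \<nu> by (auto intro!: divide_right_mono)
    finally show "norm (sin (of_real pi * s) / of_real pi) \<le> 1 / pi * exp (- \<nu> * \<bar>Im s\<bar>)" by simp
  qed
  have *: "strip_decay (pi/2 + - pi) (\<lambda>z. Gamma (1 - z) * (sin (of_real pi * z) / of_real pi))"
    by (intro strip_decay_mult s strip_decay_reflect strip_decay_Gamma)
  show ?thesis
    unfolding strip_decay_def
  proof (intro allI impI)
    fix \<nu> S :: real assume \<nu>: "\<nu> < - pi/2"
    hence \<nu>: "\<nu> < pi/2 + - pi" by simp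
    obtain C T where CT: "C > 0" "T > 0" "\<And>s. \<bar>Re s\<bar> \<le> S \<Longrightarrow> T \<le> \<bar>Im s\<bar> \<Longrightarrow>
       norm (Gamma (1 - s) * (sin (of_real pi * s) / of_real pi)) \<le> C * exp (- \<nu> * \<bar>Im s\<bar>)"
      using strip_decayD[OF * \<nu>, of S] by metis
    show "\<exists>C T. \<forall>s. \<bar>Re s\<bar> \<le> S \<longrightarrow> T \<le> \<bar>Im s\<bar> \<longrightarrow> norm (rGamma s) \<le> C * exp (- \<nu> * \<bar>Im s\<bar>)"
    proof (rule exI[of _ C], rule exI[of _ T], intro allI impI)
      fix s assume s: "\<bar>Re s\<bar> \<le> S" "T \<le> \<bar>Im s\<bar>"
      have "1 - s \<notin> \<int>\<^sub>\<le>\<^sub>0" using s CT by (auto elim!: nonpos_Ints_cases simp: complex_eq_iff)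
      from CT(3)[OF s] show "norm (rGamma s) \<le> C * exp (- \<nu> * \<bar>Im s\<bar>)"
        unfolding rGamma_conv_Gamma_reflect[OF \<open>1 - s \<notin> \<int>\<^sub>\<le>\<^sub>0\<close>] by simp
    qed
  qed
qed

section \<open>Integrals over infinite contours\<close>

lemma integrable_exp_minus_abs:
  assumes "\<delta> > 0"
  shows "(\<lambda>t::real. exp (- \<delta> * \<bar>t\<bar>)) integrable_on UNIV"
proof -
  have 1: "(\<lambda>t::real. exp (- \<delta> * \<bar>t\<bar>)) integrable_on {0..}"
    using integrable_on_exp_minus_to_infinity[OF assms, of 0]
    by (rule integrable_eq) auto
  have 2: "(\<lambda>t::real. exp (- \<delta> * \<bar>t\<bar>)) integrable_on {..0}"
  proof -
    have "(\<lambda>t::real. exp (- \<delta> * \<bar>t\<bar>)) absolutely_integrable_on {0..}"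
      by (rule nonnegative_absolutely_integrable_1[OF 1]) simp
    hence "(\<lambda>t::real. exp (- \<delta> * \<bar>-t\<bar>)) absolutely_integrable_on {..0}"
      using has_absolute_integral_reflect_real[of "{..0}" "{0..}" "\<lambda>t. exp (- \<delta> * \<bar>t\<bar>)"]
      by auto
    thus ?thesis using absolutely_integrable_on_def by auto
  qed
  have "{..0} \<union> {0..} = (UNIV::real set)" by auto
  moreover have "{..0} \<inter> {0..} = {0::real}" by auto
  ultimately show ?thesis
    using integrable_Un[OF _ 2 1] by (simp add: negligible_finite)
qed

text \<open>The gauge integral over the line is by its definition a limit over large intervals, so
  symmetric truncations converge without absolute integrability.\<close>

lemma integral_symmetric_tendsto:
  fixes g :: "real \<Rightarrow> complex"
  assumes "g integrable_on UNIV"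
  shows "((\<lambda>R. integral {-R..R} g) \<longlongrightarrow> integral UNIV g) at_top"
proof (rule tendstoI)
  fix e :: real assume "e > 0"
  then obtain B where B: "B > 0" "\<And>a b. ball 0 B \<subseteq> cbox a b \<Longrightarrow>
     \<exists>z. (g has_integral z) (cbox a b) \<and> norm (z - integral UNIV g) < e"
    using has_integral_altD[OF integrable_integral[OF assms] _ \<open>e > 0\<close>] by auto
  show "\<forall>\<^sub>F R in at_top. dist (integral {-R..R} g) (integral UNIV g) < e"
    using eventually_ge_at_top[of B]
  proof eventually_elim
    case (elim R)
    have "ball 0 B \<subseteq> cbox (-R) R" using elim by (auto simp: dist_real_def)
    from B(2)[OF this] show ?case by (auto simp: dist_norm dest: integral_unique)
  qed
qed

text \<open>The middle part \<open>m\<close> is split off because only Henstock-Kurzweil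
  integrability is known there; what remains is dominated by an integrable exponential.\<close>

lemma integrable_on_UNIV_exp_tails:
  fixes g :: "real \<Rightarrow> complex"
  assumes loc: "\<And>R. R > 0 \<Longrightarrow> g integrable_on {-R..R}"
    and bnd: "\<And>t. T \<le> \<bar>t\<bar> \<Longrightarrow> norm (g t) \<le> C * exp (- \<delta> * \<bar>t\<bar>)" and "\<delta> > 0"
  shows "g integrable_on UNIV"
proof -
  have int: "g integrable_on cbox a b" for a b
    by (rule integrable_on_subcbox[OF loc[of "max \<bar>a\<bar> \<bar>b\<bar> + 1"]]) auto
  define m where "m = (\<lambda>t. if t \<in> {-T..T} then g t else 0)"
  have m: "m integrable_on UNIV"
    unfolding m_def integrable_restrict_UNIV using int[of "-T" T] by simp
  have "(\<lambda>t. g t - m t) integrable_on UNIV"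
  proof (rule integrable_on_all_intervals_UNIV)
    show "(\<lambda>t. g t - m t) integrable_on cbox a b" for a b
      by (intro integrable_diff int integrable_on_subcbox[OF m]) auto
    show "norm (g t - m t) \<le> \<bar>C\<bar> * exp (- \<delta> * \<bar>t\<bar>)" for t
    proof (cases "t \<in> {-T..T}")
      case False
      hence "norm (g t - m t) \<le> C * exp (- \<delta> * \<bar>t\<bar>)" using bnd[of t] by (auto simp: m_def)
      also have "\<dots> \<le> \<bar>C\<bar> * exp (- \<delta> * \<bar>t\<bar>)" by (intro mult_right_mono) auto
      finally show ?thesis .
    qed (simp add: m_def)
    show "(\<lambda>t. \<bar>C\<bar> * exp (- \<delta> * \<bar>t\<bar>)) integrable_on UNIV"
      by (intro integrable_on_mult_right integrable_exp_minus_abs \<open>\<delta> > 0\<close>)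
  qed
  from integrable_add[OF this m] show ?thesis by simp
qed

section \<open>Location of the poles and the residue sum of a closed loop\<close>

lemma right_poles_altdef: "right_poles k = range (\<lambda>n. of_int (1 - k) + of_nat n)"
  unfolding right_poles_def by auto

text \<open>The abscissa lies midway between the right poles numbered N - 1 and N.\<close>

lemma right_pole_Re_less_iff:
  fixes k :: int and n N :: nat
  defines "p \<equiv> of_int (1 - k) + of_nat n :: complex"
  shows "Re p < 1 - of_int k + real N - 1/2 \<longleftrightarrow> n < N" "Re p \<noteq> 1 - of_int k + real N - 1/2" "Im p = 0"
proof -
  have e: "Re p = 1 - of_int k + real n" and "Im p = 0" by (simp_all add: p_def)
  show "Im p = 0" by fact
  have "n < N \<Longrightarrow> real n + 1 \<le> real N" "\<not> n < N \<Longrightarrow> real n \<ge> real N" by linarith+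
  thus "Re p < 1 - of_int k + real N - 1/2 \<longleftrightarrow> n < N" "Re p \<noteq> 1 - of_int k + real N - 1/2"
    unfolding e by (cases "n < N"; simp)+
qed

lemma finite_right_poles_Int_ball: "finite (right_poles k \<inter> ball 0 r)"
proof -
  have "right_poles k \<inter> ball 0 r \<subseteq> (\<lambda>n. of_int (1 - k) + of_nat n) ` {..nat \<lceil>r + \<bar>1 - k\<bar>\<rceil>}"
  proof
    fix p assume p: "p \<in> right_poles k \<inter> ball 0 r"
    then obtain n where n: "p = of_int (1 - k) + of_nat n" by (auto simp: right_poles_altdef)
    have "Re p \<le> norm p" by (rule complex_Re_le_cmod)
    moreover have "Re p = 1 - real_of_int k + real n" "norm p < r" using p n by auto
    ultimately have "real n \<le> r + \<bar>1 - k\<bar>" by linarith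
    hence "n \<le> nat \<lceil>r + \<bar>1 - k\<bar>\<rceil>" by linarith
    thus "p \<in> (\<lambda>n. of_int (1 - k) + of_nat n) ` {..nat \<lceil>r + \<bar>1 - k\<bar>\<rceil>}" using n by blast
  qed
  thus ?thesis by (rule finite_subset) auto
qed

lemma finite_left_poles_Re_ge: "finite (left_poles L \<beta> c \<inter> {s. Re s \<ge> A})"
proof -
  have "left_poles L \<beta> c \<inter> {s. Re s \<ge> A} \<subseteq>
      (\<Union>l<L. (\<lambda>i. - of_nat i - 1 / (\<beta> * c l)) ` {..nat \<lceil>- A - Re (1 / (\<beta> * c l))\<rceil>})"
  proof
    fix p assume "p \<in> left_poles L \<beta> c \<inter> {s. Re s \<ge> A}"
    then obtain i l where p: "p = - of_nat i - 1 / (\<beta> * c l)" "l < L" "Re p \<ge> A"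
      by (auto simp: left_poles_def)
    hence "real i \<le> - A - Re (1 / (\<beta> * c l))" by simp
    hence "i \<le> nat \<lceil>- A - Re (1 / (\<beta> * c l))\<rceil>" by linarith
    thus "p \<in> (\<Union>l<L. (\<lambda>i. - of_nat i - 1 / (\<beta> * c l)) ` {..nat \<lceil>- A - Re (1 / (\<beta> * c l))\<rceil>})"
      using p by blast
  qed
  thus ?thesis by (rule finite_subset) auto
qed

lemma finite_left_poles_Int_ball: "finite (left_poles L \<beta> c \<inter> ball 0 r)"
proof (rule finite_subset[OF _ finite_left_poles_Re_ge[of L \<beta> c "-r"]])
  show "left_poles L \<beta> c \<inter> ball 0 r \<subseteq> left_poles L \<beta> c \<inter> {s. - r \<le> Re s}"
  proof safe
    fix x :: complex assume "x \<in> ball 0 r"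
    thus "- r \<le> Re x" using abs_Re_le_cmod[of x] by simp
  qed
qed

text \<open>The variable enters Gamma with a minus sign, so the residue at pole n is -(-1)^n / n!
  times the value of H. The winding number -1 of a clockwise loop cancels this sign.\<close>

lemma loop_integral_Gamma_mult:
  fixes k :: int and H :: "complex \<Rightarrow> complex" and N :: nat and LP :: "complex set"
  defines "rp \<equiv> (\<lambda>n::nat. of_int (1 - k) + of_nat n :: complex)"
  assumes LP: "\<And>r. finite (LP \<inter> ball 0 r)" and hol: "H holomorphic_on - LP"
    and disj: "right_poles k \<inter> LP = {}"
    and P: "valid_path P" "pathfinish P = pathstart P"
           "path_image P \<inter> (right_poles k \<union> LP) = {}"
    and w1: "\<And>n. n < N \<Longrightarrow> winding_number P (rp n) = -1"
    and w2: "\<And>n. n \<ge> N \<Longrightarrow> winding_number P (rp n) = 0"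
    and w3: "\<And>p. p \<in> LP \<Longrightarrow> winding_number P p = 0"
  shows "contour_integral P (\<lambda>s. Gamma (1 - of_int k - s) * H s)
           = 2 * of_real pi * \<i> * (\<Sum>n<N. (-1) ^ n / fact n * H (rp n))"
proof -
  let ?f = "\<lambda>s. Gamma (1 - of_int k - s) * H s"
  have "bounded (path_image P)" using P(1) by (simp add: bounded_path_image valid_path_imp_path)
  then obtain r where r: "path_image P \<subseteq> ball 0 r"
    by (metis bounded_subset_ballD)
  \<comment> \<open>The residue theorem takes finitely many singularities. A ball around the path
    contains only finitely many poles, and the path winds around nothing outside it.\<close>
  define pts where "pts = (right_poles k \<union> LP) \<inter> ball 0 r"
  have fin: "finite pts" unfolding pts_def Int_Un_distrib2
    using LP finite_right_poles_Int_ball by auto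
  have hol': "?f holomorphic_on ball 0 r - pts"
  proof (intro holomorphic_intros)
    show "1 - of_int k - z \<notin> \<int>\<^sub>\<le>\<^sub>0" if "z \<in> ball 0 r - pts" for z
    proof
      assume "1 - of_int k - z \<in> \<int>\<^sub>\<le>\<^sub>0"
      then obtain n where "1 - of_int k - z = - of_nat n" by (auto elim!: nonpos_Ints_cases')
      hence "z = of_int (1 - k) + of_nat n" by (simp add: algebra_simps)
      hence "z \<in> right_poles k" unfolding right_poles_altdef by blast
      thus False using that by (auto simp: pts_def)
    qed
    show "H holomorphic_on ball 0 r - pts"
      by (rule holomorphic_on_subset[OF hol]) (auto simp: pts_def)
  qed
  have out: "winding_number P z = 0" if "z \<notin> ball 0 r" for z
    using r P that by (intro winding_number_zero_outside[of P "ball 0 r"]) (auto simp: valid_path_imp_path)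
  have res: "residue ?f (rp n) = - ((-1) ^ n / fact n * H (rp n))" if "rp n \<in> ball 0 r" for n
  proof (rule residue_simple'[where s = "ball 0 r - (pts - {rp n})"])
    have rpin: "rp n \<in> right_poles k" by (simp add: rp_def right_poles_altdef)
    show "open (ball 0 r - (pts - {rp n}))" using fin by (intro open_Diff finite_imp_closed) auto
    show "rp n \<in> ball 0 r - (pts - {rp n})" using that by auto
    have "ball 0 r - (pts - {rp n}) - {rp n} \<subseteq> ball 0 r - pts" by auto
    thus "?f holomorphic_on ball 0 r - (pts - {rp n}) - {rp n}"
      using hol' holomorphic_on_subset by blast
    have "open (ball 0 r - (LP \<inter> ball 0 r))" using LP by (intro open_Diff finite_imp_closed) auto
    moreover have "rp n \<in> ball 0 r - (LP \<inter> ball 0 r)" using that disj rpin by auto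
    moreover have "continuous_on (ball 0 r - (LP \<inter> ball 0 r)) H"
      by (rule continuous_on_subset[OF holomorphic_on_imp_continuous_on[OF hol]]) auto
    ultimately have "isCont H (rp n)" using continuous_on_eq_continuous_at by blast
    hence Hlim: "H \<midarrow>rp n\<rightarrow> H (rp n)" by (simp add: isCont_def)
    have "filterlim (\<lambda>w. 1 - of_int k - w) (at (- of_nat n)) (at (rp n))"
    proof (rule filterlim_atI)
      have "((\<lambda>w. 1 - of_int k - w) \<longlongrightarrow> 1 - of_int k - rp n) (at (rp n))"
        by (intro tendsto_intros)
      thus "((\<lambda>w. 1 - of_int k - w) \<longlongrightarrow> - of_nat n) (at (rp n))" by (simp add: rp_def)
      show "\<forall>\<^sub>F w in at (rp n). 1 - of_int k - w \<noteq> - of_nat n"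
        by (auto simp: eventually_at_filter rp_def algebra_simps)
    qed
    from filterlim_compose[OF Gamma_residues this]
    have "(\<lambda>w. Gamma (1 - of_int k - w) * (1 - of_int k - w + of_nat n)) \<midarrow>rp n\<rightarrow> (- 1) ^ n / fact n" .
    hence "(\<lambda>w. - (Gamma (1 - of_int k - w) * (1 - of_int k - w + of_nat n) * H w)) \<midarrow>rp n\<rightarrow>
       - ((- 1) ^ n / fact n * H (rp n))"
      by (intro tendsto_intros Hlim)
    moreover have "(\<lambda>w. - (Gamma (1 - of_int k - w) * (1 - of_int k - w + of_nat n) * H w))
                   = (\<lambda>w. ?f w * (w - rp n))"
      by (auto simp: rp_def algebra_simps)
    ultimately show "(\<lambda>w. ?f w * (w - rp n)) \<midarrow>rp n\<rightarrow> - ((- 1) ^ n / fact n * H (rp n))" by simp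
  qed
  have in_ball: "rp n \<in> ball 0 r" if "n < N" for n
    using w1[OF that] out[of "rp n"] by auto
  have inj: "inj rp" by (auto simp: inj_on_def rp_def)
  have "contour_integral P ?f = 2 * pi * \<i> * (\<Sum>p\<in>pts. winding_number P p * residue ?f p)"
    by (rule Residue_theorem[where S = "ball 0 r"])
       (use fin hol' P r out in \<open>auto simp: pts_def\<close>)
  also have "(\<Sum>p\<in>pts. winding_number P p * residue ?f p)
           = (\<Sum>p\<in>rp ` {..<N}. winding_number P p * residue ?f p)"
  proof (rule sum.mono_neutral_right[OF fin])
    show "rp ` {..<N} \<subseteq> pts" using in_ball by (auto simp: pts_def right_poles_altdef rp_def)
    show "\<forall>p\<in>pts - rp ` {..<N}. winding_number P p * residue ?f p = 0"
    proof
      fix p assume p: "p \<in> pts - rp ` {..<N}"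
      have "winding_number P p = 0"
      proof (cases "p \<in> LP")
        case False
        then obtain n where "p = rp n" using p by (auto simp: pts_def right_poles_altdef rp_def)
        with p w2[of n] show ?thesis by (cases "n < N") auto
      qed (use w3 in auto)
      thus "winding_number P p * residue ?f p = 0" by simp
    qed
  qed
  also have "\<dots> = (\<Sum>n<N. winding_number P (rp n) * residue ?f (rp n))"
    by (subst sum.reindex) (use inj in \<open>auto intro: inj_on_subset\<close>)
  also have "\<dots> = (\<Sum>n<N. (-1) ^ n / fact n * H (rp n))"
    by (intro sum.cong refl) (simp only: lessThan_iff w1 res in_ball, simp)
  finally show ?thesis by simp
qed

section \<open>Truncations of an infinite contour as paths\<close>

lemma piecewise_C1_regular_contour:
  assumes "regular_contour \<gamma>" shows "\<gamma> piecewise_C1_differentiable_on {a..b}"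
proof -
  have "{a..b} \<subseteq> {-(max \<bar>a\<bar> \<bar>b\<bar>)..max \<bar>a\<bar> \<bar>b\<bar>}" by auto
  thus ?thesis using assms unfolding regular_contour_def by (meson piecewise_C1_differentiable_on_subset)
qed

lemma continuous_regular_contour:
  assumes "regular_contour \<gamma>" shows "continuous_on {a..b} \<gamma>"
  using piecewise_C1_regular_contour[OF assms] by (simp add: piecewise_C1_differentiable_on_def)

lemma valid_path_trunc_path:
  assumes "regular_contour \<gamma>" "R > 0" shows "valid_path (trunc_path \<gamma> R)"
proof -
  have "(\<gamma> \<circ> (\<lambda>x. (2 * R) *\<^sub>R x + - R)) piecewise_C1_differentiable_on {0..1}"
  proof (rule piecewise_C1_differentiable_affine)
    show "\<gamma> piecewise_C1_differentiable_on (\<lambda>x. 2 * R * x + - R) ` {0..1}"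
      unfolding image_affinity_atLeastAtMost using assms(1)
      by (auto intro: piecewise_C1_regular_contour)
  qed
  thus ?thesis by (simp add: valid_path_def trunc_path_def o_def add_ac)
qed

lemma pathstart_trunc_path [simp]: "pathstart (trunc_path \<gamma> R) = \<gamma> (- R)"
  and pathfinish_trunc_path [simp]: "pathfinish (trunc_path \<gamma> R) = \<gamma> R"
  by (simp_all add: trunc_path_def pathstart_def pathfinish_def)

lemma path_image_trunc_path:
  assumes "R > 0" shows "path_image (trunc_path \<gamma> R) = \<gamma> ` {-R..R}"
proof -
  have "(\<lambda>u. - R + 2 * R * u) ` {0..1} = {-R..R}"
    using assms image_affinity_atLeastAtMost[of "2*R" "-R" 0 1] by (simp add: add.commute)
  thus ?thesis unfolding path_image_def trunc_path_def by (metis image_image)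
qed

lemma regular_contour_differentiable_off_finite:
  assumes "regular_contour \<gamma>"
  obtains S where "finite S" "\<And>t. t \<in> {a..b} - S \<Longrightarrow> \<gamma> differentiable (at t)"
  using piecewise_C1_regular_contour[OF assms, of a b]
  unfolding piecewise_C1_differentiable_on_def C1_differentiable_on_eq by blast

text \<open>A path that is piecewise C1 in the sense of the library may have infinite length, so over bounded
  parameter intervals the integrals are only Henstock-Kurzweil integrals; absolute integrability is
  available on the straight ends alone.\<close>

lemma has_integral_trunc_path:
  assumes \<gamma>: "regular_contour \<gamma>" and R: "R > 0" and f: "f contour_integrable_on (trunc_path \<gamma> R)"
  shows "((\<lambda>t. f (\<gamma> t) * vector_derivative \<gamma> (at t)) has_integral contour_integral (trunc_path \<gamma> R) f) {-R..R}"
proof -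
  obtain S where S: "finite S" "\<And>t. t \<in> {-R..R} - S \<Longrightarrow> \<gamma> differentiable (at t)"
    using regular_contour_differentiable_off_finite[OF \<gamma>] by metis
  let ?g = "trunc_path \<gamma> R"
  have "((\<lambda>u. f (?g u) * vector_derivative ?g (at u)) has_integral contour_integral ?g f) (cbox 0 1)"
    using has_contour_integral_integral[OF f] unfolding has_contour_integral by simp
  \<comment> \<open>The substitution u = t / (2 R) + 1/2 inverts the parametrization of
    \<open>trunc_path\<close>; its Jacobian cancels the factor 2 R in the velocity.\<close>
  from has_integral_affinity[OF this, of "1/(2*R)" "1/2"]
  have "((\<lambda>t. f (?g (t/(2*R) + 1/2)) * vector_derivative ?g (at (t/(2*R) + 1/2))) has_integral
     (2 * R) *\<^sub>R contour_integral ?g f) ((\<lambda>x. 2 * R * x - R) ` {0..1})"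
    using R by (simp add: scaleR_conv_of_real)
  also have "(\<lambda>x. 2 * R * x - R) ` {0..1} = {-R..R}"
    using R image_affinity_atLeastAtMost[of "2*R" "-R" 0 1] by simp
  finally have "((\<lambda>t. inverse (2*R) *\<^sub>R (f (?g (t/(2*R) + 1/2)) * vector_derivative ?g (at (t/(2*R) + 1/2)))) has_integral
     inverse (2*R) *\<^sub>R ((2 * R) *\<^sub>R contour_integral ?g f)) {-R..R}"
    by (rule has_integral_cmul)
  hence *: "((\<lambda>t. inverse (2*R) *\<^sub>R (f (?g (t/(2*R) + 1/2)) * vector_derivative ?g (at (t/(2*R) + 1/2)))) has_integral
     contour_integral ?g f) {-R..R}"
    using R by simp
  show ?thesis
  proof (rule has_integral_spike_finite[OF S(1) _ *])
    fix t assume t: "t \<in> {-R..R} - S"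
    define u where "u = t/(2*R) + 1/2"
    have tu: "- R + 2 * R * u = t" using R by (simp add: u_def field_simps)
    have "(\<gamma> has_vector_derivative vector_derivative \<gamma> (at t)) (at (- R + 2 * R * u))"
      using S(2)[OF t] vector_derivative_works tu by metis
    moreover have "((\<lambda>u. - R + 2 * R * u) has_vector_derivative (2*R)) (at u)"
      by (auto intro!: derivative_eq_intros simp: has_vector_derivative_def has_real_derivative_iff_has_vector_derivative[symmetric])
    ultimately have "(\<gamma> \<circ> (\<lambda>u. - R + 2 * R * u) has_vector_derivative (2*R) *\<^sub>R vector_derivative \<gamma> (at t)) (at u)"
      by (rule vector_diff_chain_at[rotated])
    hence "vector_derivative ?g (at u) = (2*R) *\<^sub>R vector_derivative \<gamma> (at t)"
      by (simp add: trunc_path_def o_def vector_derivative_at)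
    moreover have "?g u = \<gamma> t" by (simp only: trunc_path_def tu)
    ultimately show "f (\<gamma> t) * vector_derivative \<gamma> (at t) =
       inverse (2*R) *\<^sub>R (f (?g (t/(2*R) + 1/2)) * vector_derivative ?g (at (t/(2*R) + 1/2)))"
      using R by (simp add: u_def[symmetric])
  qed
qed

section \<open>Winding numbers of the closed truncations\<close>

lemma closed_segment_same_Im:
  assumes "z \<in> closed_segment (Complex a y) (Complex b y)" shows "Im z = y" "Re z \<in> closed_segment a b"
proof -
  obtain u where u: "0 \<le> u" "u \<le> 1" "z = (1 - u) *\<^sub>R Complex a y + u *\<^sub>R Complex b y"
    using assms by (auto simp: closed_segment_def)
  show "Im z = y" by (simp add: u(3) algebra_simps)
  show "Re z \<in> closed_segment a b" using u(1,2) by (auto simp: u(3) closed_segment_def)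
qed

lemma closed_segment_same_Re:
  assumes "z \<in> closed_segment (Complex x a) (Complex x b)" shows "Re z = x" "Im z \<in> closed_segment a b"
proof -
  obtain u where u: "0 \<le> u" "u \<le> 1" "z = (1 - u) *\<^sub>R Complex x a + u *\<^sub>R Complex x b"
    using assms by (auto simp: closed_segment_def)
  show "Re z = x" by (simp add: u(3) algebra_simps)
  show "Im z \<in> closed_segment a b" using u(1,2) by (auto simp: u(3) closed_segment_def)
qed

text \<open>A linepath inside a convex set that avoids \<open>p\<close> contributes the increment of a branch of the
  logarithm, so the contributions of the sides of a polygon telescope.\<close>

lemma winding_number_linepath_primitive:
  assumes "convex S" "open S" "p \<notin> S"
  obtains \<phi> where "\<And>a b. a \<in> S \<Longrightarrow> b \<in> S \<Longrightarrow> winding_number (linepath a b) p = \<phi> b - \<phi> a"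
proof -
  have "(\<lambda>w. 1 / (w - p)) holomorphic_on S" using assms by (intro holomorphic_intros) auto
  then obtain \<psi> where \<psi>: "\<And>x. x \<in> S \<Longrightarrow> (\<psi> has_field_derivative 1 / (x - p)) (at x within S)"
    using holomorphic_convex_primitive' assms(1,2) by metis
  show ?thesis
  proof (rule that[of "\<lambda>x. \<psi> x / (2 * of_real pi * \<i>)"])
    fix a b assume ab: "a \<in> S" "b \<in> S"
    have sub: "closed_segment a b \<subseteq> S" using ab assms(1) by (simp add: closed_segment_subset)
    have "((\<lambda>w. 1 / (w - p)) has_contour_integral (\<psi> b - \<psi> a)) (linepath a b)"
      using contour_integral_primitive[of S \<psi> "\<lambda>w. 1 / (w - p)" "linepath a b"] \<psi> sub by auto
    moreover have "winding_number (linepath a b) p = 1 / (2 * pi * \<i>) * contour_integral (linepath a b) (\<lambda>w. 1 / (w - p))"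
      using sub assms(3) by (intro winding_number_valid_path) auto
    ultimately show "winding_number (linepath a b) p = \<psi> b / (2 * of_real pi * \<i>) - \<psi> a / (2 * of_real pi * \<i>)"
      by (simp add: contour_integral_unique diff_divide_distrib)
  qed
qed

lemma closed_if_locally_finite:
  fixes X :: "complex set"
  assumes "\<And>r. finite (X \<inter> ball 0 r)"
  shows "closed X"
proof -
  have "open (- X)" unfolding open_contains_ball
  proof
    fix x assume x: "x \<in> - X"
    have "open (ball 0 (norm x + 1) - X \<inter> ball 0 (norm x + 1))"
      using assms by (intro open_Diff finite_imp_closed) auto
    moreover have "x \<in> ball 0 (norm x + 1) - X \<inter> ball 0 (norm x + 1)" using x by auto
    ultimately obtain e where e: "e > 0" "ball x e \<subseteq> ball 0 (norm x + 1) - X \<inter> ball 0 (norm x + 1)"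
      using open_contains_ball by meson
    thus "\<exists>e>0. ball x e \<subseteq> - X" by blast
  qed
  thus ?thesis by (simp add: closed_def)
qed

lemma closed_right_poles: "closed (right_poles k)"
  by (rule closed_if_locally_finite[OF finite_right_poles_Int_ball])

lemma closed_left_poles: "closed (left_poles L \<beta> c)"
  by (rule closed_if_locally_finite[OF finite_left_poles_Int_ball])

lemma holomorphic_Gamma_mult:
  assumes "H holomorphic_on - LP"
  shows "(\<lambda>s. Gamma (1 - of_int k - s) * H s) holomorphic_on - (right_poles k \<union> LP)"
proof (intro holomorphic_intros)
  show "1 - of_int k - z \<notin> \<int>\<^sub>\<le>\<^sub>0" if "z \<in> - (right_poles k \<union> LP)" for z
  proof
    assume "1 - of_int k - z \<in> \<int>\<^sub>\<le>\<^sub>0"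
    then obtain n where "1 - of_int k - z = - of_nat n" by (auto elim!: nonpos_Ints_cases')
    hence "z = of_int (1 - k) + of_nat n" by (simp add: algebra_simps)
    hence "z \<in> right_poles k" unfolding right_poles_altdef by blast
    thus False using that by auto
  qed
  show "H holomorphic_on - (right_poles k \<union> LP)"
    by (rule holomorphic_on_subset[OF assms]) auto
qed

lemma left_poles_Re_bounded_above:
  obtains B where "\<And>p. p \<in> left_poles L \<beta> c \<Longrightarrow> Re p < B"
proof -
  define B where "B = Max (insert 0 (Re ` (left_poles L \<beta> c \<inter> {s. Re s \<ge> 0}))) + 1"
  have "Re p < B" if "p \<in> left_poles L \<beta> c" for p
  proof -
    have fin: "finite (insert 0 (Re ` (left_poles L \<beta> c \<inter> {s. Re s \<ge> 0})))"
      using finite_left_poles_Re_ge by auto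
    show ?thesis
    proof (cases "Re p \<ge> 0")
      case True
      hence "Re p \<le> Max (insert 0 (Re ` (left_poles L \<beta> c \<inter> {s. Re s \<ge> 0})))"
        using that fin by (intro Max_ge) auto
      thus ?thesis by (simp add: B_def)
    next
      case False
      have "0 \<le> Max (insert 0 (Re ` (left_poles L \<beta> c \<inter> {s. Re s \<ge> 0})))"
        using fin by (intro Max_ge) auto
      thus ?thesis using False by (simp add: B_def)
    qed
  qed
  thus ?thesis using that by blast
qed

definition hankel_loop :: "(real \<Rightarrow> complex) \<Rightarrow> real \<Rightarrow> real \<Rightarrow> complex" where
  "hankel_loop \<gamma> R = trunc_path \<gamma> R +++ linepath (\<gamma> R) (\<gamma> (- R))"

text \<open>The contour condition fixes each winding number only for large R, with a threshold
  depending on p; here it is carried back to one b for all poles left of b. Beyond b the loops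
  differ by segments in Re s > Re p, whose contributions telescope.\<close>

lemma winding_number_hankel_loop_eq:
  assumes reg: "regular_contour \<gamma>" and T: "0 < T" "T < b" "b < R"
    and up: "\<And>t. t \<ge> T \<Longrightarrow> \<gamma> t = Complex t \<eta>"
    and down: "\<And>t. t \<le> -T \<Longrightarrow> \<gamma> t = Complex (-t) (-\<eta>)"
    and p: "Re p < b" "p \<notin> range \<gamma>"
  shows "winding_number (hankel_loop \<gamma> R) p = winding_number (hankel_loop \<gamma> b) p"
proof -
  have conv: "convex {s. Re s > Re p}" "open {s. Re s > Re p}"
    by (auto simp: convex_halfspace_Re_gt open_halfspace_Re_gt)
  obtain \<phi> where \<phi>: "\<And>x y. Re x > Re p \<Longrightarrow> Re y > Re p \<Longrightarrow> winding_number (linepath x y) p = \<phi> y - \<phi> x"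
    using winding_number_linepath_primitive[OF conv, of p] by auto
  have seg: "p \<notin> closed_segment x y" if "Re x > Re p" "Re y > Re p" for x y
    using closed_segment_subset[of x "{s. Re s > Re p}" y] conv that by auto
  have Re: "Re (\<gamma> t) > Re p" if "\<bar>t\<bar> \<ge> b" for t
    using that p T up[of t] down[of t] by (cases "t \<ge> 0") auto
  define g where "g = trunc_path \<gamma> R"
  have g: "path g" "p \<notin> path_image g"
    unfolding g_def using valid_path_trunc_path[OF reg] T p
    by (auto simp: valid_path_imp_path path_image_trunc_path)
  \<comment> \<open>The parameters in [0, 1] at which the path truncated at R passes the times -b
    and b.\<close>
  define u v where "u = (R - b) / (2 * R)" and "v = (R + b) / (2 * R)"
  have uv: "u \<in> {0..1}" "v \<in> {0..1}" using T by (auto simp: u_def v_def field_simps)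
  have Ru: "2 * R * u = R - b" "2 * R * v = R + b" using T by (auto simp: u_def v_def)
  have "winding_number g p = winding_number (subpath 0 1 g) p" by simp
  also have "\<dots> = winding_number (subpath 0 u g) p + winding_number (subpath u v g) p + winding_number (subpath v 1 g) p"
    using winding_number_subpath_combine[OF g, of 0 u v] winding_number_subpath_combine[OF g, of 0 v 1] uv by auto
  also have "subpath u v g = trunc_path \<gamma> b"
  proof
    fix x
    have "- R + 2 * R * ((v - u) * x + u) = - R + (2 * R * v - 2 * R * u) * x + 2 * R * u" by (simp add: algebra_simps)
    also have "\<dots> = - b + 2 * b * x" unfolding Ru by (simp add: algebra_simps)
    finally show "subpath u v g x = trunc_path \<gamma> b x"
      by (simp only: subpath_def g_def trunc_path_def)
  qed
  also have "winding_number (subpath 0 u g) p = winding_number (linepath (\<gamma> (-R)) (\<gamma> (-b))) p"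
  proof (rule winding_number_cong)
    fix x :: real assume x: "0 \<le> x" "x \<le> 1"
    have "- R + 2 * R * ((u - 0) * x + 0) = - R + 2 * R * u * x" by simp
    hence e: "- R + 2 * R * ((u - 0) * x + 0) = - R + (R - b) * x" unfolding Ru .
    have "(R - b) * x \<le> R - b" using mult_left_mono[of x 1 "R - b"] x T by simp
    hence le: "- R + (R - b) * x \<le> - T" using T by linarith
    show "subpath 0 u g x = linepath (\<gamma> (-R)) (\<gamma> (-b)) x"
      unfolding subpath_def g_def trunc_path_def e down[OF le] using T
      by (simp add: down linepath_def complex_eq_iff algebra_simps)
  qed
  also have "winding_number (subpath v 1 g) p = winding_number (linepath (\<gamma> b) (\<gamma> R)) p"
  proof (rule winding_number_cong)
    fix x :: real assume x: "0 \<le> x" "x \<le> 1"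
    have "- R + 2 * R * ((1 - v) * x + v) = - R + (2 * R - 2 * R * v) * x + 2 * R * v" by (simp add: algebra_simps)
    hence e: "- R + 2 * R * ((1 - v) * x + v) = b + (R - b) * x" unfolding Ru by simp
    have "(R - b) * x \<ge> 0" using x T by simp
    hence le: "b + (R - b) * x \<ge> T" using T by simp
    show "subpath v 1 g x = linepath (\<gamma> b) (\<gamma> R) x"
      unfolding subpath_def g_def trunc_path_def e up[OF le] using T
      by (simp add: up linepath_def complex_eq_iff algebra_simps)
  qed
  finally have wg: "winding_number g p = winding_number (linepath (\<gamma> (-R)) (\<gamma> (-b))) p
     + winding_number (trunc_path \<gamma> b) p + winding_number (linepath (\<gamma> b) (\<gamma> R)) p" .
  have join: "winding_number (hankel_loop \<gamma> r) p = winding_number (trunc_path \<gamma> r) p + winding_number (linepath (\<gamma> r) (\<gamma> (- r))) p"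
    if "r \<ge> b" for r
    unfolding hankel_loop_def using valid_path_trunc_path[OF reg, of r] T p that seg[OF Re Re, of r "-r"]
    by (intro winding_number_join) (auto simp: valid_path_imp_path path_image_trunc_path)
  show ?thesis
    using join[of R] join[of b] wg T Re by (simp add: g_def \<phi>)
qed

text \<open>The polygon of \<open>vclose\<close> with its vertical side moved to Re s = b. Finitely
  many right poles are then enclosed, and the horizontal sides keep a bounded length as R
  grows.\<close>

definition box_loop :: "(real \<Rightarrow> complex) \<Rightarrow> real \<Rightarrow> real \<Rightarrow> real \<Rightarrow> complex" where
  "box_loop \<gamma> b R = trunc_path \<gamma> R +++ linepath (\<gamma> R) (Complex b R) +++
                 linepath (Complex b R) (Complex b (- R)) +++ linepath (Complex b (- R)) (\<gamma> (- R))"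

lemma vclose_eq_box_loop: "vclose \<gamma> R = box_loop \<gamma> R R"
  by (simp add: vclose_def box_loop_def)

text \<open>The two closing polygons differ by segments in the half-plane Re s > Re p, where the
  contributions telescope. Splitting the horizontal sides at abscissa b isolates the parts between a
  and b, which may reach left of p but are common to both loops.\<close>

lemma winding_number_box_loop_eq:
  assumes reg: "regular_contour \<gamma>" and T: "0 < T" "T \<le> R" "b < R"
    and vert: "\<And>t. T \<le> \<bar>t\<bar> \<Longrightarrow> \<gamma> t = Complex a t" and "a < b"
    and p: "Re p < b" "\<bar>Im p\<bar> < R" "p \<notin> range \<gamma>"
  shows "winding_number (box_loop \<gamma> b R) p = winding_number (vclose \<gamma> R) p"
proof -
  have conv: "convex {s. Re s > Re p}" "open {s. Re s > Re p}"
    by (auto simp: convex_halfspace_Re_gt open_halfspace_Re_gt)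
  obtain \<phi> where \<phi>: "\<And>x y. Re x > Re p \<Longrightarrow> Re y > Re p \<Longrightarrow> winding_number (linepath x y) p = \<phi> y - \<phi> x"
    using winding_number_linepath_primitive[OF conv, of p] by auto
  have hor: "p \<notin> closed_segment (Complex x y) (Complex x' y)" if "\<bar>y\<bar> = R" for x x' y
    using closed_segment_same_Im(1)[of p x y x'] that p by auto
  have ver: "p \<notin> closed_segment (Complex x y) (Complex x y')" if "x > Re p" for x y y'
    using closed_segment_same_Re(1)[of p x y y'] that by auto
  have g: "path (trunc_path \<gamma> R)" "p \<notin> path_image (trunc_path \<gamma> R)"
    using valid_path_trunc_path[OF reg] T p
    by (auto simp: valid_path_imp_path path_image_trunc_path)
  have ends: "\<gamma> R = Complex a R" "\<gamma> (-R) = Complex a (-R)" using vert T by auto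
  have join: "winding_number (box_loop \<gamma> x R) p = winding_number (trunc_path \<gamma> R) p
      + winding_number (linepath (Complex a R) (Complex x R)) p
      + winding_number (linepath (Complex x R) (Complex x (-R))) p
      + winding_number (linepath (Complex x (-R)) (Complex a (-R))) p" if "x > Re p" for x
    unfolding box_loop_def using that T
    by (simp add: winding_number_join g hor ver ends path_image_join not_in_path_image_join)
  have inseg: "Complex b y \<in> closed_segment (Complex a y) (Complex R y)" for y
  proof -
    have "b \<in> closed_segment a R" using assms by (simp add: closed_segment_eq_real_ivl)
    then obtain u where "0 \<le> u" "u \<le> 1" "b = (1 - u) * a + u * R" by (auto simp: closed_segment_def)
    thus ?thesis unfolding closed_segment_def by (auto intro!: exI[of _ u] simp: complex_eq_iff algebra_simps)
  qed
  have s1: "winding_number (linepath (Complex a R) (Complex R R)) p =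
     winding_number (linepath (Complex a R) (Complex b R)) p + winding_number (linepath (Complex b R) (Complex R R)) p"
    using T by (intro winding_number_split_linepath inseg hor) auto
  have s2: "winding_number (linepath (Complex R (-R)) (Complex a (-R))) p =
     winding_number (linepath (Complex R (-R)) (Complex b (-R))) p + winding_number (linepath (Complex b (-R)) (Complex a (-R))) p"
    using T inseg[of "-R"] by (intro winding_number_split_linepath hor) (auto simp: closed_segment_commute)
  show ?thesis
    unfolding vclose_eq_box_loop using join[of R] join[of b] s1 s2 assms by (simp add: \<phi>)
qed

lemma vector_derivative_eq_if_eq_on_open:
  assumes "open S" "t \<in> S" "\<And>x. x \<in> S \<Longrightarrow> \<gamma> x = h x" "(h has_vector_derivative h') (at t)"
  shows "vector_derivative \<gamma> (at t) = h'"
  using has_vector_derivative_transform_within_open[OF assms(4,1,2)] assms(3)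
  by (metis vector_derivative_at)

lemma has_vector_derivative_Complex:
  "((\<lambda>t. Complex t y) has_vector_derivative 1) (at t)"
  "((\<lambda>t. Complex (-t) y) has_vector_derivative -1) (at t)"
  "((\<lambda>t. Complex x t) has_vector_derivative \<i>) (at t)"
  unfolding Complex_eq by (auto intro!: derivative_eq_intros)

lemma has_integral_trunc_path_holomorphic:
  assumes reg: "regular_contour \<gamma>" and "R > 0" and hol: "f holomorphic_on - X" and X: "closed X"
    and disj: "X \<inter> range \<gamma> = {}"
  shows "((\<lambda>t. f (\<gamma> t) * vector_derivative \<gamma> (at t)) has_integral contour_integral (trunc_path \<gamma> R) f) {-R..R}"
proof (rule has_integral_trunc_path[OF reg \<open>R > 0\<close>])
  show "f contour_integrable_on trunc_path \<gamma> R"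
    by (rule contour_integrable_holomorphic_simple[OF hol])
       (use X disj \<open>R > 0\<close> in \<open>auto simp: path_image_trunc_path intro!: valid_path_trunc_path reg\<close>)
qed

lemma exp_minus_tendsto_0:
  fixes \<delta> :: real
  assumes "\<delta> > 0" shows "((\<lambda>R. C * exp (- \<delta> * R)) \<longlongrightarrow> 0) at_top"
proof -
  have "filterlim (\<lambda>R. - \<delta> * R) at_bot at_top"
    using assms by (intro filterlim_tendsto_neg_mult_at_bot[OF tendsto_const]) (auto intro: filterlim_ident)
  hence "((\<lambda>R. exp (- \<delta> * R)) \<longlongrightarrow> 0) at_top"
    by (rule filterlim_compose[OF exp_at_bot])
  from tendsto_mult_right_zero[OF this] show ?thesis .
qed

section \<open>Moving a vertical contour to a half-integer abscissa\<close>

lemma regular_contour_bounded: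
  assumes "regular_contour \<gamma>"
  obtains K where "K \<ge> 0" "\<And>t. \<bar>t\<bar> \<le> T \<Longrightarrow> norm (\<gamma> t) \<le> K"
proof -
  have "bounded (\<gamma> ` {-T..T})"
    by (intro compact_imp_bounded compact_continuous_image continuous_regular_contour assms) auto
  then obtain K where "\<And>t. t \<in> {-T..T} \<Longrightarrow> norm (\<gamma> t) \<le> K" unfolding bounded_iff by (metis imageI)
  hence "norm (\<gamma> t) \<le> max K 0" if "\<bar>t\<bar> \<le> T" for t
    using that by (simp add: abs_le_iff le_max_iff_disj)
  thus ?thesis using that[of "max K 0"] by simp
qed

text \<open>The truncated contour is closed by \<open>box_loop\<close>; as R grows, strip decay
  removes the horizontal sides. \<open>N0\<close> depends on the contour and the left poles but not
  on H, so that one N serves all zeta and both integrands to which the formula is applied.\<close>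

lemma line_integral_vertical_contour:
  assumes vc: "vertical_contour L \<beta> c k \<gamma>" and disj: "right_poles k \<inter> left_poles L \<beta> c = {}"
  obtains N0 where
    "\<And>N H \<mu>. N \<ge> N0 \<Longrightarrow> H holomorphic_on - left_poles L \<beta> c \<Longrightarrow> 0 < \<mu> \<Longrightarrow>
       strip_decay \<mu> (\<lambda>s. Gamma (1 - of_int k - s) * H s) \<Longrightarrow>
       line_integral (\<lambda>s. Gamma (1 - of_int k - s) * H s) \<gamma> =
         \<i> * integral UNIV (\<lambda>t. Gamma (1 - of_int k - Complex (1 - of_int k + real N - 1/2) t)
                                * H (Complex (1 - of_int k + real N - 1/2) t))
         + 2 * of_real pi * \<i> * (\<Sum>n<N. (-1) ^ n / fact n * H (of_int (1 - k) + of_nat n))"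
    "\<And>p N. p \<in> left_poles L \<beta> c \<Longrightarrow> N \<ge> N0 \<Longrightarrow> Re p < 1 - of_int k + real N - 1/2"
proof -
  define RP LP where "RP = right_poles k" and "LP = left_poles L \<beta> c"
  have reg: "regular_contour \<gamma>" using vc by (simp add: vertical_contour_def)
  have avoid: "(RP \<union> LP) \<inter> range \<gamma> = {}" using vc unfolding vertical_contour_def RP_def LP_def by blast
  obtain T a where T: "T > 0" and vert: "\<And>t. T \<le> \<bar>t\<bar> \<Longrightarrow> \<gamma> t = Complex a t"
    using vc unfolding vertical_contour_def by blast
  have wR: "\<forall>\<^sub>F R in at_top. winding_number (vclose \<gamma> R) p = -1" if "p \<in> RP" for p
    using vc that unfolding vertical_contour_def RP_def by blast
  have wL: "\<forall>\<^sub>F R in at_top. winding_number (vclose \<gamma> R) p = 0" if "p \<in> LP" for p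
    using vc that unfolding vertical_contour_def LP_def by blast
  obtain K where K: "K \<ge> 0" "\<And>t. \<bar>t\<bar> \<le> T \<Longrightarrow> norm (\<gamma> t) \<le> K"
    using regular_contour_bounded[OF reg] by metis
  define A0 where "A0 = min (-K) a"
  define A1 where "A1 = max K a"
  have ReG: "A0 \<le> Re (\<gamma> t)" "Re (\<gamma> t) \<le> A1" for t
  proof -
    have "Re (\<gamma> t) = a \<or> \<bar>Re (\<gamma> t)\<bar> \<le> K"
    proof (cases "\<bar>t\<bar> \<le> T")
      case True thus ?thesis using K(2)[of t] abs_Re_le_cmod[of "\<gamma> t"] by linarith
    qed (use vert[of t] in auto)
    thus "A0 \<le> Re (\<gamma> t)" "Re (\<gamma> t) \<le> A1" by (auto simp: A0_def A1_def)
  qed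
  obtain B where B: "\<And>p. p \<in> LP \<Longrightarrow> Re p < B"
    using left_poles_Re_bounded_above unfolding LP_def by metis
  \<comment> \<open>Large enough for the line Re s = b to lie right of the whole contour
    (\<open>A1\<close>) and of all left poles (\<open>B\<close>).\<close>
  define N0 where "N0 = nat \<lceil>\<bar>A1\<bar> + \<bar>B\<bar> + \<bar>of_int k\<bar> + 2\<rceil>"
  have N0: "1 - of_int k + real N - 1/2 > A1" "1 - of_int k + real N - 1/2 > B" if "N \<ge> N0" for N
  proof -
    have "real N \<ge> \<bar>A1\<bar> + \<bar>B\<bar> + \<bar>of_int k\<bar> + 2" using that unfolding N0_def by linarith
    thus "1 - of_int k + real N - 1/2 > A1" "1 - of_int k + real N - 1/2 > B" by linarith+
  qed
  show ?thesis
  proof (rule that[of N0])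
    fix p N assume "p \<in> left_poles L \<beta> c" "N \<ge> N0"
    thus "Re p < 1 - of_int k + real N - 1/2" using B[of p] N0[of N] by (auto simp: LP_def)
  next
    fix N H \<mu> assume N: "N \<ge> N0" and hol: "H holomorphic_on - left_poles L \<beta> c" and \<mu>: "0 < \<mu>"
      and dec: "strip_decay \<mu> (\<lambda>s. Gamma (1 - of_int k - s) * H s)"
    define f where "f = (\<lambda>s. Gamma (1 - of_int k - s) * H s)"
    let ?g = "\<lambda>t. f (\<gamma> t) * vector_derivative \<gamma> (at t)"
    define rp where "rp = (\<lambda>n::nat. of_int (1 - k) + of_nat n :: complex)"
    define b where "b = 1 - of_int k + real N - 1/2"
    have bA: "b > A1" "b > B" using N0[OF N] by (auto simp: b_def)
    have ab: "a < b" using bA by (auto simp: A1_def)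
    have holf: "f holomorphic_on - (RP \<union> LP)"
      unfolding f_def RP_def LP_def by (rule holomorphic_Gamma_mult[OF hol])
    have clos: "closed (RP \<union> LP)" unfolding RP_def LP_def using closed_right_poles closed_left_poles by auto
    have contf: "continuous_on (- (RP \<union> LP)) f" by (rule holomorphic_on_imp_continuous_on[OF holf])
    have rpRP: "rp n \<in> RP" for n by (auto simp: rp_def RP_def right_poles_altdef)
    have RPrp: "\<exists>n. p = rp n" if "p \<in> RP" for p using that by (auto simp: rp_def RP_def right_poles_altdef)
    have Rerp: "Re (rp n) < b \<longleftrightarrow> n < N" "Re (rp n) \<noteq> b" "Im (rp n) = 0" for n
      unfolding rp_def b_def by (rule right_pole_Re_less_iff)+
    let ?W = "\<lambda>R. integral {-R..R} ?g
             + contour_integral (linepath (Complex a R) (Complex b R)) f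
             - \<i> * integral {-R..R} (\<lambda>t. f (Complex b t))
             + contour_integral (linepath (Complex b (-R)) (Complex a (-R))) f"
    \<comment> \<open>All loops stay in Re s >= \<open>A0\<close>, so the left poles outside
      \<open>F\<close> have winding number 0 by convexity. Finiteness of \<open>F\<close> allows its
      eventual conditions on R to be combined.\<close>
    define F where "F = LP \<inter> {s. Re s \<ge> A0}"
    have finF: "finite F" unfolding F_def LP_def by (rule finite_left_poles_Re_ge)
    have bline: "Complex b t \<notin> RP \<union> LP" for t
      using B[of "Complex b t"] bA RPrp[of "Complex b t"] Rerp by (auto simp: complex_eq_iff)
    have "\<forall>\<^sub>F R in at_top. R > max T (max b 0) \<and> (\<forall>p\<in>F. \<bar>Im p\<bar> < R) \<and>
        (\<forall>n\<in>{..<N}. winding_number (vclose \<gamma> R) (rp n) = -1) \<and> (\<forall>p\<in>F. winding_number (vclose \<gamma> R) p = 0)"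
      using finF wR[OF rpRP] wL
      by (intro eventually_conj eventually_ball_finite eventually_gt_at_top ballI) (auto simp: F_def eventually_gt_at_top)
    hence ev: "\<forall>\<^sub>F R in at_top. ?W R
           = 2 * of_real pi * \<i> * (\<Sum>n<N. (-1) ^ n / fact n * H (rp n))"
    proof eventually_elim
      case (elim R)
      hence R: "R > T" "R > b" "R > 0" and FIm: "\<And>p. p \<in> F \<Longrightarrow> \<bar>Im p\<bar> < R"
        and w1: "\<And>n. n < N \<Longrightarrow> winding_number (vclose \<gamma> R) (rp n) = -1"
        and w2: "\<And>p. p \<in> F \<Longrightarrow> winding_number (vclose \<gamma> R) p = 0" by auto
      have ends: "\<gamma> R = Complex a R" "\<gamma> (-R) = Complex a (-R)" using vert R T by auto
      have segab: "Re z \<ge> a \<and> Re z \<le> b \<and> Im z = y" if "z \<in> closed_segment (Complex a y) (Complex b y)" for z y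
        using closed_segment_same_Im[OF that] ab by (auto simp: closed_segment_eq_real_ivl)
      have hor: "closed_segment (Complex a y) (Complex b y) \<inter> (RP \<union> LP) = {}" if "\<bar>y\<bar> = R" for y
      proof -
        have "z \<notin> RP \<union> LP" if z: "z \<in> closed_segment (Complex a y) (Complex b y)" for z
        proof
          assume "z \<in> RP \<union> LP"
          thus False
          proof
            assume "z \<in> RP"
            then obtain n where "z = rp n" using RPrp by blast
            thus False using Rerp(3)[of n] segab[OF z] \<open>\<bar>y\<bar> = R\<close> R by auto
          next
            assume "z \<in> LP"
            hence "z \<in> F" using segab[OF z] by (auto simp: F_def A0_def)
            thus False using FIm[of z] segab[OF z] \<open>\<bar>y\<bar> = R\<close> by auto
          qed
        qed
        thus ?thesis by blast
      qed
      have h1: "closed_segment (Complex a R) (Complex b R) \<inter> (RP \<union> LP) = {}"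
        using hor[of R] R by simp
      have h3: "closed_segment (Complex b (-R)) (Complex a (-R)) \<inter> (RP \<union> LP) = {}"
        using hor[of "-R"] R by (simp add: closed_segment_commute)
      have ver: "closed_segment (Complex b R) (Complex b (-R)) \<inter> (RP \<union> LP) = {}"
      proof -
        have "z \<notin> RP \<union> LP" if "z \<in> closed_segment (Complex b R) (Complex b (-R))" for z
          using closed_segment_same_Re(1)[OF that] bline[of "Im z"] by (metis complex.collapse)
        thus ?thesis by blast
      qed
      define P where "P = box_loop \<gamma> b R"
      have imP: "path_image P = \<gamma> ` {-R..R} \<union> closed_segment (Complex a R) (Complex b R) \<union>
         closed_segment (Complex b R) (Complex b (-R)) \<union> closed_segment (Complex b (-R)) (Complex a (-R))"
        unfolding P_def box_loop_def using R by (simp add: path_image_join ends path_image_trunc_path Un_assoc)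
      have P: "valid_path P" "pathfinish P = pathstart P"
        unfolding P_def box_loop_def using valid_path_trunc_path[OF reg, of R] R
        by (auto simp: ends intro!: valid_path_join)
      have h0: "\<gamma> ` {-R..R} \<inter> (RP \<union> LP) = {}" using avoid by blast
      have Pdisj: "path_image P \<inter> (RP \<union> LP) = {}"
        unfolding imP Int_Un_distrib2[of _ _ "RP \<union> LP"] h0 h1 h3 ver by simp
      have ReP: "Re z \<ge> A0 \<and> Re z \<le> b" if "z \<in> path_image P" for z
      proof -
        have s3: "Re z \<ge> a \<and> Re z \<le> b" if "z \<in> closed_segment (Complex b (-R)) (Complex a (-R))"
          using segab[of z "-R"] that by (simp add: closed_segment_commute)
        have s2: "Re z = b" if "z \<in> closed_segment (Complex b R) (Complex b (-R))"
          using closed_segment_same_Re(1)[OF that] .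
        have A0a: "A0 \<le> a" by (simp add: A0_def)
        from that consider t where "z = \<gamma> t" | "z \<in> closed_segment (Complex a R) (Complex b R)"
          | "z \<in> closed_segment (Complex b R) (Complex b (-R))"
          | "z \<in> closed_segment (Complex b (-R)) (Complex a (-R))"
          unfolding imP by blast
        thus ?thesis
        proof cases
          case (1 t)
          thus ?thesis using ReG[of t] bA by auto
        next
          case 2
          thus ?thesis using segab[OF 2] A0a by auto
        next
          case 3
          thus ?thesis using s2[OF 3] A0a ab by auto
        next
          case 4
          thus ?thesis using s3[OF 4] A0a by auto
        qed
      qed
      have weq: "winding_number P p = winding_number (vclose \<gamma> R) p"
        if "Re p < b" "\<bar>Im p\<bar> < R" "p \<in> RP \<union> LP" for p
        unfolding P_def by (rule winding_number_box_loop_eq[OF reg T _ _ vert ab]) (use R that avoid in auto)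
      have main: "contour_integral P f = 2 * of_real pi * \<i> * (\<Sum>n<N. (-1) ^ n / fact n * H (rp n))"
        unfolding f_def rp_def
      proof (rule loop_integral_Gamma_mult[where LP = LP])
        show "finite (LP \<inter> ball 0 r)" for r unfolding LP_def by (rule finite_left_poles_Int_ball)
        show "H holomorphic_on - LP" using hol by (simp add: LP_def)
        show "right_poles k \<inter> LP = {}" using disj by (simp add: LP_def)
        show "path_image P \<inter> (right_poles k \<union> LP) = {}" using Pdisj by (simp add: RP_def)
        show "winding_number P (of_int (1 - k) + of_nat n) = -1" if "n < N" for n
          unfolding rp_def[symmetric] using weq[of "rp n"] w1[OF that] rpRP[of n] Rerp[of n] that R
          by (simp add: rp_def)
        show "winding_number P (of_int (1 - k) + of_nat n) = 0" if "n \<ge> N" for n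
        proof -
          have "winding_number P (rp n) = 0"
          proof (rule winding_number_zero_outside[of P "{z. Re z \<le> b}"])
            show "rp n \<notin> {z. Re z \<le> b}" using Rerp[of n] that by auto
            show "path_image P \<subseteq> {z. Re z \<le> b}" using ReP by auto
          qed (use P in \<open>auto simp: valid_path_imp_path convex_halfspace_Re_le\<close>)
          thus ?thesis by (simp add: rp_def)
        qed
        show "winding_number P p = 0" if "p \<in> LP" for p
        proof (cases "p \<in> F")
          case True
          thus ?thesis using weq[of p] w2[of p] FIm[of p] that B[of p] bA by auto
        next
          case False
          show ?thesis
          proof (rule winding_number_zero_outside[of P "{z. Re z \<ge> A0}"])
            show "p \<notin> {z. Re z \<ge> A0}" using False that by (auto simp: F_def)
            show "path_image P \<subseteq> {z. Re z \<ge> A0}" using ReP by auto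
          qed (use P in \<open>auto simp: valid_path_imp_path convex_halfspace_Re_ge\<close>)
        qed
      qed (use P in auto)
      have cl: "continuous_on (closed_segment x y) f" if "closed_segment x y \<inter> (RP \<union> LP) = {}" for x y
        by (rule continuous_on_subset[OF contf]) (use that in auto)
      have int: "f contour_integrable_on linepath x y" if "closed_segment x y \<inter> (RP \<union> LP) = {}" for x y
        by (rule contour_integrable_continuous_linepath[OF cl[OF that]])
      have intg: "f contour_integrable_on trunc_path \<gamma> R"
        by (rule contour_integrable_holomorphic_simple[OF holf])
           (use open_Compl[OF clos] h0 R in \<open>auto simp: path_image_trunc_path intro!: valid_path_trunc_path reg\<close>)
      have "contour_integral P f = contour_integral (trunc_path \<gamma> R) f
         + contour_integral (linepath (Complex a R) (Complex b R)) f
         + contour_integral (linepath (Complex b R) (Complex b (-R))) f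
         + contour_integral (linepath (Complex b (-R)) (Complex a (-R))) f"
        unfolding P_def box_loop_def ends
        using int[OF h1] int[OF h3] int[OF ver] intg valid_path_trunc_path[OF reg, of R] R
        by (simp add: contour_integrable_joinI ends)
      also have "contour_integral (trunc_path \<gamma> R) f = integral {-R..R} ?g"
        using has_integral_trunc_path[OF reg \<open>R > 0\<close> intg] by (simp add: integral_unique)
      also have "contour_integral (linepath (Complex b R) (Complex b (-R))) f = - (\<i> * integral {-R..R} (\<lambda>t. f (Complex b t)))"
        using contour_integral_reverse_linepath[OF cl[OF ver]]
          contour_integral_linepath_same_Re[of "Complex b (-R)" b "Complex b R" "-R" R f] R by simp
      finally show ?case using main by simp
    qed
    obtain C D where C: "C > 0" "D > 0" "\<And>s. \<bar>Re s\<bar> \<le> \<bar>a\<bar> + \<bar>b\<bar> \<Longrightarrow> D \<le> \<bar>Im s\<bar> \<Longrightarrow> norm (f s) \<le> C * exp (- (\<mu>/2) * \<bar>Im s\<bar>)"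
      using strip_decayD[OF dec, of "\<mu>/2" "\<bar>a\<bar> + \<bar>b\<bar>"] \<mu> unfolding f_def by auto
    have i1: "?g integrable_on UNIV"
    proof (rule integrable_on_UNIV_exp_tails)
      show "?g integrable_on {-R..R}" if "R > 0" for R
        using has_integral_trunc_path_holomorphic[OF reg that holf clos avoid] by (rule has_integral_integrable)
      fix t assume t: "D + T + 1 \<le> \<bar>t\<bar>"
      have "vector_derivative \<gamma> (at t) = \<i>"
      proof (rule vector_derivative_eq_if_eq_on_open)
        show "open (- {-T..T})" by auto
        show "t \<in> - {-T..T}" using t C by auto
        show "\<gamma> x = Complex a x" if "x \<in> - {-T..T}" for x using that by (intro vert) auto
      qed (rule has_vector_derivative_Complex)
      moreover have "norm (f (Complex a t)) \<le> C * exp (- (\<mu>/2) * \<bar>Im (Complex a t)\<bar>)"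
        using t C(1,2) T by (intro C) auto
      moreover have "\<gamma> t = Complex a t" using t C T by (intro vert) auto
      ultimately show "norm (f (\<gamma> t) * vector_derivative \<gamma> (at t)) \<le> C * exp (- (\<mu>/2) * \<bar>t\<bar>)"
        by (simp add: norm_mult)
    qed (use \<mu> in auto)
    have i2: "(\<lambda>t. f (Complex b t)) integrable_on UNIV"
    proof (rule integrable_on_UNIV_exp_tails)
      show "(\<lambda>t. f (Complex b t)) integrable_on {-R..R}" for R
      proof (rule integrable_continuous_real)
        show "continuous_on {-R..R} (\<lambda>t. f (Complex b t))"
          by (rule continuous_on_compose2[OF contf]) (use bline in \<open>auto simp: Complex_eq intro!: continuous_intros\<close>)
      qed
      show "norm (f (Complex b t)) \<le> C * exp (- (\<mu>/2) * \<bar>t\<bar>)" if "D \<le> \<bar>t\<bar>" for t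
        using C(3)[of "Complex b t"] that by simp
    qed (use \<mu> in auto)
    \<comment> \<open>The endpoints are given as an unordered pair, so that this covers the upper
      side, run from a to b, and the lower side, run from b to a.\<close>
    have hz: "((\<lambda>R. contour_integral (linepath (x R) (y R)) f) \<longlongrightarrow> 0) at_top"
      if xy: "\<And>R. R \<ge> 0 \<Longrightarrow> \<exists>Y. \<bar>Y\<bar> = R \<and> {x R, y R} = {Complex a Y, Complex b Y}" for x y
    proof (rule Lim_null_comparison)
      show "((\<lambda>R. (C * \<bar>b - a\<bar>) * exp (- (\<mu>/2) * R)) \<longlongrightarrow> 0) at_top"
        using \<mu> by (intro exp_minus_tendsto_0) auto
      obtain Q where Q: "\<And>p. p \<in> RP \<union> F \<Longrightarrow> \<bar>Im p\<bar> < Q"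
      proof -
        have fin: "finite (insert 0 ((\<lambda>p. \<bar>Im p\<bar>) ` F))" using finF by auto
        have "\<bar>Im p\<bar> < Max (insert 0 ((\<lambda>p. \<bar>Im p\<bar>) ` F)) + 1" if p: "p \<in> RP \<union> F" for p
        proof -
          have "\<bar>Im p\<bar> \<in> insert 0 ((\<lambda>p. \<bar>Im p\<bar>) ` F)" using p RPrp[of p] Rerp(3) by auto
          from Max_ge[OF fin this] show ?thesis by simp
        qed
        thus ?thesis using that by blast
      qed
      show "\<forall>\<^sub>F R in at_top. norm (contour_integral (linepath (x R) (y R)) f) \<le> (C * \<bar>b - a\<bar>) * exp (- (\<mu>/2) * R)"
        using eventually_ge_at_top[of "max D Q"]
      proof eventually_elim
        case (elim R)
        then obtain Y where Y: "\<bar>Y\<bar> = R" "{x R, y R} = {Complex a Y, Complex b Y}" using xy[of R] C by auto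
        have seg: "closed_segment (x R) (y R) = closed_segment (Complex a Y) (Complex b Y)"
          using Y(2) by (metis closed_segment_commute doubleton_eq_iff)
        have nrm: "norm (y R - x R) = \<bar>b - a\<bar>"
        proof -
          have "norm (Complex b Y - Complex a Y) = \<bar>b - a\<bar>" by (simp add: cmod_def)
          thus ?thesis using Y(2) by (metis doubleton_eq_iff norm_minus_commute)
        qed
        have z: "Im z = Y" "\<bar>Re z\<bar> \<le> \<bar>a\<bar> + \<bar>b\<bar>" "a \<le> Re z" if "z \<in> closed_segment (x R) (y R)" for z
          using closed_segment_same_Im[of z a Y b] that ab unfolding seg by (auto simp: closed_segment_eq_real_ivl)
        have nin: "z \<notin> RP \<union> LP" if "z \<in> closed_segment (x R) (y R)" for z
        proof
          assume "z \<in> RP \<union> LP"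
          hence "z \<in> RP \<union> F" using z[OF that] by (auto simp: F_def A0_def)
          from Q[OF this] show False using z[OF that] Y elim by auto
        qed
        have "norm (contour_integral (linepath (x R) (y R)) f) \<le> C * exp (- (\<mu>/2) * R) * norm (y R - x R)"
        proof (rule contour_integral_bound_linepath)
          show "f contour_integrable_on linepath (x R) (y R)"
            by (rule contour_integrable_continuous_linepath, rule continuous_on_subset[OF contf]) (use nin in auto)
          show "norm (f z) \<le> C * exp (- (\<mu>/2) * R)" if "z \<in> closed_segment (x R) (y R)" for z
            using C(3)[of z] z[OF that] Y elim by auto
        qed (use C in auto)
        thus ?case unfolding nrm by (simp add: mult_ac)
      qed
    qed
    have "(?W
          \<longlongrightarrow> integral UNIV ?g + 0 - \<i> * integral UNIV (\<lambda>t. f (Complex b t)) + 0) at_top"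
    proof (intro tendsto_intros integral_symmetric_tendsto i1 i2 hz)
      fix R :: real assume "R \<ge> 0"
      show "\<exists>Y. \<bar>Y\<bar> = R \<and> {Complex a R, Complex b R} = {Complex a Y, Complex b Y}"
        using \<open>R \<ge> 0\<close> by (intro exI[of _ R]) auto
      show "\<exists>Y. \<bar>Y\<bar> = R \<and> {Complex b (-R), Complex a (-R)} = {Complex a Y, Complex b Y}"
        using \<open>R \<ge> 0\<close> by (intro exI[of _ "-R"]) auto
    qed
    moreover have "(?W
           \<longlongrightarrow> 2 * of_real pi * \<i> * (\<Sum>n<N. (-1) ^ n / fact n * H (rp n))) at_top"
      using ev by (intro tendsto_eventually) auto
    ultimately have "integral UNIV ?g + 0 - \<i> * integral UNIV (\<lambda>t. f (Complex b t)) + 0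
       = 2 * of_real pi * \<i> * (\<Sum>n<N. (-1) ^ n / fact n * H (rp n))"
      by (intro tendsto_unique[OF trivial_limit_at_top_linorder])
    thus "line_integral (\<lambda>s. Gamma (1 - of_int k - s) * H s) \<gamma> =
         \<i> * integral UNIV (\<lambda>t. Gamma (1 - of_int k - Complex (1 - of_int k + real N - 1/2) t)
                                * H (Complex (1 - of_int k + real N - 1/2) t))
         + 2 * of_real pi * \<i> * (\<Sum>n<N. (-1) ^ n / fact n * H (of_int (1 - k) + of_nat n))"
      by (simp add: line_integral_def f_def rp_def b_def algebra_simps)
  qed
qed

section \<open>Lower bounds for the sine and the Hankel contour\<close>

lemma exp_double_add_minus_2:
  "exp (2 * y) + exp (- (2 * y)) - 2 = (exp y - exp (- y))\<^sup>2" for y :: real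
proof -
  have "exp (2 * y) = (exp y)\<^sup>2" by (rule exp_double)
  moreover have "exp (- (2 * y)) = (exp (- y))\<^sup>2" using exp_double[of "- y"] by simp
  moreover have "exp y * exp (- y) = 1" by (rule exp_minus_inverse)
  ultimately show ?thesis by (simp only: power2_diff)
qed

text \<open>Uniformity in Re z is what matters: the ends of a Hankel contour run at fixed heights,
  and the denominator sin(pi (k + s)) must stay away from 0 along them.\<close>

lemma norm_sin_ge_off_real:
  assumes "y \<noteq> 0"
  obtains m where "m > 0" "\<And>z::complex. \<bar>Im z\<bar> = \<bar>y\<bar> \<Longrightarrow> norm (sin z) \<ge> m"
proof -
  define m2 where "m2 = (exp (2 * \<bar>y\<bar>) + exp (- 2 * \<bar>y\<bar>) - 2) / 4"
  have "exp (2 * \<bar>y\<bar>) + exp (- 2 * \<bar>y\<bar>) - 2 = (exp \<bar>y\<bar> - exp (- \<bar>y\<bar>))\<^sup>2"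
    using exp_double_add_minus_2[of "\<bar>y\<bar>"] by simp
  moreover have "exp \<bar>y\<bar> \<noteq> exp (- \<bar>y\<bar>)" using assms by simp
  ultimately have m2: "m2 > 0" by (simp add: m2_def)
  have "norm (sin z) \<ge> sqrt m2" if z: "\<bar>Im z\<bar> = \<bar>y\<bar>" for z :: complex
  proof -
    have "exp (2 * Im z) + inverse (exp (2 * Im z)) = exp (2 * \<bar>y\<bar>) + exp (- 2 * \<bar>y\<bar>)"
      unfolding z[symmetric] by (cases "Im z \<ge> 0") (auto simp: exp_minus)
    hence "(norm (sin z))\<^sup>2 = (exp (2 * \<bar>y\<bar>) + exp (- 2 * \<bar>y\<bar>) - 2 * cos (2 * Re z)) / 4"
      unfolding norm_sin_squared by simp
    also have "\<dots> \<ge> m2" unfolding m2_def using cos_le_one[of "2 * Re z"] by (intro divide_right_mono) auto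
    finally show ?thesis by (simp add: real_le_lsqrt)
  qed
  thus ?thesis using that[of "sqrt m2"] m2 by auto
qed

text \<open>|sin z|^2 = (cosh(2 Im z) - cos(2 Re z)) / 2, and the cosine equals -1 here. This
  controls the vertical sides closing the truncated Hankel contour, uniformly in their
  abscissa.\<close>

lemma norm_sin_ge_half_int:
  fixes z :: complex
  assumes "Re z = pi * (of_int j + 1/2)"
  shows "norm (sin z) \<ge> 1"
proof -
  have "2 * Re z = of_int j * (2 * pi) + pi" unfolding assms by (simp add: field_simps)
  hence c: "cos (2 * Re z) = -1"
    using cos_int_2pin[of j] by (simp add: mult_ac)
  have "exp (2 * Im z) + inverse (exp (2 * Im z)) \<ge> 2"
  proof -
    have "0 \<le> (exp (Im z) - exp (- Im z))\<^sup>2" by simp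
    also have "\<dots> = exp (2 * Im z) + exp (- (2 * Im z)) - 2"
      by (rule exp_double_add_minus_2[symmetric])
    finally show ?thesis by (simp add: exp_minus)
  qed
  hence "(norm (sin z))\<^sup>2 \<ge> 1\<^sup>2" unfolding norm_sin_squared c by simp
  thus ?thesis by (rule power2_le_imp_le) simp
qed

text \<open>The second alternative covers the integers k + s >= 1, where Gamma has its default value
  0 while \<open>rGamma\<close> does not vanish.\<close>

lemma Gamma_mult_sin_eq:
  fixes s :: complex
  shows "Gamma (1 - of_int k - s) * sin (of_real pi * (of_int k + s)) = of_real pi * rGamma (of_int k + s) \<or>
    sin (of_real pi * (of_int k + s)) = 0"
proof -
  define z where "z = of_int k + s"
  have e: "1 - of_int k - s = 1 - z" by (simp add: z_def)
  have "rGamma z * rGamma (1 - z) = sin (of_real pi * z) / of_real pi" by (rule rGamma_reflection_complex)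
  hence "sin (of_real pi * z) \<noteq> 0 \<Longrightarrow> Gamma (1 - z) * sin (of_real pi * z) = of_real pi * rGamma z"
    by (cases "rGamma (1 - z) = 0") (auto simp: Gamma_def field_simps)
  thus ?thesis unfolding e unfolding z_def[symmetric] by blast
qed

text \<open>Decay is assumed for rGamma(k + s) H(s), which has no right poles. The integrand itself
  is this function times pi / sin(pi (k + s)), and it is estimated only where the sine is bounded
  below: on the two ends and on the half-integer lines.\<close>

lemma line_integral_hankel_contour:
  assumes hc: "hankel_contour L \<beta> c k \<gamma>" and disj: "right_poles k \<inter> left_poles L \<beta> c = {}"
    and hol: "H holomorphic_on - left_poles L \<beta> c"
    and dec: "\<And>\<eta>. \<exists>C \<delta> x0. \<delta> > 0 \<and> (\<forall>s. Re s \<ge> x0 \<longrightarrow> \<bar>Im s\<bar> \<le> \<eta> \<longrightarrow>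
                norm (rGamma (of_int k + s) * H s) \<le> C * exp (- \<delta> * Re s))"
  shows "(\<lambda>n. (-1) ^ n / fact n * H (of_int (1 - k) + of_nat n)) sums
           (line_integral (\<lambda>s. Gamma (1 - of_int k - s) * H s) \<gamma> / (2 * of_real pi * \<i>))"
proof -
  define RP LP where "RP = right_poles k" and "LP = left_poles L \<beta> c"
  have reg: "regular_contour \<gamma>" using hc by (simp add: hankel_contour_def)
  have avoid: "(RP \<union> LP) \<inter> range \<gamma> = {}" using hc unfolding hankel_contour_def RP_def LP_def by blast
  obtain T \<eta> where T: "T > 0" "\<eta> > 0" and up: "\<And>t. t \<ge> T \<Longrightarrow> \<gamma> t = Complex t \<eta>"
    and down: "\<And>t. t \<le> -T \<Longrightarrow> \<gamma> t = Complex (-t) (-\<eta>)"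
  proof -
    obtain T \<eta> where "T > 0" "\<eta> > 0" "\<forall>t\<ge>T. \<gamma> t = of_real t + \<i> * of_real \<eta>"
      "\<forall>t\<le>-T. \<gamma> t = of_real (- t) - \<i> * of_real \<eta>" using hc unfolding hankel_contour_def by blast
    thus ?thesis by (intro that[of T \<eta>]) (auto simp: complex_eq_iff)
  qed
  have wR: "\<forall>\<^sub>F R in at_top. winding_number (hankel_loop \<gamma> R) p = -1" if "p \<in> RP" for p
    using hc that unfolding hankel_contour_def RP_def hankel_loop_def by blast
  have wL: "\<forall>\<^sub>F R in at_top. winding_number (hankel_loop \<gamma> R) p = 0" if "p \<in> LP" for p
    using hc that unfolding hankel_contour_def LP_def hankel_loop_def by blast
  obtain K where K: "K \<ge> 0" "\<And>t. \<bar>t\<bar> \<le> T \<Longrightarrow> norm (\<gamma> t) \<le> K"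
    using regular_contour_bounded[OF reg] by metis
  obtain B where B: "\<And>p. p \<in> LP \<Longrightarrow> Re p < B"
    using left_poles_Re_bounded_above unfolding LP_def by metis
  obtain C \<delta> x0 where C: "\<delta> > 0" "\<And>s. Re s \<ge> x0 \<Longrightarrow> \<bar>Im s\<bar> \<le> \<eta> \<Longrightarrow>
                norm (rGamma (of_int k + s) * H s) \<le> C * exp (- \<delta> * Re s)"
    using dec[of \<eta>] by blast
  obtain m where m: "m > 0" "\<And>z::complex. \<bar>Im z\<bar> = \<bar>pi * \<eta>\<bar> \<Longrightarrow> norm (sin z) \<ge> m"
    using norm_sin_ge_off_real[of "pi * \<eta>"] T by auto
  define f where "f = (\<lambda>s. Gamma (1 - of_int k - s) * H s)"
  let ?g = "\<lambda>t. f (\<gamma> t) * vector_derivative \<gamma> (at t)"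
  define rp where "rp = (\<lambda>n::nat. of_int (1 - k) + of_nat n :: complex)"
  have holf: "f holomorphic_on - (RP \<union> LP)"
    unfolding f_def RP_def LP_def by (rule holomorphic_Gamma_mult[OF hol])
  have clos: "closed (RP \<union> LP)" unfolding RP_def LP_def using closed_right_poles closed_left_poles by auto
  have contf: "continuous_on (- (RP \<union> LP)) f" by (rule holomorphic_on_imp_continuous_on[OF holf])
  have rpRP: "rp n \<in> RP" for n by (auto simp: rp_def RP_def right_poles_altdef)
  have RPrp: "\<exists>n. p = rp n" if "p \<in> RP" for p using that by (auto simp: rp_def RP_def right_poles_altdef)
  \<comment> \<open>Applied with m' = \<open>m\<close> on the two ends and with m' = 1 on the
    closing sides.\<close>
  have fbound: "norm (f s) \<le> pi / m' * \<bar>C\<bar> * exp (- \<delta> * Re s)"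
    if "Re s \<ge> x0" "\<bar>Im s\<bar> \<le> \<eta>" "m' > 0" "norm (sin (of_real pi * (of_int k + s))) \<ge> m'" for s m'
  proof -
    let ?S = "sin (of_real pi * (of_int k + s))"
    have "?S \<noteq> 0" using that by auto
    hence "f s = of_real pi / ?S * (rGamma (of_int k + s) * H s)"
      using Gamma_mult_sin_eq[of k s] by (simp add: f_def field_simps)
    hence "norm (f s) = pi / norm ?S * norm (rGamma (of_int k + s) * H s)"
      by (simp add: norm_mult norm_divide)
    also have "\<dots> \<le> pi / m' * (\<bar>C\<bar> * exp (- \<delta> * Re s))"
    proof (rule mult_mono)
      show "pi / norm ?S \<le> pi / m'" using that by (intro divide_left_mono mult_pos_pos) auto
      have "norm (rGamma (of_int k + s) * H s) \<le> C * exp (- \<delta> * Re s)" using that by (intro C) auto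
      also have "\<dots> \<le> \<bar>C\<bar> * exp (- \<delta> * Re s)" by (intro mult_right_mono) auto
      finally show "norm (rGamma (of_int k + s) * H s) \<le> \<bar>C\<bar> * exp (- \<delta> * Re s)" .
    qed (use that in auto)
    finally show ?thesis by simp
  qed
  have int: "?g integrable_on UNIV"
  proof (rule integrable_on_UNIV_exp_tails)
    show "?g integrable_on {-R..R}" if "R > 0" for R
      using has_integral_trunc_path_holomorphic[OF reg that holf clos avoid] by (rule has_integral_integrable)
    fix t assume t: "\<bar>x0\<bar> + T + 1 \<le> \<bar>t\<bar>"
    have sinb: "norm (sin (of_real pi * (of_int k + s))) \<ge> m" if "\<bar>Im s\<bar> = \<eta>" for s
      using that T by (intro m) (simp add: abs_mult)
    have "norm (vector_derivative \<gamma> (at t)) = 1 \<and> \<bar>Im (\<gamma> t)\<bar> = \<eta> \<and> Re (\<gamma> t) = \<bar>t\<bar>"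
    proof (cases "t \<ge> 0")
      case True
      have "vector_derivative \<gamma> (at t) = 1"
        by (rule vector_derivative_eq_if_eq_on_open[where S = "{T<..}"])
           (use True t T up has_vector_derivative_Complex in auto)
      thus ?thesis using True t T up[of t] by auto
    next
      case False
      have "vector_derivative \<gamma> (at t) = -1"
        by (rule vector_derivative_eq_if_eq_on_open[where S = "{..<-T}"])
           (use False t T down has_vector_derivative_Complex in auto)
      thus ?thesis using False t T down[of t] by auto
    qed
    thus "norm (f (\<gamma> t) * vector_derivative \<gamma> (at t)) \<le> (pi / m * \<bar>C\<bar>) * exp (- \<delta> * \<bar>t\<bar>)"
      using fbound[of "\<gamma> t" m] sinb[of "\<gamma> t"] t T m by (auto simp: norm_mult)
  qed (use C in auto)
  \<comment> \<open>On the ends Re (\<open>\<gamma>\<close> t) = |t|, so truncating the parameter at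
    \<open>b N\<close> also places the endpoints on the line Re s = \<open>b N\<close>.\<close>
  define b where "b = (\<lambda>N::nat. 1 - of_int k + real N - 1/2)"
  let ?V = "\<lambda>N. contour_integral (linepath (Complex (b N) \<eta>) (Complex (b N) (-\<eta>))) f" and ?S = "\<lambda>N. closed_segment (Complex (b N) \<eta>) (Complex (b N) (-\<eta>))"
  have b_lim: "filterlim b at_top sequentially"
  proof -
    have "filterlim (\<lambda>N. (1 - of_int k - 1/2) + real N) at_top sequentially"
      by (intro filterlim_tendsto_add_at_top[OF tendsto_const] filterlim_real_sequentially)
    thus ?thesis by (simp add: b_def algebra_simps)
  qed
  have lim1: "(\<lambda>N. integral {-b N..b N} ?g) \<longlonglongrightarrow> line_integral f \<gamma>"
    unfolding line_integral_def
    by (rule filterlim_compose[OF integral_symmetric_tendsto[OF int] b_lim])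
  \<comment> \<open>Beyond T the endpoints lie on the straight ends, beyond K the bounded part is
    left of the line, beyond B so are the left poles, and beyond x0 the decay estimate
    applies.\<close>
  have ev0: "\<forall>\<^sub>F N in sequentially. b N > max (max T K) (max B (max 0 x0))"
    using b_lim unfolding filterlim_at_top_dense by blast
  have ev: "\<forall>\<^sub>F N in sequentially. integral {-b N..b N} ?g
       + ?V N
       = 2 * of_real pi * \<i> * (\<Sum>n<N. (-1) ^ n / fact n * H (rp n))
     \<and> norm (?V N)
        \<le> (pi * \<bar>C\<bar> * (2 * \<eta>)) * exp (- \<delta> * b N)"
    using ev0
  proof eventually_elim
    case (elim N)
    hence bN: "b N > T" "b N > K" "b N > B" "b N > 0" "b N > x0" by auto
    have ends: "\<gamma> (b N) = Complex (b N) \<eta>" "\<gamma> (- b N) = Complex (b N) (-\<eta>)"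
      using up[of "b N"] down[of "- b N"] bN by auto
    have Rerp: "Re (rp n) < b N \<longleftrightarrow> n < N" "Re (rp n) \<noteq> b N" for n
      unfolding rp_def b_def by (rule right_pole_Re_less_iff)+
    have bline: "z \<notin> RP \<union> LP" if "Re z = b N" for z
      using B[of z] bN RPrp[of z] Rerp that by auto
    have seg: "Re z = b N" "\<bar>Im z\<bar> \<le> \<eta>" if "z \<in> ?S N" for z
      using closed_segment_same_Re[OF that] T by (auto simp: closed_segment_eq_real_ivl)
    define P where "P = hankel_loop \<gamma> (b N)"
    have imP: "path_image P = \<gamma> ` {-b N..b N} \<union> ?S N"
      unfolding P_def hankel_loop_def using bN by (simp add: path_image_join ends path_image_trunc_path)
    have P: "valid_path P" "pathfinish P = pathstart P"
      unfolding P_def hankel_loop_def using valid_path_trunc_path[OF reg, of "b N"] bN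
      by (auto simp: ends intro!: valid_path_join)
    have h0: "\<gamma> ` {-b N..b N} \<inter> (RP \<union> LP) = {}" using avoid by blast
    have h1: "?S N \<inter> (RP \<union> LP) = {}"
      using seg(1) bline by blast
    have Pdisj: "path_image P \<inter> (RP \<union> LP) = {}"
      unfolding imP Int_Un_distrib2[of _ _ "RP \<union> LP"] h0 h1 by simp
    have ReP: "Re z \<le> b N" if "z \<in> path_image P" for z
    proof -
      from that consider t where "z = \<gamma> t" "\<bar>t\<bar> \<le> b N" | "z \<in> ?S N"
        unfolding imP by fastforce
      thus ?thesis
      proof cases
        case (1 t)
        show ?thesis
        proof (cases "\<bar>t\<bar> \<le> T")
          case True
          thus ?thesis using K(2)[OF True] complex_Re_le_cmod[of z] 1 bN by simp
        next
          case False
          thus ?thesis using up[of t] down[of t] 1 by (cases "t \<ge> 0") auto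
        qed
      next
        case 2
        thus ?thesis using seg by auto
      qed
    qed
    \<comment> \<open>The eventual winding number is realized by some R > \<open>b N\<close>, and
      enlarging the loop from \<open>b N\<close> to R does not change it.\<close>
    have w: "winding_number P p = x" if p: "Re p < b N" "p \<in> RP \<union> LP"
      and ev: "\<forall>\<^sub>F R in at_top. winding_number (hankel_loop \<gamma> R) p = x" for p x
    proof -
      have "\<forall>\<^sub>F R in at_top. winding_number (hankel_loop \<gamma> R) p = x \<and> R > b N"
        by (intro eventually_conj ev eventually_gt_at_top)
      then obtain R where R: "winding_number (hankel_loop \<gamma> R) p = x" "R > b N"
        using eventually_happens by force
      have "p \<notin> range \<gamma>" using p avoid by blast
      from winding_number_hankel_loop_eq[OF reg T(1) bN(1) R(2) up down p(1) this] R(1)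
      show ?thesis by (simp add: P_def)
    qed
    have main: "contour_integral P f = 2 * of_real pi * \<i> * (\<Sum>n<N. (-1) ^ n / fact n * H (rp n))"
      unfolding f_def rp_def
    proof (rule loop_integral_Gamma_mult[where LP = LP])
      show "finite (LP \<inter> ball 0 r)" for r unfolding LP_def by (rule finite_left_poles_Int_ball)
      show "H holomorphic_on - LP" using hol by (simp add: LP_def)
      show "right_poles k \<inter> LP = {}" using disj by (simp add: LP_def)
      show "path_image P \<inter> (right_poles k \<union> LP) = {}" using Pdisj by (simp add: RP_def)
      show "winding_number P (of_int (1 - k) + of_nat n) = -1" if "n < N" for n
        using w[of "rp n" "-1"] rpRP[of n] wR[OF rpRP] Rerp[of n] that by (simp add: rp_def)
      show "winding_number P (of_int (1 - k) + of_nat n) = 0" if "n \<ge> N" for n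
      proof -
        have "winding_number P (rp n) = 0"
        proof (rule winding_number_zero_outside[of P "{z. Re z \<le> b N}"])
          show "rp n \<notin> {z. Re z \<le> b N}" using Rerp[of n] that by auto
          show "path_image P \<subseteq> {z. Re z \<le> b N}" using ReP by auto
        qed (use P in \<open>auto simp: valid_path_imp_path convex_halfspace_Re_le\<close>)
        thus ?thesis by (simp add: rp_def)
      qed
      show "winding_number P p = 0" if "p \<in> LP" for p
        using w[of p 0] that wL[OF that] B[OF that] bN by auto
    qed (use P in auto)
    have cl: "continuous_on (?S N) f"
      by (rule continuous_on_subset[OF contf]) (use h1 in auto)
    note int1 = contour_integrable_continuous_linepath[OF cl]
    have intg: "f contour_integrable_on trunc_path \<gamma> (b N)"
      by (rule contour_integrable_holomorphic_simple[OF holf])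
         (use open_Compl[OF clos] h0 bN in \<open>auto simp: path_image_trunc_path intro!: valid_path_trunc_path reg\<close>)
    have "contour_integral P f = contour_integral (trunc_path \<gamma> (b N)) f
       + ?V N"
      unfolding P_def hankel_loop_def ends
      using int1 intg valid_path_trunc_path[OF reg, of "b N"] bN
      by (simp add: ends)
    also have "contour_integral (trunc_path \<gamma> (b N)) f = integral {-b N..b N} ?g"
      using has_integral_trunc_path[OF reg \<open>b N > 0\<close> intg] by (simp add: integral_unique)
    finally have 1: "integral {-b N..b N} ?g
       + ?V N
       = 2 * of_real pi * \<i> * (\<Sum>n<N. (-1) ^ n / fact n * H (rp n))" using main by simp
    have "norm (?V N)
        \<le> (pi / 1 * \<bar>C\<bar> * exp (- \<delta> * b N)) * norm (Complex (b N) (-\<eta>) - Complex (b N) \<eta>)"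
    proof (rule contour_integral_bound_linepath[OF int1])
      show "norm (f z) \<le> pi / 1 * \<bar>C\<bar> * exp (- \<delta> * b N)"
        if "z \<in> ?S N" for z
      proof -
        have "norm (sin (of_real pi * (of_int k + z))) \<ge> 1"
          by (rule norm_sin_ge_half_int[of _ "int N"]) (use seg[OF that] in \<open>simp add: b_def\<close>)
        thus ?thesis using fbound[of z 1] seg[OF that] bN by auto
      qed
    qed auto
    also have "norm (Complex (b N) (-\<eta>) - Complex (b N) \<eta>) = 2 * \<eta>"
      using T by (simp add: cmod_def real_sqrt_mult)
    finally have 2: "norm (?V N)
        \<le> (pi * \<bar>C\<bar> * (2 * \<eta>)) * exp (- \<delta> * b N)" by (simp add: mult_ac)
    show ?case using 1 2 by blast
  qed
  have lim2: "(\<lambda>N. ?V N) \<longlonglongrightarrow> 0"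
  proof (rule Lim_null_comparison)
    show "\<forall>\<^sub>F N in sequentially. norm (?V N)
        \<le> (pi * \<bar>C\<bar> * (2 * \<eta>)) * exp (- \<delta> * b N)" using ev by eventually_elim auto
    show "(\<lambda>N. (pi * \<bar>C\<bar> * (2 * \<eta>)) * exp (- \<delta> * b N)) \<longlonglongrightarrow> 0"
      by (rule filterlim_compose[OF exp_minus_tendsto_0[OF C(1)] b_lim])
  qed
  have "(\<lambda>N. (integral {-b N..b N} ?g
       + ?V N) / (2 * of_real pi * \<i>))
       \<longlonglongrightarrow> (line_integral f \<gamma> + 0) / (2 * of_real pi * \<i>)"
    by (intro tendsto_intros lim1 lim2) auto
  moreover have "\<forall>\<^sub>F N in sequentially. (integral {-b N..b N} ?g
       + ?V N) / (2 * of_real pi * \<i>)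
       = (\<Sum>n<N. (-1) ^ n / fact n * H (rp n))"
    using ev by eventually_elim simp
  ultimately have "(\<lambda>N. \<Sum>n<N. (-1) ^ n / fact n * H (rp n)) \<longlonglongrightarrow> (line_integral f \<gamma> + 0) / (2 * of_real pi * \<i>)"
    by (rule Lim_transform_eventually)
  thus ?thesis by (simp add: sums_def f_def rp_def)
qed

section \<open>The integrand\<close>

text \<open>A basic open set that meets Z in a single point determines that point, so a countable
  basis labels all of Z.\<close>

lemma countable_if_isolated:
  fixes Z :: "'a :: second_countable_topology set"
  assumes "\<And>t. t \<in> Z \<Longrightarrow> \<exists>U. open U \<and> t \<in> U \<and> Z \<inter> U = {t}"
  shows "countable Z"
proof -
  obtain B :: "'a set set" where B: "countable B" "topological_basis B"
    using ex_countable_basis by blast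
  have "Z \<subseteq> (\<lambda>V. THE t. Z \<inter> V = {t}) ` B"
  proof
    fix t assume t: "t \<in> Z"
    then obtain U where U: "open U" "t \<in> U" "Z \<inter> U = {t}" using assms by blast
    then obtain V where V: "V \<in> B" "t \<in> V" "V \<subseteq> U" using B(2) by (meson topological_basisE)
    hence "Z \<inter> V = {t}" using U t by blast
    hence "(THE t. Z \<inter> V = {t}) = t" by auto
    thus "t \<in> (\<lambda>V. THE t. Z \<inter> V = {t}) ` B" using V by force
  qed
  thus ?thesis using B countable_subset by blast
qed

lemma eventually_neq_if_vector_derivative_nonzero:
  fixes \<gamma> :: "real \<Rightarrow> complex"
  assumes D: "(\<gamma> has_vector_derivative D) (at t)" and "D \<noteq> 0"
  shows "eventually (\<lambda>x. \<gamma> x \<noteq> \<gamma> t) (at t)"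
proof -
  have *: "eventually (\<lambda>x. f x \<noteq> f t) (at t)" if "(f has_real_derivative d) (at t)" "d \<noteq> 0" for f d
  proof -
    have "((\<lambda>y. (f y - f t) / (y - t)) \<longlongrightarrow> d) (at t)" using that by (simp add: has_field_derivative_iff)
    from tendsto_imp_eventually_ne[OF this that(2)] show ?thesis by eventually_elim auto
  qed
  have "Re D \<noteq> 0 \<or> Im D \<noteq> 0" using \<open>D \<noteq> 0\<close> by (auto simp: complex_eq_iff)
  thus ?thesis
  proof
    assume "Re D \<noteq> 0"
    from *[OF _ this, of "\<lambda>x. Re (\<gamma> x)"] show ?thesis
      using bounded_linear.has_vector_derivative[OF bounded_linear_Re D]
      by (force simp: has_real_derivative_iff_has_vector_derivative elim: eventually_mono)
  next
    assume "Im D \<noteq> 0"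
    from *[OF _ this, of "\<lambda>x. Im (\<gamma> x)"] show ?thesis
      using bounded_linear.has_vector_derivative[OF bounded_linear_Im D]
      by (force simp: has_real_derivative_iff_has_vector_derivative elim: eventually_mono)
  qed
qed

text \<open>With nonzero velocity the contour leaves q at once, so such times are isolated. Times of
  zero velocity may fill an interval but contribute nothing to a line integral.\<close>

lemma countable_contour_preimage:
  assumes "regular_contour \<gamma>"
  shows "countable {t. \<gamma> t = q \<and> vector_derivative \<gamma> (at t) \<noteq> 0}"
proof -
  \<comment> \<open>Times without a derivative, where \<open>vector_derivative\<close> carries no
    information, are excluded from \<open>Z\<close> and caught by the finite sets \<open>S n\<close>
    below.\<close>
  define Z where "Z = {t. \<gamma> t = q \<and> \<gamma> differentiable (at t) \<and> vector_derivative \<gamma> (at t) \<noteq> 0}"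
  have "countable Z"
  proof (rule countable_if_isolated)
    fix t assume t: "t \<in> Z"
    hence "(\<gamma> has_vector_derivative vector_derivative \<gamma> (at t)) (at t)"
      by (simp add: Z_def vector_derivative_works)
    from eventually_neq_if_vector_derivative_nonzero[OF this]
    have "eventually (\<lambda>x. \<gamma> x \<noteq> \<gamma> t) (at t)" using t by (auto simp: Z_def)
    then obtain U where "open U" "t \<in> U" "\<forall>x\<in>U. x \<noteq> t \<longrightarrow> \<gamma> x \<noteq> \<gamma> t"
      unfolding eventually_at_topological by auto
    thus "\<exists>U. open U \<and> t \<in> U \<and> Z \<inter> U = {t}"
      using t by (intro exI[of _ U]) (auto simp: Z_def)
  qed
  moreover have "\<exists>S. finite S \<and> (\<forall>t\<in>{-real n..real n} - S. \<gamma> differentiable (at t))" for n :: nat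
    using regular_contour_differentiable_off_finite[OF assms] by metis
  then obtain S where S: "\<And>n::nat. finite (S n)" "\<And>n t. t \<in> {-real n..real n} - S n \<Longrightarrow> \<gamma> differentiable (at t)"
    by metis
  have "t \<in> Z \<union> (\<Union>n. S n)" if t: "\<gamma> t = q" "vector_derivative \<gamma> (at t) \<noteq> 0" for t
  proof -
    obtain n :: nat where "\<bar>t\<bar> \<le> real n" using real_arch_simple by blast
    hence "t \<in> {-real n..real n}" by auto
    thus ?thesis using S(2)[of t n] t by (auto simp: Z_def)
  qed
  hence "{t. \<gamma> t = q \<and> vector_derivative \<gamma> (at t) \<noteq> 0} \<subseteq> Z \<union> (\<Union>n. S n)" by blast
  moreover have "countable (\<Union>n. S n)" using S(1) by (auto intro: countable_finite)
  ultimately show ?thesis by (meson countable_Un countable_subset)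
qed

text \<open>The contour may pass through, or even rest at, a zero of the denominator of \<open>Gcd\<close>, where the
  quotient takes the junk value 0.\<close>

lemma line_integral_cong_off_finite:
  assumes reg: "regular_contour \<gamma>" and X: "finite X" and eq: "\<And>t. \<gamma> t \<notin> X \<Longrightarrow> f (\<gamma> t) = g (\<gamma> t)"
  shows "line_integral f \<gamma> = line_integral g \<gamma>"
  unfolding line_integral_def
proof (rule integral_spike)
  \<comment> \<open>Off this countable set, a time spent in X has velocity 0, so both integrands
    vanish there.\<close>
  let ?N = "\<Union>q\<in>X. {t. \<gamma> t = q \<and> vector_derivative \<gamma> (at t) \<noteq> 0}"
  have "countable ?N" by (rule countable_UN[OF countable_finite[OF X] countable_contour_preimage[OF reg]])
  hence "?N \<in> null_sets lborel" by (rule countable_imp_null_set_lborel)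
  thus "negligible ?N" by (simp add: negligible_iff_null_sets null_sets_completionI)
  fix t assume "t \<in> UNIV - ?N"
  thus "g (\<gamma> t) * vector_derivative \<gamma> (at t) = f (\<gamma> t) * vector_derivative \<gamma> (at t)"
    using eq[of t] by (cases "\<gamma> t \<in> X") auto
qed

lemma line_integral_cmult: "line_integral (\<lambda>s. a * f s) \<gamma> = a * line_integral f \<gamma>"
  unfolding line_integral_def by (simp add: mult.assoc)

text \<open>\<open>rGamma\<close> is entire, so only the left poles remain as singularities. It also
  matches division by Gamma at every s: at a pole Gamma is 0 by convention, and so is the
  quotient.\<close>

definition mb_core :: "nat \<Rightarrow> nat \<Rightarrow> complex \<Rightarrow> (nat \<Rightarrow> complex) \<Rightarrow> (nat \<Rightarrow> complex) \<Rightarrow> complex \<Rightarrow> complex" where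
  "mb_core L M \<beta> c d s = (\<Prod>l<L. Gamma (s + 1 / (\<beta> * c l))) * (\<Prod>m<M. rGamma (s - 1 / (\<beta> * d m)))"

lemma integrand_eq:
  "integrand L M \<beta> c d k \<zeta> s = Gamma (1 - of_int k - s) * (mb_core L M \<beta> c d s * exp (s * \<zeta>))"
proof -
  have "(\<Prod>m<M. rGamma (s - 1 / (\<beta> * d m))) = inverse (\<Prod>m<M. Gamma (s - 1 / (\<beta> * d m)))"
    unfolding rGamma_inverse_Gamma by (induction M) simp_all
  thus ?thesis by (simp add: integrand_def mb_core_def divide_inverse[of _ "prod _ _"] mult_ac)
qed

lemma not_left_pole_imp:
  assumes "s \<notin> left_poles L \<beta> c" "l < L"
  shows "s + 1 / (\<beta> * c l) \<notin> \<int>\<^sub>\<le>\<^sub>0"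
proof
  assume "s + 1 / (\<beta> * c l) \<in> \<int>\<^sub>\<le>\<^sub>0"
  then obtain n where "s + 1 / (\<beta> * c l) = - of_nat n" by (auto elim!: nonpos_Ints_cases')
  hence "s = - of_nat n - 1 / (\<beta> * c l)" by (simp add: algebra_simps)
  thus False using assms unfolding left_poles_def by blast
qed

lemma holomorphic_mb_core: "mb_core L M \<beta> c d holomorphic_on - left_poles L \<beta> c"
  unfolding mb_core_def by (intro holomorphic_intros) (use not_left_pole_imp in auto)

lemma left_poles_closed_under_pred:
  assumes "s \<in> left_poles L \<beta> c" shows "s - 1 \<in> left_poles L \<beta> c"
proof -
  obtain i l where "s = - of_nat i - 1 / (\<beta> * c l)" "l < L" using assms by (auto simp: left_poles_def)
  hence "s - 1 = - of_nat (Suc i) - 1 / (\<beta> * c l)" by simp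
  thus ?thesis unfolding left_poles_def using \<open>l < L\<close> by blast
qed

text \<open>The product over d is kept as a factor instead of being divided out, so that the
  functional equation includes the points s = 1/(beta d_m).\<close>

lemma mb_core_plus1:
  assumes "s \<notin> left_poles L \<beta> c"
  shows "mb_core L M \<beta> c d (s + 1) * (\<Prod>m<M. s - 1 / (\<beta> * d m)) = (\<Prod>l<L. s + 1 / (\<beta> * c l)) * mb_core L M \<beta> c d s"
proof -
  have 1: "(\<Prod>l<L. Gamma (s + 1 + 1 / (\<beta> * c l))) = (\<Prod>l<L. s + 1 / (\<beta> * c l)) * (\<Prod>l<L. Gamma (s + 1 / (\<beta> * c l)))"
    unfolding prod.distrib[symmetric]
  proof (intro prod.cong refl)
    fix l assume "l \<in> {..<L}"
    thus "Gamma (s + 1 + 1 / (\<beta> * c l)) = (s + 1 / (\<beta> * c l)) * Gamma (s + 1 / (\<beta> * c l))"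
      using Gamma_plus1[OF not_left_pole_imp[OF assms, of l]] by (simp add: add_ac)
  qed
  have 2: "(\<Prod>m<M. rGamma (s - 1 / (\<beta> * d m))) = (\<Prod>m<M. s - 1 / (\<beta> * d m)) * (\<Prod>m<M. rGamma (s + 1 - 1 / (\<beta> * d m)))"
    unfolding prod.distrib[symmetric]
  proof (intro prod.cong refl)
    fix m
    show "rGamma (s - 1 / (\<beta> * d m)) = (s - 1 / (\<beta> * d m)) * rGamma (s + 1 - 1 / (\<beta> * d m))"
      using rGamma_plus1[of "s - 1 / (\<beta> * d m)"] by (simp add: algebra_simps)
  qed
  show ?thesis unfolding mb_core_def 1 2 by (simp add: mult_ac)
qed

lemma Gcd_eq:
  assumes "\<beta> \<noteq> 0" "\<forall>l<L. c l \<noteq> 0" "\<forall>m<M. d m \<noteq> 0"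
  shows "Gcd L M c d (\<beta> * s) = kappa L M \<beta> c d * (\<Prod>l<L. s + 1 / (\<beta> * c l)) / (\<Prod>m<M. s - 1 / (\<beta> * d m))"
proof -
  have 1: "(\<Prod>l<L. 1 + c l * (\<beta> * s)) = (\<Prod>l<L. \<beta> * c l) * (\<Prod>l<L. s + 1 / (\<beta> * c l))"
    unfolding prod.distrib[symmetric] using assms by (intro prod.cong refl) (auto simp: field_simps)
  have "(\<Prod>m<M. 1 - d m * (\<beta> * s)) = (\<Prod>m<M. - (\<beta> * d m) * (s - 1 / (\<beta> * d m)))"
    using assms by (intro prod.cong refl) (auto simp: field_simps)
  also have "\<dots> = (-1) ^ M * (\<Prod>m<M. \<beta> * d m) * (\<Prod>m<M. s - 1 / (\<beta> * d m))"
    unfolding prod.distrib[of "\<lambda>m. - (\<beta> * d m)"] by (subst prod_uminus) simp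
  finally have 2: "(\<Prod>m<M. 1 - d m * (\<beta> * s)) = (-1) ^ M * (\<Prod>m<M. \<beta> * d m) * (\<Prod>m<M. s - 1 / (\<beta> * d m))" .
  show ?thesis unfolding Gcd_def kappa_def 1 2
    by (cases "even M") simp_all
qed

lemma kappa_nonzero:
  assumes "\<beta> \<noteq> 0" "\<forall>l<L. c l \<noteq> 0" "\<forall>m<M. d m \<noteq> 0"
  shows "kappa L M \<beta> c d \<noteq> 0"
  unfolding kappa_def using assms by auto

lemma right_left_poles_disjoint:
  assumes "\<forall>l<L. 1 / (\<beta> * c l) \<notin> \<int>"
  shows "right_poles k \<inter> left_poles L \<beta> c = {}"
proof (rule ccontr)
  assume "right_poles k \<inter> left_poles L \<beta> c \<noteq> {}"
  then obtain n i l where "of_int (1 - k) + of_nat n = - of_nat i - 1 / (\<beta> * c l)" "l < L"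
    unfolding right_poles_def left_poles_def by blast
  hence "1 / (\<beta> * c l) = of_int (- int i - (1 - k) - int n)" by (simp add: algebra_simps)
  thus False using assms \<open>l < L\<close> Ints_of_int by metis
qed

lemma of_int_not_left_pole:
  assumes "\<forall>l<L. 1 / (\<beta> * c l) \<notin> \<int>"
  shows "of_int j \<notin> left_poles L \<beta> c"
proof -
  have "of_int j = of_int (1 - (1 - j)) + (of_nat 0 :: complex)" by simp
  hence "of_int j \<in> right_poles (1 - j)" unfolding right_poles_def by blast
  thus ?thesis using right_left_poles_disjoint[OF assms, of "1 - j"] by blast
qed

lemma mb_core_of_int_nonzero:
  assumes "\<forall>l<L. 1 / (\<beta> * c l) \<notin> \<int>" "\<forall>m<M. 1 / (\<beta> * d m) \<notin> \<int>"
  shows "mb_core L M \<beta> c d (of_int j) \<noteq> 0"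
proof -
  have "Gamma (of_int j + 1 / (\<beta> * c l)) \<noteq> 0" if "l < L" for l
    using not_left_pole_imp[OF of_int_not_left_pole[OF assms(1)] that] by (simp add: Gamma_eq_zero_iff)
  moreover have "rGamma (of_int j - 1 / (\<beta> * d m)) \<noteq> 0" if "m < M" for m
  proof
    assume "rGamma (of_int j - 1 / (\<beta> * d m)) = 0"
    hence "of_int j - 1 / (\<beta> * d m) \<in> \<int>"
      unfolding rGamma_eq_zero_iff using nonpos_Ints_subset_Ints by blast
    from Ints_diff[OF Ints_of_int[of j] this] show False using assms(2) that by simp
  qed
  ultimately show ?thesis unfolding mb_core_def by auto
qed

lemma strip_decay_mb_core:
  "strip_decay ((real L - real M) * (pi/2)) (mb_core L M \<beta> c d)"
proof -
  have "strip_decay (real L * (pi/2) + real M * (- pi/2))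
     (\<lambda>s. (\<Prod>l<L. Gamma (s + 1 / (\<beta> * c l))) * (\<Prod>m<M. rGamma (s + - (1 / (\<beta> * d m)))))"
    by (intro strip_decay_mult strip_decay_prod strip_decay_shift strip_decay_Gamma strip_decay_rGamma)
  moreover have "real L * (pi/2) + real M * (- pi/2) = (real L - real M) * (pi/2)"
    by (simp add: algebra_simps)
  moreover have "mb_core L M \<beta> c d = (\<lambda>s. (\<Prod>l<L. Gamma (s + 1 / (\<beta> * c l))) * (\<Prod>m<M. rGamma (s + - (1 / (\<beta> * d m)))))"
    by (simp add: mb_core_def fun_eq_iff)
  ultimately show ?thesis by (simp only:)
qed

lemma strip_decay_Gamma_mb_core:
  "strip_decay ((real L - real M + 1) * (pi/2)) (\<lambda>s. Gamma (1 - of_int k - s) * mb_core L M \<beta> c d s)"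
proof -
  have "strip_decay (pi/2 + (real L - real M) * (pi/2)) (\<lambda>s. Gamma (1 - of_int k - s) * mb_core L M \<beta> c d s)"
    by (intro strip_decay_mult strip_decay_reflect strip_decay_Gamma strip_decay_mb_core)
  moreover have "pi/2 + (real L - real M) * (pi/2) = (real L - real M + 1) * (pi/2)"
    by (simp add: field_simps)
  ultimately show ?thesis by (simp only:)
qed

section \<open>Laplace integrals over vertical lines\<close>

lemma integrable_on_UNIV_exp_bound:
  fixes g :: "real \<Rightarrow> complex"
  assumes "continuous_on UNIV g" "\<And>t. norm (g t) \<le> C * exp (- \<delta> * \<bar>t\<bar>)" "\<delta> > 0"
  shows "g integrable_on UNIV"
proof (rule integrable_on_UNIV_exp_tails[where T = 0])
  show "norm (g t) \<le> C * exp (- \<delta> * \<bar>t\<bar>)" for t by (rule assms)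
  show "g integrable_on {-R..R}" for R
    by (rule integrable_continuous_real) (rule continuous_on_subset[OF assms(1)], simp)
qed (rule assms)

lemma norm_exp_minus_linear_le: "norm (exp z - 1 - z) \<le> exp (norm z) * (norm z)\<^sup>2" for z :: complex
proof -
  have "norm (exp z - (\<Sum>k\<le>1. z ^ k / fact k)) \<le> exp \<bar>Re z\<bar> * norm z ^ Suc 1 / fact 1"
    by (rule Taylor_exp)
  also have "\<dots> \<le> exp (norm z) * norm z ^ Suc 1 / fact 1"
    using abs_Re_le_cmod[of z] by (intro divide_right_mono mult_right_mono) auto
  finally show ?thesis by (simp add: power2_eq_square diff_diff_eq)
qed

lemma has_field_derivative_quadratic_bound:
  fixes J :: "complex \<Rightarrow> complex"
  assumes "r > 0" "\<And>w. norm w \<le> r \<Longrightarrow> norm (J (\<zeta> + w) - J \<zeta> - w * D) \<le> K * (norm w)\<^sup>2"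
  shows "(J has_field_derivative D) (at \<zeta>)"
proof -
  have "(\<lambda>w. (J (\<zeta> + w) - J \<zeta>) / w - D) \<midarrow>0\<rightarrow> 0"
  proof (rule Lim_null_comparison)
    have "(\<lambda>w::complex. K * norm w) \<midarrow>0\<rightarrow> K * norm (0::complex)" by (intro tendsto_intros)
    thus "(\<lambda>w::complex. K * norm w) \<midarrow>0\<rightarrow> 0" by simp
    have "\<forall>\<^sub>F w in at 0. w \<noteq> (0::complex) \<and> norm w < r"
      unfolding eventually_at using assms(1) by (auto intro!: exI[of _ r] simp: dist_norm)
    thus "\<forall>\<^sub>F w in at 0. norm ((J (\<zeta> + w) - J \<zeta>) / w - D) \<le> K * norm w"
    proof eventually_elim
      case (elim w)
      have "(J (\<zeta> + w) - J \<zeta>) / w - D = (J (\<zeta> + w) - J \<zeta> - w * D) / w" using elim by (simp add: field_simps)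
      hence "norm ((J (\<zeta> + w) - J \<zeta>) / w - D) \<le> K * (norm w)\<^sup>2 / norm w"
        using assms(2)[of w] elim by (simp add: norm_divide divide_right_mono)
      thus ?case using elim by (simp add: power2_eq_square)
    qed
  qed
  thus ?thesis unfolding DERIV_def by (simp add: LIM_zero_iff)
qed

lemma norm_mult_vertical_exp_le:
  fixes h :: complex
  assumes "norm h \<le> C * exp (- \<nu> * \<bar>t\<bar>)" "\<bar>Im \<zeta>\<bar> \<le> \<theta>" "C \<ge> 0"
  shows "norm (h * exp (Complex b t * \<zeta>)) \<le> C * exp (b * Re \<zeta>) * exp (- (\<nu> - \<theta>) * \<bar>t\<bar>)"
proof -
  have "- (t * Im \<zeta>) \<le> \<bar>t\<bar> * \<bar>Im \<zeta>\<bar>" using abs_ge_minus_self[of "t * Im \<zeta>"] by (simp add: abs_mult)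
  also have "\<dots> \<le> \<bar>t\<bar> * \<theta>" using assms(2) by (intro mult_left_mono) auto
  finally have "Re (Complex b t * \<zeta>) \<le> b * Re \<zeta> + \<bar>t\<bar> * \<theta>" by simp
  hence "norm (h * exp (Complex b t * \<zeta>)) \<le> (C * exp (- \<nu> * \<bar>t\<bar>)) * exp (b * Re \<zeta> + \<bar>t\<bar> * \<theta>)"
    unfolding norm_mult using assms(1,3) by (intro mult_mono) auto
  also have "\<dots> = C * exp (b * Re \<zeta>) * (exp (- \<nu> * \<bar>t\<bar>) * exp (\<bar>t\<bar> * \<theta>))"
    unfolding exp_add by simp
  also have "exp (- \<nu> * \<bar>t\<bar>) * exp (\<bar>t\<bar> * \<theta>) = exp (- (\<nu> - \<theta>) * \<bar>t\<bar>)"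
    unfolding exp_add[symmetric] by (simp add: algebra_simps)
  finally show ?thesis .
qed

text \<open>Differentiation under the integral by direct estimate: exp(w s) - 1 - w s is quadratic
  in w, up to a factor growing exponentially in |s| at a small rate, which the decay of h
  outweighs.\<close>

lemma has_field_derivative_vertical_exp_integral:
  fixes h :: "real \<Rightarrow> complex" and b :: real
  assumes cont: "continuous_on UNIV h" and bound: "\<And>\<nu>. \<nu> < \<mu> \<Longrightarrow> \<exists>C. \<forall>t. norm (h t) \<le> C * exp (- \<nu> * \<bar>t\<bar>)"
    and \<zeta>: "\<bar>Im \<zeta>\<bar> < \<mu>"
  shows "((\<lambda>\<zeta>. integral UNIV (\<lambda>t. h t * exp (Complex b t * \<zeta>))) has_field_derivative
          integral UNIV (\<lambda>t. Complex b t * (h t * exp (Complex b t * \<zeta>)))) (at \<zeta>)"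
    and "(\<lambda>t. h t * exp (Complex b t * \<zeta>)) integrable_on UNIV"
    and "(\<lambda>t. Complex b t * (h t * exp (Complex b t * \<zeta>))) integrable_on UNIV"
proof -
  obtain \<nu> where \<nu>: "\<bar>Im \<zeta>\<bar> < \<nu>" "\<nu> < \<mu>" using dense[OF \<zeta>] by blast
  \<comment> \<open>A quarter of the gap: the integrand decays at rate 4 r, multipliers may grow at
    rate 2 r, and the rate 2 r that is left keeps everything integrable.\<close>
  define r where "r = (\<nu> - \<bar>Im \<zeta>\<bar>) / 4"
  have r: "r > 0" using \<nu> by (simp add: r_def)
  have r4: "4 * r = \<nu> - \<bar>Im \<zeta>\<bar>" by (simp add: r_def)
  obtain C where C: "\<And>t. norm (h t) \<le> C * exp (- \<nu> * \<bar>t\<bar>)" using bound[OF \<nu>(2)] by blast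
  have C0: "C \<ge> 0" using order_trans[OF norm_ge_zero C[of 0]] by simp
  have contC: "continuous_on UNIV (\<lambda>t. Complex b t)" unfolding Complex_eq by (intro continuous_intros)
  define C1 where "C1 = C * exp (b * Re \<zeta>)"
  have C1: "C1 \<ge> 0" using C0 by (simp add: C1_def)
  have nb: "norm (Complex b t) \<le> \<bar>b\<bar> + \<bar>t\<bar>" for t using cmod_le[of "Complex b t"] by simp
  have base: "norm (h t * exp (Complex b t * \<zeta>)) \<le> C1 * exp (- (4 * r) * \<bar>t\<bar>)" for t
    using norm_mult_vertical_exp_le[OF C order_refl C0, where \<zeta> = \<zeta> and b = b and t = t]
    unfolding C1_def r4 .
  have expr: "exp (x * norm (Complex b t)) \<le> exp (x * \<bar>b\<bar>) * exp (x * \<bar>t\<bar>)" if "x \<ge> 0" for x t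
    unfolding exp_add[symmetric] using mult_left_mono[OF nb that] by (simp add: distrib_left)
  have bnd: "norm (X * (h t * exp (Complex b t * \<zeta>))) \<le> (K * C1 * exp (2 * r * \<bar>b\<bar>)) * exp (- (2 * r) * \<bar>t\<bar>)"
    if X: "norm X \<le> K * exp (2 * r * norm (Complex b t))" and "K \<ge> 0" for X K t
  proof -
    have "norm (X * (h t * exp (Complex b t * \<zeta>))) \<le> (K * (exp (2 * r * \<bar>b\<bar>) * exp (2 * r * \<bar>t\<bar>))) * (C1 * exp (- (4 * r) * \<bar>t\<bar>))"
      unfolding norm_mult[of X]
    proof (rule mult_mono[OF _ base])
      show "norm X \<le> K * (exp (2 * r * \<bar>b\<bar>) * exp (2 * r * \<bar>t\<bar>))"
        using X mult_left_mono[OF expr[of "2 * r" t] \<open>K \<ge> 0\<close>] r by linarith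
    qed (use \<open>K \<ge> 0\<close> in auto)
    also have "\<dots> = (K * C1 * exp (2 * r * \<bar>b\<bar>)) * (exp (2 * r * \<bar>t\<bar>) * exp (- (4 * r) * \<bar>t\<bar>))" by (simp only: mult_ac)
    also have "exp (2 * r * \<bar>t\<bar>) * exp (- (4 * r) * \<bar>t\<bar>) = exp (- (2 * r) * \<bar>t\<bar>)"
      unfolding exp_add[symmetric] by (simp add: algebra_simps)
    finally show ?thesis .
  qed
  have cint: "continuous_on UNIV (\<lambda>t. h t * exp (Complex b t * z))" for z
    by (intro continuous_intros cont contC)
  show i1: "(\<lambda>t. h t * exp (Complex b t * \<zeta>)) integrable_on UNIV"
    by (rule integrable_on_UNIV_exp_bound[OF cint base]) (use r in simp)
  show i2: "(\<lambda>t. Complex b t * (h t * exp (Complex b t * \<zeta>))) integrable_on UNIV"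
  proof (rule integrable_on_UNIV_exp_bound)
    show "continuous_on UNIV (\<lambda>t. Complex b t * (h t * exp (Complex b t * \<zeta>)))"
      by (intro continuous_on_mult[OF contC cint])
    fix t
    have "2 * r * norm (Complex b t) \<le> exp (2 * r * norm (Complex b t))"
      using exp_ge_add_one_self[of "2 * r * norm (Complex b t)"] by linarith
    hence "norm (Complex b t) \<le> 1 / (2 * r) * exp (2 * r * norm (Complex b t))" using r by (simp add: field_simps)
    thus "norm (Complex b t * (h t * exp (Complex b t * \<zeta>))) \<le> (1 / (2 * r) * C1 * exp (2 * r * \<bar>b\<bar>)) * exp (- (2 * r) * \<bar>t\<bar>)"
      by (rule bnd) (use r in simp)
  qed (use r in simp)
  define J where "J = (\<lambda>\<zeta>. integral UNIV (\<lambda>t. h t * exp (Complex b t * \<zeta>)))"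
  define D where "D = integral UNIV (\<lambda>t. Complex b t * (h t * exp (Complex b t * \<zeta>)))"
  define K where "K = integral UNIV (\<lambda>t. (2 / r\<^sup>2 * C1 * exp (2 * r * \<bar>b\<bar>)) * exp (- (2 * r) * \<bar>t\<bar>))"
  have "(J has_field_derivative D) (at \<zeta>)"
  proof (rule has_field_derivative_quadratic_bound[OF r])
    fix w :: complex assume w: "norm w \<le> r"
    \<comment> \<open>With s = |Complex b t| and |w| <= r, the factor (s |w|)^2 equals (|w| / r)^2
      (r s)^2, and (r s)^2 <= 2 exp(r s). This separates |w|^2 from a growth of rate 2 r.\<close>
    have Kbound: "norm ((exp (Complex b t * w) - 1 - Complex b t * w)) \<le> ((norm w)\<^sup>2 * (2 / r\<^sup>2)) * exp (2 * r * norm (Complex b t))" for t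
    proof -
      define s where "s = norm (Complex b t)"
      have s: "s \<ge> 0" by (simp add: s_def)
      have "norm ((exp (Complex b t * w) - 1 - Complex b t * w)) \<le> exp (s * norm w) * (s * norm w)\<^sup>2"
        using norm_exp_minus_linear_le[of "Complex b t * w"] by (simp add: norm_mult s_def)
      also have "exp (s * norm w) \<le> exp (r * s)" using mult_left_mono[OF w s] by (simp add: mult.commute)
      also have "exp (r * s) * (s * norm w)\<^sup>2 = exp (r * s) * ((norm w)\<^sup>2 / r\<^sup>2 * (r * s)\<^sup>2)"
        using r by (simp add: power_mult_distrib)
      also have "\<dots> \<le> exp (r * s) * ((norm w)\<^sup>2 / r\<^sup>2 * (2 * exp (r * s)))"
        using power_le_fact_mult_exp[of "r * s" 2] r s by (intro mult_left_mono) (auto simp: fact_2)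
      also have "\<dots> = ((norm w)\<^sup>2 * (2 / r\<^sup>2)) * (exp (r * s) * exp (r * s))" by simp
      also have "exp (r * s) * exp (r * s) = exp (2 * r * s)" unfolding exp_add[symmetric] by simp
      finally show ?thesis by (simp add: s_def mult_right_mono)
    qed
    let ?E = "\<lambda>t. (exp (Complex b t * w) - 1 - Complex b t * w) * (h t * exp (Complex b t * \<zeta>))"
    have Ebound: "norm (?E t) \<le> (((norm w)\<^sup>2 * (2 / r\<^sup>2)) * C1 * exp (2 * r * \<bar>b\<bar>)) * exp (- (2 * r) * \<bar>t\<bar>)" for t
      by (rule bnd[OF Kbound]) simp
    have i3: "?E integrable_on UNIV"
      by (rule integrable_on_UNIV_exp_bound[OF _ Ebound]) (use r in \<open>auto intro!: continuous_intros contC cont\<close>)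
    have i4: "(\<lambda>t. w * (Complex b t * (h t * exp (Complex b t * \<zeta>)))) integrable_on UNIV"
      by (intro integrable_on_mult_right i2)
    have eqE: "h t * exp (Complex b t * (\<zeta> + w)) = ?E t + (h t * exp (Complex b t * \<zeta>) + w * (Complex b t * (h t * exp (Complex b t * \<zeta>))))" for t
      by (simp add: distrib_left exp_add algebra_simps)
    have "J (\<zeta> + w) = integral UNIV ?E + (J \<zeta> + w * D)"
      unfolding J_def D_def eqE
      by (subst integral_add[OF i3 integrable_add[OF i1 i4]], subst integral_add[OF i1 i4]) simp
    hence "norm (J (\<zeta> + w) - J \<zeta> - w * D) = norm (integral UNIV ?E)" by (simp add: algebra_simps)
    also have "\<dots> \<le> integral UNIV (\<lambda>t. (((norm w)\<^sup>2 * (2 / r\<^sup>2)) * C1 * exp (2 * r * \<bar>b\<bar>)) * exp (- (2 * r) * \<bar>t\<bar>))"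
      by (rule integral_norm_bound_integral[OF i3 _ Ebound])
         (use integrable_exp_minus_abs[of "2 * r"] r in \<open>auto intro: integrable_on_mult_right\<close>)
    also have "\<dots> = K * (norm w)\<^sup>2" unfolding K_def integral_mult_right by (simp add: mult_ac)
    finally show "norm (J (\<zeta> + w) - J \<zeta> - w * D) \<le> K * (norm w)\<^sup>2" .
  qed
  thus "((\<lambda>\<zeta>. integral UNIV (\<lambda>t. h t * exp (Complex b t * \<zeta>))) has_field_derivative
          integral UNIV (\<lambda>t. Complex b t * (h t * exp (Complex b t * \<zeta>)))) (at \<zeta>)"
    by (simp add: J_def D_def)
qed

lemma strip_decay_line_bound:
  assumes dec: "strip_decay \<mu> h" and cont: "continuous_on UNIV (\<lambda>t. h (Complex b t))" and "\<nu> < \<mu>"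
  shows "\<exists>C. \<forall>t. norm (h (Complex b t)) \<le> C * exp (- \<nu> * \<bar>t\<bar>)"
proof -
  obtain C T where C: "C > 0" "T > 0" "\<And>s. \<bar>Re s\<bar> \<le> \<bar>b\<bar> \<Longrightarrow> T \<le> \<bar>Im s\<bar> \<Longrightarrow> norm (h s) \<le> C * exp (- \<nu> * \<bar>Im s\<bar>)"
    using strip_decayD[OF dec \<open>\<nu> < \<mu>\<close>, of "\<bar>b\<bar>"] by metis
  have "bounded ((\<lambda>t. h (Complex b t) * of_real (exp (\<nu> * \<bar>t\<bar>))) ` {-T..T})"
    by (intro compact_imp_bounded compact_continuous_image continuous_intros continuous_on_subset[OF cont]) auto
  then obtain K where K: "\<And>t. t \<in> {-T..T} \<Longrightarrow> norm (h (Complex b t) * of_real (exp (\<nu> * \<bar>t\<bar>))) \<le> K"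
    unfolding bounded_iff by (metis (no_types, lifting) imageI)
  have "norm (h (Complex b t)) \<le> max C K * exp (- \<nu> * \<bar>t\<bar>)" for t
  proof (cases "T \<le> \<bar>t\<bar>")
    case True
    have "norm (h (Complex b t)) \<le> C * exp (- \<nu> * \<bar>t\<bar>)" using C(3)[of "Complex b t"] True by simp
    also have "\<dots> \<le> max C K * exp (- \<nu> * \<bar>t\<bar>)" by (intro mult_right_mono) auto
    finally show ?thesis .
  next
    case False
    hence "t \<in> {-T..T}" by auto
    hence "norm (h (Complex b t)) * exp (\<nu> * \<bar>t\<bar>) \<le> K" using K[of t] by (simp add: norm_mult)
    hence "norm (h (Complex b t)) \<le> K * exp (- \<nu> * \<bar>t\<bar>)" by (simp add: exp_minus field_simps)
    also have "\<dots> \<le> max C K * exp (- \<nu> * \<bar>t\<bar>)" by (intro mult_right_mono) auto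
    finally show ?thesis .
  qed
  thus ?thesis by blast
qed

section \<open>The series and the Hankel contour\<close>

lemma tendsto_inverse_shift_at_infinity: "((\<lambda>s::complex. inverse (s + e)) \<longlongrightarrow> 0) at_infinity"
proof -
  have "filterlim (\<lambda>s::complex. s + e) at_infinity at_infinity"
    by (rule tendsto_add_filterlim_at_infinity'[OF filterlim_ident tendsto_const])
  thus ?thesis by (rule filterlim_compose[OF tendsto_inverse_0])
qed

lemma tendsto_ratio_shift_at_infinity: "((\<lambda>s::complex. (s + a) / (s + e)) \<longlongrightarrow> 1) at_infinity"
proof (rule Lim_transform_eventually)
  have "((\<lambda>s. 1 + (a - e) * inverse (s + e)) \<longlongrightarrow> 1 + (a - e) * 0) at_infinity"
    by (intro tendsto_intros tendsto_inverse_shift_at_infinity)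
  thus "((\<lambda>s. 1 + (a - e) * inverse (s + e)) \<longlongrightarrow> 1) at_infinity" by simp
  show "\<forall>\<^sub>F s in at_infinity. 1 + (a - e) * inverse (s + e) = (s + a) / (s + e)"
    unfolding eventually_at_infinity
  proof (intro exI[of _ "norm e + 1"] allI impI)
    fix s :: complex assume s: "norm e + 1 \<le> norm s"
    have "s + e \<noteq> 0"
    proof
      assume "s + e = 0"
      hence "s = - e" by (simp add: eq_neg_iff_add_eq_0)
      thus False using s by simp
    qed
    thus "1 + (a - e) * inverse (s + e) = (s + a) / (s + e)" by (simp add: field_simps)
  qed
qed

text \<open>The last two assumptions are the genericity: non-integrality of 1/(beta c_l) separates
  the two families of poles, and together they make \<open>mb_core\<close> finite and nonzero at all
  integers, hence every rho_i nonzero.\<close>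

locale mellin_barnes =
  fixes L M :: nat and \<beta> :: complex and c d :: "nat \<Rightarrow> complex"
  assumes beta: "\<beta> \<noteq> 0"
    and c_nz: "\<forall>l<L. c l \<noteq> 0" and d_nz: "\<forall>m<M. d m \<noteq> 0"
    and c_gen: "\<forall>l<L. 1 / (\<beta> * c l) \<notin> \<int>"
    and d_gen: "\<forall>m<M. 1 / (\<beta> * d m) \<notin> \<int>"
begin

abbreviation core :: "complex \<Rightarrow> complex" where "core \<equiv> mb_core L M \<beta> c d"
abbreviation kap :: complex where "kap \<equiv> kappa L M \<beta> c d"
abbreviation LP :: "complex set" where "LP \<equiv> left_poles L \<beta> c"
abbreviation pterm :: "int \<Rightarrow> complex \<Rightarrow> nat \<Rightarrow> complex" where "pterm \<equiv> phi_term L M \<beta> c d"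
abbreviation ptil :: "(real \<Rightarrow> complex) \<Rightarrow> int \<Rightarrow> complex \<Rightarrow> complex" where "ptil \<equiv> phitilde L M \<beta> c d"
abbreviation GDptil :: "(real \<Rightarrow> complex) \<Rightarrow> int \<Rightarrow> complex \<Rightarrow> complex" where "GDptil \<equiv> GD_phitilde L M \<beta> c d"
abbreviation xo :: "complex \<Rightarrow> complex" where "xo \<equiv> xof L M \<beta> c d"
abbreviation CK :: "int \<Rightarrow> complex" where "CK \<equiv> Ck L M \<beta> c d"
abbreviation rhoc :: "int \<Rightarrow> complex" where "rhoc \<equiv> rho L M \<beta> c d"
abbreviation rrc :: "int \<Rightarrow> complex" where "rrc \<equiv> rr L M \<beta> c d"
abbreviation rp :: "int \<Rightarrow> nat \<Rightarrow> complex" where "rp k n \<equiv> of_int (1 - k) + of_nat n"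

lemmas kap_nz = kappa_nonzero[OF beta c_nz d_nz]
lemmas poles_disjoint = right_left_poles_disjoint[OF c_gen]
lemmas core_of_int_nz = mb_core_of_int_nonzero[OF c_gen d_gen]

section \<open>Closed forms for the coefficients and the normalizing constants\<close>

lemma rp_pred: "rp (k - 1) n = rp k n + 1" "rp (k - 1) n = rp k (Suc n)"
  by simp_all

lemma Gcd_mult_core:
  assumes "s \<notin> LP" "\<forall>m<M. s \<noteq> 1 / (\<beta> * d m)"
  shows "Gcd L M c d (\<beta> * s) * core s = kap * core (s + 1)"
proof -
  have nz: "(\<Prod>m<M. s - 1 / (\<beta> * d m)) \<noteq> 0" using assms(2) by auto
  show ?thesis
    unfolding Gcd_eq[OF beta c_nz d_nz] using mb_core_plus1[OF assms(1), of M d] nz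
    by (simp add: divide_simps mult.assoc mult.commute)
qed

lemma Gcd_of_int:
  "Gcd L M c d (of_int i * \<beta>) = kap * core (of_int i + 1) / core (of_int i)"
proof -
  have "of_int i \<noteq> 1 / (\<beta> * d m)" if "m < M" for m using d_gen that Ints_of_int by metis
  hence "Gcd L M c d (\<beta> * of_int i) * core (of_int i) = kap * core (of_int i + 1)"
    by (intro Gcd_mult_core of_int_not_left_pole[OF c_gen]) auto
  thus ?thesis using core_of_int_nz[of i] by (simp add: field_simps)
qed

lemma core_0: "core 0 = kap * core 1"
  using Gcd_of_int[of 0] core_of_int_nz[of 0] by (simp add: Gcd_def)

lemma rr_nonzero: "rrc i \<noteq> 0"
  unfolding rr_def Gcd_of_int using beta kap_nz core_of_int_nz[of i] core_of_int_nz[of "i + 1"] by simp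

lemma rho_step: "rhoc (i + 1) = rrc (i + 1) * rhoc i"
proof (cases "i \<ge> 0")
  case True
  hence "nat (i + 1) = Suc (nat i)" by simp
  thus ?thesis using True by (simp add: rho_def add.commute)
next
  case False
  \<comment> \<open>For negative indices the product starts with r_0, so the step from -(n + 1) to
    -n carries the factor r_(-n).\<close>
  define n where "n = nat (- (i + 1))"
  have i: "i = - int (Suc n)" using False by (simp add: n_def)
  have "rhoc (- int (Suc n)) = (\<Prod>k\<in>{0..<Suc n}. inverse (rrc (- int k)))"
  proof -
    have c: "\<not> 0 \<le> - int (Suc n)" by simp
    have n': "nat (- (- int (Suc n))) = Suc n" by (simp only: minus_minus nat_int)
    show ?thesis unfolding rho_def if_not_P[OF c] n' ..
  qed
  moreover have "rhoc (- int n) = (\<Prod>k\<in>{0..<n}. inverse (rrc (- int k)))"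
    unfolding rho_def by simp
  ultimately have "rhoc (- int (Suc n)) = rhoc (- int n) * inverse (rrc (- int n))"
    by simp
  moreover have "i + 1 = - int n" using i by simp
  ultimately show ?thesis using rr_nonzero[of "- int n"] unfolding i by (simp add: field_simps)
qed

text \<open>Both sides equal 1 at i = 0 and obey the same recursion with ratio r_(i+1), since G at
  an integer multiple of beta is a quotient of neighbouring \<open>core\<close> values. Nonvanishing
  of r lets the recursion run backwards too.\<close>

lemma rho_eq: "rhoc i = (\<beta> * kap) powi i * core (of_int i + 1) / core 1"
proof -
  have nz: "\<beta> * kap \<noteq> 0" using beta kap_nz by simp
  have core1: "core 1 \<noteq> 0" using core_of_int_nz[of 1] by simp
  have rr: "rrc (i + 1) = \<beta> * kap * core (of_int i + 2) / core (of_int i + 1)" for i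
    unfolding rr_def Gcd_of_int by (simp add: add.assoc)
  have cnz: "core (of_int i + 1) \<noteq> 0" for i using core_of_int_nz[of "i + 1"] by simp
  have step: "rrc (i + 1) * ((\<beta> * kap) powi i * core (of_int i + 1) / core 1)
      = (\<beta> * kap) powi (i + 1) * core (of_int (i + 1) + 1) / core 1" for i
    unfolding rr using cnz[of i] nz by (simp add: power_int_add_1 add.assoc mult_ac)
  show ?thesis
  proof (induction i rule: int_induct[where k = 0])
    case base
    show ?case using core1 by (simp add: rho_def)
  next
    case (step1 i)
    show ?case unfolding rho_step step1(2) step ..
  next
    case (step2 i)
    have "rrc i * rhoc (i - 1) = rrc i * ((\<beta> * kap) powi (i - 1) * core (of_int (i - 1) + 1) / core 1)"
      using rho_step[of "i - 1"] step[of "i - 1"] step2(2) by simp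
    thus ?case using rr_nonzero[of i] unfolding mult_cancel_left by blast
  qed
qed

lemma Ck_eq: "CK k = (- \<beta>) powi (1 - k) / core 0"
proof -
  have "(- \<beta>) powi (1 - k) = inverse ((- \<beta>) powi (k - 1))"
    using power_int_minus[of "-\<beta>" "k - 1"] by simp
  moreover have "(\<Prod>m<M. rGamma (- 1 / (\<beta> * d m))) = inverse (\<Prod>m<M. Gamma (- 1 / (\<beta> * d m)))"
    unfolding rGamma_inverse_Gamma by (induction M) simp_all
  ultimately show ?thesis unfolding Ck_def mb_core_def by (simp add: field_simps)
qed

lemma Ck_pred: "CK (k - 1) = - \<beta> * CK k"
proof -
  have "(- \<beta>) powi (1 - (k - 1)) = (- \<beta>) powi (1 - k + 1)" by (simp add: algebra_simps)
  also have "\<dots> = (- \<beta>) powi (1 - k) * (- \<beta>)" by (rule power_int_add_1) (use beta in simp)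
  finally show ?thesis unfolding Ck_eq by simp
qed

lemma exp_eq_xof: "exp \<zeta> = - kap * xo \<zeta>"
  unfolding xof_def using kap_nz by simp

lemma xof_nonzero: "xo \<zeta> \<noteq> 0"
  unfolding xof_def using kap_nz by simp

text \<open>This is where the normalization C_k comes from: each term of the Laurent series is C_k
  times the contribution of one right pole.\<close>

lemma phi_term_eq:
  "pterm k (xo \<zeta>) n
     = CK k * ((-1) ^ n / fact n * (core (rp k n) * exp (rp k n * \<zeta>)))"
proof -
  define x where "x = xo \<zeta>"
  define i where "i = int n - k"
  have x: "x \<noteq> 0" by (simp add: x_def xof_nonzero)
  have rp: "rp k n = of_int (i + 1)" by (simp add: i_def)
  have "exp (rp k n * \<zeta>) = exp \<zeta> powi (i + 1)"
    unfolding rp by (simp add: exp_power_int)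
  also have "\<dots> = ((-1) * kap * x) powi (i + 1)" unfolding exp_eq_xof x_def by simp
  also have "\<dots> = (-1) powi (i + 1) * kap powi (i + 1) * x powi (i + 1)"
    by (simp only: power_int_mult_distrib)
  finally have e: "exp (rp k n * \<zeta>) = (-1) powi (i + 1) * kap powi (i + 1) * x powi (i + 1)" .
  have b: "(- \<beta>) powi (1 - k) = (-1) powi (1 - k) * \<beta> powi (1 - k)"
    by (metis mult_minus1 power_int_mult_distrib)
  \<comment> \<open>The signs come from (-beta)^(1-k), from the residue and from (-kappa x)^(i+1);
    their exponents add up to the even number 2 (i + 1).\<close>
  have sgn: "(-1) powi (1 - k) * (-1) ^ n * (-1) powi (i + 1) = (1 :: complex)"
  proof -
    have "(-1 :: complex) powi (1 - k) * (-1) powi int n * (-1) powi (i + 1) = (-1) powi ((1 - k) + int n + (i + 1))"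
      by (subst power_int_add, simp)+ simp
    also have "(1 - k) + int n + (i + 1) = 2 * (i + 1)" by (simp add: i_def)
    also have "(-1 :: complex) powi (2 * (i + 1)) = 1" by (simp add: power_int_mult)
    finally show ?thesis by simp
  qed
  have "CK k * ((-1) ^ n / fact n * (core (rp k n) * exp (rp k n * \<zeta>)))
     = ((-1) powi (1 - k) * (-1) ^ n * (-1) powi (i + 1)) *
        (\<beta> powi (1 - k) * kap powi (i + 1) * x powi (i + 1) * core (of_int (i + 1)) / (core 0 * fact n))"
    unfolding Ck_eq e b unfolding rp by simp
  also have "\<dots> = \<beta> powi (1 - k) * kap powi (i + 1) * x powi (i + 1) * core (of_int (i + 1)) / (core 0 * fact n)"
    unfolding sgn by simp
  also have "\<dots> = \<beta> * x powi (1 - k) * (((\<beta> * kap) powi i * core (of_int i + 1) / core 1) / fact n) * (x / \<beta>) ^ n"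
  proof -
    have "x powi (i + 1) = x powi (1 - k) * x ^ n"
    proof -
      have e: "i + 1 = (1 - k) + int n" by (simp add: i_def)
      show ?thesis unfolding e power_int_add[OF disjI1[OF x]] by simp
    qed
    moreover have "\<beta> powi (1 - k) = \<beta> * \<beta> powi i / \<beta> ^ n"
    proof -
      have "\<beta> powi (1 + i) = \<beta> powi (1 - k) * \<beta> powi int n"
        unfolding power_int_add[OF disjI1[OF beta], symmetric] by (simp add: i_def add_diff_eq diff_add_eq)
      thus ?thesis using beta by (simp add: power_int_add field_simps)
    qed
    moreover have "kap powi (i + 1) = kap powi i * kap" using kap_nz by (simp add: power_int_add_1)
    ultimately show ?thesis unfolding core_0 using kap_nz
      by (simp add: power_int_mult_distrib power_divide) (simp only: mult_ac)
  qed
  also have "\<dots> = pterm k x n"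
    unfolding phi_term_def rho_eq i_def ..
  finally show ?thesis by (simp add: x_def)
qed

text \<open>G(beta s) core(s) = kappa core(s + 1), so applying G(beta D) shifts the core. The
  prefactor kappa exp(-zeta) is -1/x, and multiplying by beta x turns C_k into -beta C_k =
  C_(k-1).\<close>

lemma line_integral_Gcd_integrand:
  assumes reg: "regular_contour \<gamma>" and avoid: "\<forall>p\<in>LP. p \<notin> range \<gamma>"
  shows "line_integral (\<lambda>s. Gcd L M c d (\<beta> * s) * integrand L M \<beta> c d k \<zeta> s) \<gamma>
     = kap * exp (- \<zeta>) * line_integral (\<lambda>s. Gamma (1 - of_int k - s) * (core (s + 1) * exp ((s + 1) * \<zeta>))) \<gamma>"
  unfolding line_integral_cmult[symmetric]
proof (rule line_integral_cong_off_finite[OF reg, where X = "(\<lambda>m. 1 / (\<beta> * d m)) ` {..<M}"])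
  fix t assume t: "\<gamma> t \<notin> (\<lambda>m. 1 / (\<beta> * d m)) ` {..<M}"
  define s where "s = \<gamma> t"
  have *: "Gcd L M c d (\<beta> * s) * core s = kap * core (s + 1)"
    by (rule Gcd_mult_core) (use avoid t in \<open>auto simp: s_def\<close>)
  have "Gcd L M c d (\<beta> * s) * integrand L M \<beta> c d k \<zeta> s =
      Gamma (1 - of_int k - s) * exp (s * \<zeta>) * (Gcd L M c d (\<beta> * s) * core s)"
    unfolding integrand_eq by (simp add: mult_ac)
  also have "\<dots> = kap * exp (- \<zeta>) * (Gamma (1 - of_int k - s) * (core (s + 1) * exp ((s + 1) * \<zeta>)))"
    unfolding * by (simp add: distrib_right exp_add exp_minus)
  finally show "Gcd L M c d (\<beta> * \<gamma> t) * integrand L M \<beta> c d k \<zeta> (\<gamma> t) =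
     kap * exp (- \<zeta>) * (Gamma (1 - of_int k - \<gamma> t) * (core (\<gamma> t + 1) * exp ((\<gamma> t + 1) * \<zeta>)))"
    by (simp add: s_def)
qed auto

section \<open>Geometric decay in the direction of the right poles\<close>

lemma holomorphic_core_exp: "(\<lambda>s. core s * exp (s * \<zeta>)) holomorphic_on - LP"
  by (intro holomorphic_intros holomorphic_mb_core)

lemma holomorphic_core_exp_shift: "(\<lambda>s. core (s + 1) * exp ((s + 1) * \<zeta>)) holomorphic_on - LP"
proof -
  have "(\<lambda>s. (\<lambda>s. core s * exp (s * \<zeta>)) (s + 1)) holomorphic_on - LP"
  proof (rule holomorphic_on_compose_gen[unfolded o_def, OF _ holomorphic_core_exp])
    show "(\<lambda>s. s + 1) ` (- LP) \<subseteq> - LP"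
      using left_poles_closed_under_pred[of _ L \<beta> c] by force
  qed (intro holomorphic_intros)
  thus ?thesis by simp
qed

text \<open>Up to exp(zeta), this is the quotient of rGamma(k + s) core(s) exp(s zeta) at s + 1 and
  at s.\<close>

definition step_ratio :: "int \<Rightarrow> complex \<Rightarrow> complex" where
  "step_ratio k s = (\<Prod>l<L. s + 1 / (\<beta> * c l)) / ((of_int k + s) * (\<Prod>m<M. s - 1 / (\<beta> * d m)))"

lemma step_ratio_tendsto:
  assumes "L \<le> M + 1"
  shows "(step_ratio k \<longlongrightarrow> (if L = M + 1 then 1 else 0)) at_infinity"
proof -
  \<comment> \<open>The M + 1 linear factors of the denominator as one family s +
    \<open>e m\<close>, with k + s last. L of them are paired with the numerators, each quotient
    tending to 1; any left over drive the product to 0.\<close>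
  define e where "e = (\<lambda>m. if m < M then - 1 / (\<beta> * d m) else of_int k)"
  have eq: "step_ratio k s = (\<Prod>l<L. (s + 1 / (\<beta> * c l)) / (s + e l)) * (\<Prod>m\<in>{L..<Suc M}. inverse (s + e m))" for s
  proof -
    have "(\<Prod>m<M. s - 1 / (\<beta> * d m)) = (\<Prod>m<M. s + e m)" by (intro prod.cong) (auto simp: e_def)
    hence "(of_int k + s) * (\<Prod>m<M. s - 1 / (\<beta> * d m)) = (\<Prod>m<Suc M. s + e m)"
      by (simp add: e_def add_ac mult_ac)
    also have "{..<Suc M} = {..<L} \<union> {L..<Suc M}" using assms by auto
    also have "(\<Prod>m\<in>{..<L} \<union> {L..<Suc M}. s + e m) = (\<Prod>m<L. s + e m) * (\<Prod>m\<in>{L..<Suc M}. s + e m)"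
      by (rule prod.union_disjoint) auto
    finally show ?thesis unfolding step_ratio_def prod_dividef prod_inversef
      by (simp only: divide_inverse inverse_mult_distrib mult.assoc prod_inversef[symmetric] o_def)
  qed
  have "((\<lambda>s. (\<Prod>l<L. (s + 1 / (\<beta> * c l)) / (s + e l)) * (\<Prod>m\<in>{L..<Suc M}. inverse (s + e m)))
     \<longlongrightarrow> (\<Prod>l<L. 1) * (\<Prod>m\<in>{L..<Suc M}. 0)) at_infinity"
    by (intro tendsto_mult tendsto_prod tendsto_ratio_shift_at_infinity tendsto_inverse_shift_at_infinity)
  moreover have "(\<Prod>l<L. 1) * (\<Prod>m\<in>{L..<Suc M}. 0) = (if L = M + 1 then 1 else 0 :: complex)"
    using assms by (auto simp: power_0_left)
  ultimately show ?thesis unfolding eq[abs_def] by (simp only:)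
qed

text \<open>Since |exp zeta| = |kappa x|, the half-plane is the logarithmic form of the punctured
  unit disc in kappa x. The empty set for L > M + 1 makes membership imply L <= M + 1.\<close>

definition convergence_domain :: "complex set" where
  "convergence_domain = (if L \<le> M then UNIV else if L = M + 1 then {\<zeta>. Re \<zeta> < 0} else {})"

lemma convergence_domain_imp_le: "\<zeta> \<in> convergence_domain \<Longrightarrow> L \<le> M + 1"
  by (auto simp: convergence_domain_def split: if_splits)

lemma step_ratio_contraction:
  assumes "\<zeta> \<in> convergence_domain"
  obtains q R where "0 < q" "q < 1" "\<And>s. norm s \<ge> R \<Longrightarrow> norm (exp \<zeta> * step_ratio k s) \<le> q"
proof -
  define l where "l = norm (exp \<zeta> * (if L = M + 1 then 1 else 0))"
  have l: "l < 1" using assms by (auto simp: l_def convergence_domain_def split: if_splits)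
  have "((\<lambda>s. norm (exp \<zeta> * step_ratio k s)) \<longlongrightarrow> l) at_infinity"
    unfolding l_def by (intro tendsto_intros step_ratio_tendsto convergence_domain_imp_le[OF assms])
  \<comment> \<open>The midpoint of the limit and 1 serves as contraction constant; it is positive
    even when the limit is 0.\<close>
  moreover have "l < (1 + l) / 2" using l by simp
  ultimately have "\<forall>\<^sub>F s in at_infinity. norm (exp \<zeta> * step_ratio k s) < (1 + l) / 2"
    by (rule order_tendstoD(2))
  then obtain R where R: "\<And>s. norm s \<ge> R \<Longrightarrow> norm (exp \<zeta> * step_ratio k s) < (1 + l) / 2"
    unfolding eventually_at_infinity by blast
  have "l \<ge> 0" by (simp add: l_def)
  thus ?thesis using l R by (intro that[of "(1 + l) / 2" R]) (auto intro: less_imp_le)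
qed

text \<open>By the reflection formula the integrand is \<open>pi / sin (pi (k + s))\<close> times this function.\<close>

definition reflected_term :: "int \<Rightarrow> complex \<Rightarrow> complex \<Rightarrow> complex" where
  "reflected_term k \<zeta> s = rGamma (of_int k + s) * (core s * exp (s * \<zeta>))"

text \<open>The points where the step s -> s + 1 is legitimate: \<open>core\<close> obeys its
  functional equation off the left poles, and the other conditions keep the denominator of
  \<open>step_ratio\<close> nonzero.\<close>

definition regular_at :: "int \<Rightarrow> complex \<Rightarrow> bool" where
  "regular_at k s \<longleftrightarrow> s \<notin> LP \<and> (\<forall>m<M. s \<noteq> 1 / (\<beta> * d m)) \<and> of_int k + s \<noteq> 0"

lemma core_plus1:
  assumes "regular_at k s"
  shows "core (s + 1) = step_ratio k s * (of_int k + s) * core s"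
proof -
  have nz: "(\<Prod>m<M. s - 1 / (\<beta> * d m)) \<noteq> 0" using assms by (auto simp: regular_at_def)
  have "core (s + 1) = (\<Prod>l<L. s + 1 / (\<beta> * c l)) * core s / (\<Prod>m<M. s - 1 / (\<beta> * d m))"
    using mb_core_plus1[of s L \<beta> c M d] assms nz by (simp add: field_simps regular_at_def)
  also have "\<dots> = step_ratio k s * (of_int k + s) * core s"
    unfolding step_ratio_def using assms by (simp add: regular_at_def)
  finally show ?thesis .
qed

lemma reflected_term_plus1:
  assumes "regular_at k s"
  shows "reflected_term k \<zeta> (s + 1) = exp \<zeta> * step_ratio k s * reflected_term k \<zeta> s"
proof -
  have 1: "(of_int k + s) * rGamma (of_int k + (s + 1)) = rGamma (of_int k + s)"
    using rGamma_plus1[of "of_int k + s"] by (simp add: add.assoc)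
  have 2: "exp ((s + 1) * \<zeta>) = exp (s * \<zeta>) * exp \<zeta>" by (simp add: distrib_right exp_add)
  show ?thesis
    unfolding reflected_term_def core_plus1[OF assms] 1[symmetric] 2 by (simp only: mult_ac)
qed

lemma Re_large_regular:
  obtains R where "\<And>s. Re s \<ge> R \<Longrightarrow> regular_at k s"
proof -
  obtain B where B: "\<And>p. p \<in> LP \<Longrightarrow> Re p < B" using left_poles_Re_bounded_above by blast
  define D where "D = (\<Sum>m<M. norm (1 / (\<beta> * d m)))"
  have D: "Re (1 / (\<beta> * d m)) \<le> D" if "m < M" for m
  proof -
    have "Re (1 / (\<beta> * d m)) \<le> norm (1 / (\<beta> * d m))" by (rule complex_Re_le_cmod)
    also have "\<dots> \<le> D" unfolding D_def
      by (rule member_le_sum[where f = "\<lambda>m. norm (1 / (\<beta> * d m))"]) (use that in auto)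
    finally show ?thesis .
  qed
  show ?thesis
  proof (rule that[of "max B (max (D + 1) (1 - of_int k))"])
    fix s assume s: "Re s \<ge> max B (max (D + 1) (1 - of_int k))"
    have "of_int k + s \<noteq> 0"
    proof
      assume "of_int k + s = 0"
      hence "Re (of_int k + s) = 0" by simp
      thus False using s by simp
    qed
    moreover have "s \<notin> LP" using B[of s] s by auto
    moreover have "s \<noteq> 1 / (\<beta> * d m)" if "m < M" for m using D[OF that] s by auto
    ultimately show "regular_at k s" by (simp add: regular_at_def)
  qed
qed

lemma contraction_right:
  assumes "\<zeta> \<in> convergence_domain"
  obtains q R where "0 < q" "q < 1"
    "\<And>s. Re s \<ge> R \<Longrightarrow> regular_at k s \<and> norm (exp \<zeta> * step_ratio k s) \<le> q"
proof -
  obtain q R1 where q: "0 < q" "q < 1" "\<And>s. norm s \<ge> R1 \<Longrightarrow> norm (exp \<zeta> * step_ratio k s) \<le> q"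
    using step_ratio_contraction[OF assms] by metis
  obtain R2 where R2: "\<And>s. Re s \<ge> R2 \<Longrightarrow> regular_at k s"
    using Re_large_regular by metis
  show ?thesis
  proof (rule that[of q "max R1 R2", OF q(1,2)])
    fix s assume s: "Re s \<ge> max R1 R2"
    have "norm s \<ge> R1" using s complex_Re_le_cmod[of s] by linarith
    thus "regular_at k s \<and> norm (exp \<zeta> * step_ratio k s) \<le> q"
      using R2[of s] q(3)[of s] s by auto
  qed
qed

text \<open>Continuity bounds the function on a compact rectangle of width 1, and every unit step to
  the right multiplies it by at most q = exp(-\<open>\<delta>\<close>).\<close>

lemma reflected_term_decay:
  assumes "\<zeta> \<in> convergence_domain"
  shows "\<exists>C \<delta> x0. \<delta> > 0 \<and> (\<forall>s. Re s \<ge> x0 \<longrightarrow> \<bar>Im s\<bar> \<le> \<eta> \<longrightarrow> norm (reflected_term k \<zeta> s) \<le> C * exp (- \<delta> * Re s))"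
proof -
  obtain q R where q: "0 < q" "q < 1" and R: "\<And>s. Re s \<ge> R \<Longrightarrow> regular_at k s \<and> norm (exp \<zeta> * step_ratio k s) \<le> q"
    using contraction_right[OF assms] by metis
  define B where "B = cbox (Complex R (-\<eta>)) (Complex (R + 1) \<eta>)"
  have "continuous_on B (reflected_term k \<zeta>)"
    unfolding reflected_term_def
  proof (intro continuous_intros)
    have "continuous_on (- LP) core" by (rule holomorphic_on_imp_continuous_on[OF holomorphic_mb_core])
    thus "continuous_on B core" by (rule continuous_on_subset) (use R in \<open>auto simp: B_def in_cbox_complex_iff regular_at_def\<close>)
    show "continuous_on B (\<lambda>s. rGamma (of_int k + s))"
      by (intro holomorphic_on_imp_continuous_on holomorphic_intros)
  qed
  hence "bounded (reflected_term k \<zeta> ` B)" by (intro compact_imp_bounded compact_continuous_image) (auto simp: B_def)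
  then obtain C where C: "\<And>s. s \<in> B \<Longrightarrow> norm (reflected_term k \<zeta> s) \<le> C" unfolding bounded_iff by (metis imageI)
  have iter: "norm (reflected_term k \<zeta> (s + of_nat n)) \<le> q ^ n * norm (reflected_term k \<zeta> s)" if "Re s \<ge> R" for s n
  proof (induction n)
    case (Suc n)
    have Rn: "Re (s + of_nat n) \<ge> R" using that by simp
    have "norm (reflected_term k \<zeta> (s + of_nat n + 1)) = norm (exp \<zeta> * step_ratio k (s + of_nat n)) * norm (reflected_term k \<zeta> (s + of_nat n))"
      using R[OF Rn] by (subst reflected_term_plus1) (auto simp: norm_mult)
    also have "\<dots> \<le> q * (q ^ n * norm (reflected_term k \<zeta> s))"
      using R[OF Rn] Suc q by (intro mult_mono) auto
    finally show ?case by (simp add: add_ac)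
  qed simp
  define \<delta> where "\<delta> = - ln q"
  have \<delta>: "\<delta> > 0" "q = exp (- \<delta>)" using q by (auto simp: \<delta>_def)
  have "norm (reflected_term k \<zeta> s) \<le> (\<bar>C\<bar> * exp (\<delta> * (R + 1))) * exp (- \<delta> * Re s)" if s: "Re s \<ge> R" "\<bar>Im s\<bar> \<le> \<eta>" for s
  proof -
    \<comment> \<open>The number of unit steps by which s lies beyond the base rectangle R <= Re <=
      R + 1.\<close>
    define n where "n = nat \<lfloor>Re s - R\<rfloor>"
    have n: "real n \<le> Re s - R" "Re s - R < real n + 1" using s by (auto simp: n_def)
    define s' where "s' = s - of_nat n"
    have "s' \<in> B" using n s by (auto simp: s'_def B_def in_cbox_complex_iff)
    have "norm (reflected_term k \<zeta> s) \<le> q ^ n * norm (reflected_term k \<zeta> s')"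
      using iter[of s' n] n by (simp add: s'_def)
    also have "\<dots> \<le> q ^ n * \<bar>C\<bar>" using C[OF \<open>s' \<in> B\<close>] q by (intro mult_left_mono) auto
    also have "q ^ n = exp (- \<delta> * real n)" unfolding \<delta>(2) by (simp add: exp_of_nat_mult[symmetric] mult.commute)
    also have "\<dots> \<le> exp (\<delta> * (R + 1) + - \<delta> * Re s)"
    proof -
      have "\<delta> * (Re s - R - 1) \<le> \<delta> * real n" using n \<delta> by (intro mult_left_mono) auto
      thus ?thesis by (simp add: algebra_simps)
    qed
    finally show ?thesis unfolding exp_add by (simp add: mult_ac mult_right_mono)
  qed
  thus ?thesis using \<delta>(1) by blast
qed

text \<open>At the right pole number n, k + s = n + 1 and \<open>rGamma\<close> gives 1/n!. The
  terms are thus, up to sign and C_k, values of \<open>reflected_term\<close>, and the contraction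
  serves as ratio test.\<close>

lemma summable_phi_term:
  assumes "\<zeta> \<in> convergence_domain"
  shows "summable (\<lambda>n. norm (pterm k (xo \<zeta>) n))"
proof -
  obtain q R where q: "0 < q" "q < 1" and R: "\<And>s. Re s \<ge> R \<Longrightarrow> regular_at k s \<and> norm (exp \<zeta> * step_ratio k s) \<le> q"
    using contraction_right[OF assms] by metis
  have eq: "norm (pterm k (xo \<zeta>) n) = norm (CK k) * norm (reflected_term k \<zeta> (rp k n))" for n
  proof -
    have "of_int k + rp k n = of_nat (Suc n)" by simp
    hence "rGamma (of_int k + rp k n) = inverse (fact n)"
      unfolding rGamma_inverse_Gamma using Gamma_fact[of n, where 'a = complex] by simp
    thus ?thesis unfolding phi_term_eq reflected_term_def by (simp add: norm_mult norm_divide norm_inverse norm_power divide_inverse)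
  qed
  show ?thesis
  proof (rule summable_ratio_test[OF q(2)])
    fix n assume n: "n \<ge> nat \<lceil>R + \<bar>of_int k\<bar>\<rceil>"
    have "real n \<ge> R + \<bar>of_int k\<bar>" using n by linarith
    hence "Re (rp k n) \<ge> R" by simp
    note * = R[OF this]
    have "rp k (Suc n) = rp k n + 1" by simp
    hence "reflected_term k \<zeta> (rp k (Suc n)) = exp \<zeta> * step_ratio k (rp k n) * reflected_term k \<zeta> (rp k n)"
      using reflected_term_plus1[of k "rp k n" \<zeta>] * by metis
    hence "norm (reflected_term k \<zeta> (rp k (Suc n))) \<le> q * norm (reflected_term k \<zeta> (rp k n))"
      using * by (simp add: norm_mult mult_right_mono del: of_nat_Suc)
    hence "norm (CK k) * norm (reflected_term k \<zeta> (rp k (Suc n))) \<le> norm (CK k) * (q * norm (reflected_term k \<zeta> (rp k n)))"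
      by (intro mult_left_mono) auto
    thus "norm (norm (pterm k (xo \<zeta>) (Suc n)))
        \<le> q * norm (norm (pterm k (xo \<zeta>) n))"
      unfolding eq by (simp add: mult_ac del: of_nat_Suc)
  qed
qed

section \<open>Hankel contours: the series and the three relations\<close>

lemma hankel_sums:
  assumes hc: "hankel_contour L \<beta> c k \<gamma>" and \<zeta>: "\<zeta> \<in> convergence_domain"
  shows "pterm k (xo \<zeta>) sums ptil \<gamma> k \<zeta>"
proof -
  have "(\<lambda>n. (-1) ^ n / fact n * (core (rp k n) * exp (rp k n * \<zeta>))) sums
    (line_integral (\<lambda>s. Gamma (1 - of_int k - s) * (core s * exp (s * \<zeta>))) \<gamma> / (2 * of_real pi * \<i>))"
    by (rule line_integral_hankel_contour[OF hc poles_disjoint holomorphic_core_exp])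
       (use reflected_term_decay[OF \<zeta>, of _ k] in \<open>simp add: reflected_term_def\<close>)
  from sums_mult[OF this, of "CK k"] show ?thesis
    unfolding phi_term_eq[symmetric] phitilde_def integrand_eq[abs_def] by simp
qed

text \<open>After G(beta D) the integrand for k is the one for k - 1 evaluated at s + 1, up to the
  prefactor. Its residues at the right poles of k therefore produce the series for k - 1.\<close>

lemma hankel_GD_sums:
  assumes hc: "hankel_contour L \<beta> c k \<gamma>" and \<zeta>: "\<zeta> \<in> convergence_domain"
  shows "pterm (k - 1) (xo \<zeta>) sums (\<beta> * xo \<zeta> * GDptil \<gamma> k \<zeta>)"
proof -
  let ?LI = "line_integral (\<lambda>s. Gamma (1 - of_int k - s) * (core (s + 1) * exp ((s + 1) * \<zeta>))) \<gamma>"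
  have "(\<lambda>n. (-1) ^ n / fact n * (core (rp k n + 1) * exp ((rp k n + 1) * \<zeta>))) sums
    (?LI / (2 * of_real pi * \<i>))"
  proof (rule line_integral_hankel_contour[OF hc poles_disjoint holomorphic_core_exp_shift])
    fix \<eta>
    obtain C \<delta> x0 where C: "\<delta> > 0" "\<And>s. Re s \<ge> x0 \<Longrightarrow> \<bar>Im s\<bar> \<le> \<eta> \<Longrightarrow> norm (reflected_term (k - 1) \<zeta> s) \<le> C * exp (- \<delta> * Re s)"
      using reflected_term_decay[OF \<zeta>, of \<eta> "k - 1"] by blast
    have "norm (rGamma (of_int k + s) * (core (s + 1) * exp ((s + 1) * \<zeta>))) \<le> (C * exp (- \<delta>)) * exp (- \<delta> * Re s)"
      if "Re s \<ge> x0" "\<bar>Im s\<bar> \<le> \<eta>" for s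
    proof -
      have "norm (reflected_term (k - 1) \<zeta> (s + 1)) \<le> C * exp (- \<delta> * Re (s + 1))" using that by (intro C) auto
      also have "- \<delta> * Re (s + 1) = - \<delta> + - \<delta> * Re s" by (simp add: algebra_simps)
      finally show ?thesis unfolding exp_add by (simp add: reflected_term_def mult.assoc)
    qed
    thus "\<exists>C \<delta> x0. 0 < \<delta> \<and> (\<forall>s. x0 \<le> Re s \<longrightarrow> \<bar>Im s\<bar> \<le> \<eta> \<longrightarrow>
       norm (rGamma (of_int k + s) * (core (s + 1) * exp ((s + 1) * \<zeta>))) \<le> C * exp (- \<delta> * Re s))"
      using C(1) by blast
  qed
  from sums_mult[OF this[unfolded rp_pred(1)[symmetric]], of "CK (k - 1)"]
  have "pterm (k - 1) (xo \<zeta>) sums (CK (k - 1) * (?LI / (2 * of_real pi * \<i>)))"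
    unfolding phi_term_eq[symmetric] .
  moreover have "\<beta> * xo \<zeta> * GDptil \<gamma> k \<zeta> = CK (k - 1) * (?LI / (2 * of_real pi * \<i>))"
  proof -
    have "line_integral (\<lambda>s. Gcd L M c d (\<beta> * s) * integrand L M \<beta> c d k \<zeta> s) \<gamma> = kap * exp (- \<zeta>) * ?LI"
      by (rule line_integral_Gcd_integrand) (use hc in \<open>auto simp: hankel_contour_def\<close>)
    thus ?thesis unfolding GD_phitilde_def Ck_pred xof_def using kap_nz
      by (simp add: exp_minus field_simps)
  qed
  ultimately show ?thesis by simp
qed

lemma phi_term_pred:
  "pterm (k - 1) (xo \<zeta>) n = \<beta> * of_nat (Suc n) * pterm k (xo \<zeta>) (Suc n)"
  unfolding phi_term_eq Ck_pred rp_pred(2) by (simp add: field_simps del: of_nat_Suc)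

lemma open_convergence_domain: "open convergence_domain"
  by (auto simp: convergence_domain_def open_halfspace_Re_lt)

text \<open>phitilde_k is exp((1-k) zeta) times a power series G in exp zeta, so termwise
  differentiation suffices. The operator D + k - 1 cancels the derivative of the exponential
  prefactor, and the series of G' is that of phitilde_(k-1).\<close>

lemma hankel_derivative:
  assumes hc: "\<And>k. hankel_contour L \<beta> c k (\<gamma> k)" and \<zeta>: "\<zeta> \<in> convergence_domain"
  shows "\<exists>D. (ptil (\<gamma> k) k has_field_derivative D) (at \<zeta>) \<and>
     \<beta> * (D + of_int (k - 1) * ptil (\<gamma> k) k \<zeta>) = ptil (\<gamma> (k - 1)) (k - 1) \<zeta>"
proof -
  define A where "A = (\<lambda>n. CK k * ((-1) ^ n / fact n * core (rp k n)))"
  have tm: "pterm k (xo z) n = exp (of_int (1 - k) * z) * (A n * exp z ^ n)" for z n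
    unfolding phi_term_eq A_def distrib_right exp_add exp_of_nat_mult by (simp add: mult_ac)
  have sums: "(\<lambda>n. A n * exp z ^ n) sums (exp (- (of_int (1 - k) * z)) * ptil (\<gamma> k) k z)"
    if "z \<in> convergence_domain" for z
    using sums_mult[OF hankel_sums[OF hc that, of k], of "exp (- (of_int (1 - k) * z))"]
    unfolding tm mult.assoc[symmetric] exp_add[symmetric] by simp
  define G where "G = (\<lambda>w. \<Sum>n. A n * w ^ n)"
  have rep: "ptil (\<gamma> k) k z = exp (of_int (1 - k) * z) * G (exp z)" if "z \<in> convergence_domain" for z
    unfolding G_def sums_unique[OF sums[OF that], symmetric] by (simp add: exp_minus)
  \<comment> \<open>A point of convergence with strictly larger |exp|, which puts exp zeta inside
    the disc where the power series may be differentiated. For Re zeta < 0 halving zeta moves it to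
    the right within the half-plane.\<close>
  obtain \<zeta>1 where \<zeta>1: "\<zeta>1 \<in> convergence_domain" "Re \<zeta> < Re \<zeta>1"
  proof (cases "L \<le> M")
    case True
    thus ?thesis using that[of "\<zeta> + 1"] by (auto simp: convergence_domain_def)
  next
    case False
    thus ?thesis using that[of "\<zeta> / 2"] \<zeta> by (auto simp: convergence_domain_def split: if_splits)
  qed
  have sm: "summable (\<lambda>n. A n * exp \<zeta>1 ^ n)" using sums[OF \<zeta>1(1)] by (rule sums_summable)
  have less: "norm (exp \<zeta>) < norm (exp \<zeta>1)" using \<zeta>1(2) by simp
  define G' where "G' = (\<Sum>n. diffs A n * exp \<zeta> ^ n)"
  have DG: "(G has_field_derivative G') (at (exp \<zeta>))"
    unfolding G_def G'_def by (rule termdiffs_strong[OF sm less])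
  define D where "D = of_int (1 - k) * exp (of_int (1 - k) * \<zeta>) * G (exp \<zeta>) + exp (of_int (1 - k) * \<zeta>) * (G' * exp \<zeta>)"
  have "((\<lambda>z. exp (of_int (1 - k) * z) * G (exp z)) has_field_derivative D) (at \<zeta>)"
  proof -
    have d1: "((\<lambda>z. G (exp z)) has_field_derivative G' * exp \<zeta>) (at \<zeta>)"
      by (rule DERIV_chain2[where f = G and g = exp, OF _ DERIV_exp]) (rule DG)
    have d2: "((\<lambda>z. exp (of_int (1 - k) * z)) has_field_derivative of_int (1 - k) * exp (of_int (1 - k) * \<zeta>)) (at \<zeta>)"
      by (auto intro!: derivative_eq_intros)
    from DERIV_mult'[OF d2 d1] show ?thesis unfolding D_def by (simp only: add.commute)
  qed
  hence der: "(ptil (\<gamma> k) k has_field_derivative D) (at \<zeta>)"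
    by (rule has_field_derivative_transform_within_open[OF _ open_convergence_domain \<zeta>]) (simp add: rep)
  have smd: "summable (\<lambda>n. diffs A n * exp \<zeta> ^ n)"
  proof (rule termdiff_converges[of _ "norm (exp \<zeta>1)"])
    show "norm (exp \<zeta>) < norm (exp \<zeta>1)" by (rule less)
    show "summable (\<lambda>n. A n * x ^ n)" if "norm x < norm (exp \<zeta>1)" for x
      by (rule powser_inside[OF sm that])
  qed
  have "pterm (k - 1) (xo \<zeta>) n = (\<beta> * exp (of_int (1 - k) * \<zeta>) * exp \<zeta>) * (diffs A n * exp \<zeta> ^ n)" for n
    unfolding phi_term_pred tm diffs_def by (simp add: mult_ac)
  hence "pterm (k - 1) (xo \<zeta>) sums ((\<beta> * exp (of_int (1 - k) * \<zeta>) * exp \<zeta>) * G')"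
    unfolding G'_def using sums_mult[OF summable_sums[OF smd]] by presburger
  with hankel_sums[OF hc \<zeta>, of "k - 1"]
  have "ptil (\<gamma> (k - 1)) (k - 1) \<zeta> = (\<beta> * exp (of_int (1 - k) * \<zeta>) * exp \<zeta>) * G'"
    by (rule sums_unique2)
  also have "\<dots> = \<beta> * (D + of_int (k - 1) * ptil (\<gamma> k) k \<zeta>)"
    unfolding D_def rep[OF \<zeta>] by (simp add: algebra_simps)
  finally show ?thesis using der by metis
qed

text \<open>Equating the first two relations and cancelling beta gives the third.\<close>

lemma relations_holdI:
  assumes der: "\<And>k \<zeta>. \<zeta> \<in> \<Omega> \<Longrightarrow> \<exists>D. (ptil (\<gamma> k) k has_field_derivative D) (at \<zeta>) \<and>
     \<beta> * (D + of_int (k - 1) * ptil (\<gamma> k) k \<zeta>) = ptil (\<gamma> (k - 1)) (k - 1) \<zeta>"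
   and GD: "\<And>k \<zeta>. \<zeta> \<in> \<Omega> \<Longrightarrow> \<beta> * xo \<zeta> * GDptil (\<gamma> k) k \<zeta> = ptil (\<gamma> (k - 1)) (k - 1) \<zeta>"
  shows "relations_hold L M \<beta> c d \<gamma> \<Omega>"
  unfolding relations_hold_def
proof (intro allI ballI)
  fix k \<zeta> assume \<zeta>: "\<zeta> \<in> \<Omega>"
  let ?p = "ptil (\<gamma> k) k" and ?X = "xo \<zeta> * GDptil (\<gamma> k) k \<zeta>"
  obtain D where D: "(?p has_field_derivative D) (at \<zeta>)"
     "\<beta> * (D + of_int (k - 1) * ?p \<zeta>) = ptil (\<gamma> (k - 1)) (k - 1) \<zeta>" using der[OF \<zeta>] by blast
  have dD: "deriv ?p \<zeta> = D" using D(1) by (rule DERIV_imp_deriv)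
  have "\<beta> * ?X = \<beta> * (D + of_int (k - 1) * ?p \<zeta>)" using GD[OF \<zeta>, of k] D(2) by (simp add: mult.assoc)
  hence "?X = D + of_int (k - 1) * ?p \<zeta>" using beta by simp
  thus "?p field_differentiable at \<zeta> \<and>
       \<beta> * (deriv ?p \<zeta> + of_int (k - 1) * ?p \<zeta>) = ptil (\<gamma> (k - 1)) (k - 1) \<zeta> \<and>
       \<beta> * xo \<zeta> * GDptil (\<gamma> k) k \<zeta> = ptil (\<gamma> (k - 1)) (k - 1) \<zeta> \<and>
       ?X - deriv ?p \<zeta> = of_int (k - 1) * ?p \<zeta>"
    using D GD[OF \<zeta>, of k] unfolding dD field_differentiable_def by auto
qed

lemma hankel_relations:
  assumes hc: "\<And>k. hankel_contour L \<beta> c k (\<gamma> k)"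
  shows "relations_hold L M \<beta> c d \<gamma> convergence_domain"
  using hankel_derivative[OF hc] sums_unique2[OF hankel_GD_sums[OF hc] hankel_sums[OF hc]]
  by (intro relations_holdI) auto

section \<open>The vertical contour\<close>

definition line_re :: "int \<Rightarrow> nat \<Rightarrow> real" where "line_re k N = 1 - of_int k + real N - 1/2"

definition line_weight :: "int \<Rightarrow> nat \<Rightarrow> real \<Rightarrow> complex" where
  "line_weight k N t = Gamma (1 - of_int k - Complex (line_re k N) t) * core (Complex (line_re k N) t)"

definition line_remainder :: "int \<Rightarrow> nat \<Rightarrow> complex \<Rightarrow> complex" where
  "line_remainder k N \<zeta> = integral UNIV (\<lambda>t. line_weight k N t * exp (Complex (line_re k N) t * \<zeta>))"

text \<open>The decay rate of Gamma(1 - k - s) core(s) in vertical strips, hence the bound on the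
  argument of -kappa x.\<close>

definition half_angle :: real where "half_angle = (real L - real M + 1) * (pi/2)"

text \<open>The value of phitilde_k once the contour is moved past N right poles. On the line ds = i
  dt, which cancels the i of 2 pi i.\<close>

definition shifted_repr :: "int \<Rightarrow> nat \<Rightarrow> complex \<Rightarrow> complex" where
  "shifted_repr k N \<zeta> = CK k / (2 * of_real pi) * line_remainder k N \<zeta> + (\<Sum>n<N. pterm k (xo \<zeta>) n)"

lemma line_re_pred: "line_re (k - 1) N = line_re k N + 1" "line_re (k - 1) N = line_re k (Suc N)"
  by (simp_all add: line_re_def)

lemma Re_line_re_not_int:
  assumes "Re z = line_re k N" shows "of_int j - z \<notin> \<int>"
proof
  assume "of_int j - z \<in> \<int>"
  then obtain i where "of_int j - z = of_int i" by (elim Ints_cases)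
  hence "Re (of_int j - z) = of_int i" by simp
  hence "2 * of_int j - 2 * line_re k N = 2 * of_int i" using assms by simp
  hence "real_of_int (2 * j - 2 * (1 - k) - 2 * int N + 1) = real_of_int (2 * i)" by (simp add: line_re_def algebra_simps)
  hence "2 * j - 2 * (1 - k) - 2 * int N + 1 = 2 * i" using of_int_eq_iff by blast
  thus False by presburger
qed

lemma line_not_right_pole: "Complex (line_re k N) t \<notin> right_poles k'"
proof
  assume "Complex (line_re k N) t \<in> right_poles k'"
  then obtain n where n: "Complex (line_re k N) t = of_int (1 - k') + of_nat n" by (auto simp: right_poles_altdef)
  have "of_int 0 - Complex (line_re k N) t = of_int (- (1 - k') - int n)" unfolding n by simp
  hence "of_int 0 - Complex (line_re k N) t \<in> \<int>" using Ints_of_int by metis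
  thus False using Re_line_re_not_int[of "Complex (line_re k N) t" k N 0] by simp
qed

lemma continuous_line_weight:
  assumes "\<And>p. p \<in> LP \<Longrightarrow> Re p < line_re k N"
  shows "continuous_on UNIV (line_weight k N)"
proof -
  have c: "continuous_on (- (right_poles k \<union> LP)) (\<lambda>s. Gamma (1 - of_int k - s) * core s)"
    by (intro holomorphic_on_imp_continuous_on holomorphic_Gamma_mult holomorphic_mb_core)
  have nl: "Complex (line_re k N) t \<notin> LP" for t using assms[of "Complex (line_re k N) t"] by auto
  have "continuous_on UNIV (Complex (line_re k N))" unfolding Complex_eq[abs_def] by (intro continuous_intros)
  thus ?thesis unfolding line_weight_def
    by (rule continuous_on_compose2[OF c]) (use line_not_right_pole nl in auto)
qed

lemma line_weight_bound:
  assumes "\<And>p. p \<in> LP \<Longrightarrow> Re p < line_re k N" "\<nu> < half_angle"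
  shows "\<exists>C. \<forall>t. norm (line_weight k N t) \<le> C * exp (- \<nu> * \<bar>t\<bar>)"
  using strip_decay_line_bound[OF strip_decay_Gamma_mb_core _ assms(2)[unfolded half_angle_def]] continuous_line_weight[OF assms(1)]
  unfolding line_weight_def[abs_def] by blast

text \<open>The functional equation of Gamma(1 - k - s). The line for k past N + 1 poles coincides
  with the line for k - 1 past N poles, which is why the two counts differ by one.\<close>

lemma line_weight_pred:
  "(Complex (line_re k (Suc N)) t + of_int (k - 1)) * line_weight k (Suc N) t = - line_weight (k - 1) N t"
proof -
  define s where "s = Complex (line_re k (Suc N)) t"
  have "1 - of_int k - s \<notin> \<int>" using Re_line_re_not_int[of s k "Suc N" "1 - k"] by (simp add: s_def)
  hence "1 - of_int k - s \<notin> \<int>\<^sub>\<le>\<^sub>0" using nonpos_Ints_subset_Ints by blast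
  from Gamma_plus1[OF this]
  have "Gamma (1 - of_int (k - 1) - s) = (1 - of_int k - s) * Gamma (1 - of_int k - s)" by (simp add: algebra_simps)
  moreover have "1 - of_int k - s = - (s + of_int (k - 1))" by simp
  ultimately have "Gamma (1 - of_int (k - 1) - s) = - ((s + of_int (k - 1)) * Gamma (1 - of_int k - s))"
    by (simp only: mult_minus_left)
  thus ?thesis unfolding line_weight_def line_re_pred(2) s_def[symmetric] by (simp only: mult.assoc mult_minus_left minus_minus)
qed

lemma vertical_strip_decay:
  "strip_decay (half_angle - \<bar>Im \<zeta>\<bar>) (\<lambda>s. Gamma (1 - of_int k - s) * (core s * exp (s * \<zeta>)))"
proof -
  have "strip_decay (half_angle + - \<bar>Im \<zeta>\<bar>) (\<lambda>s. (Gamma (1 - of_int k - s) * core s) * exp (s * \<zeta>))"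
    unfolding half_angle_def by (intro strip_decay_mult strip_decay_Gamma_mb_core strip_decay_exp)
  thus ?thesis by (simp add: mult.assoc)
qed

text \<open>For G(beta D) the shift s -> s + 1 moves the line for k onto the line for k - 1, so the
  contour of k already yields the representation of phitilde_(k-1).\<close>

lemma vertical_representation:
  assumes vc: "vertical_contour L \<beta> c k \<gamma>"
  obtains N0 where
    "\<And>N \<zeta>. N \<ge> N0 \<Longrightarrow> \<bar>Im \<zeta>\<bar> < half_angle \<Longrightarrow> ptil \<gamma> k \<zeta> = shifted_repr k N \<zeta>"
    "\<And>N \<zeta>. N \<ge> N0 \<Longrightarrow> \<bar>Im \<zeta>\<bar> < half_angle \<Longrightarrow> \<beta> * xo \<zeta> * GDptil \<gamma> k \<zeta> = shifted_repr (k - 1) N \<zeta>"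
    "\<And>N p. N \<ge> N0 \<Longrightarrow> p \<in> LP \<Longrightarrow> Re p < line_re k N"
proof (rule line_integral_vertical_contour[OF vc poles_disjoint])
  fix N0
  assume N0: "\<And>N H \<mu>. N \<ge> N0 \<Longrightarrow> H holomorphic_on - LP \<Longrightarrow> 0 < \<mu> \<Longrightarrow>
       strip_decay \<mu> (\<lambda>s. Gamma (1 - of_int k - s) * H s) \<Longrightarrow>
       line_integral (\<lambda>s. Gamma (1 - of_int k - s) * H s) \<gamma> =
         \<i> * integral UNIV (\<lambda>t. Gamma (1 - of_int k - Complex (1 - of_int k + real N - 1/2) t)
                                * H (Complex (1 - of_int k + real N - 1/2) t))
         + 2 * of_real pi * \<i> * (\<Sum>n<N. (-1) ^ n / fact n * H (rp k n))"
    "\<And>p N. p \<in> LP \<Longrightarrow> N \<ge> N0 \<Longrightarrow> Re p < 1 - of_int k + real N - 1/2"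
  show ?thesis
  proof (rule that[of N0])
    fix N \<zeta> assume N: "N \<ge> N0" and \<zeta>: "\<bar>Im \<zeta>\<bar> < half_angle"
    have "line_integral (integrand L M \<beta> c d k \<zeta>) \<gamma> = \<i> * line_remainder k N \<zeta>
        + 2 * of_real pi * \<i> * (\<Sum>n<N. (-1) ^ n / fact n * (core (rp k n) * exp (rp k n * \<zeta>)))"
      unfolding integrand_eq[abs_def] line_remainder_def line_weight_def line_re_def mult.assoc
      by (rule N0(1)[OF N holomorphic_core_exp _ vertical_strip_decay, unfolded mult.assoc]) (use \<zeta> in simp)
    thus "ptil \<gamma> k \<zeta> = shifted_repr k N \<zeta>"
      unfolding shifted_repr_def phitilde_def phi_term_eq sum_distrib_left[symmetric] by (simp add: field_simps)
    have dec: "strip_decay (half_angle - \<bar>Im \<zeta>\<bar>) (\<lambda>s. Gamma (1 - of_int k - s) * (core (s + 1) * exp ((s + 1) * \<zeta>)))"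
      using strip_decay_shift[OF vertical_strip_decay[of \<zeta> "k - 1"], of 1] by (simp add: algebra_simps)
    have gen: "z * ((\<i> * j + 2 * of_real pi * \<i> * s) / (2 * of_real pi * \<i>)) = z / (2 * of_real pi) * j + z * s" for z j s
      by (simp add: field_simps)
    let ?LI = "line_integral (\<lambda>s. Gamma (1 - of_int k - s) * (core (s + 1) * exp ((s + 1) * \<zeta>))) \<gamma>"
    have sh: "Complex (line_re k N) t + 1 = Complex (line_re (k - 1) N) t" for t by (simp add: line_re_pred complex_eq_iff)
    have gam: "1 - of_int k - Complex (line_re k N) t = 1 - of_int (k - 1) - Complex (line_re (k - 1) N) t" for t
      unfolding sh[symmetric] by simp
    have "?LI = \<i> * integral UNIV (\<lambda>t. Gamma (1 - of_int k - Complex (line_re k N) t) *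
           (core (Complex (line_re k N) t + 1) * exp ((Complex (line_re k N) t + 1) * \<zeta>)))
        + 2 * of_real pi * \<i> * (\<Sum>n<N. (-1) ^ n / fact n * (core (rp k n + 1) * exp ((rp k n + 1) * \<zeta>)))"
      unfolding line_re_def by (rule N0(1)[OF N holomorphic_core_exp_shift _ dec]) (use \<zeta> in simp)
    also have "integral UNIV (\<lambda>t. Gamma (1 - of_int k - Complex (line_re k N) t) *
           (core (Complex (line_re k N) t + 1) * exp ((Complex (line_re k N) t + 1) * \<zeta>))) = line_remainder (k - 1) N \<zeta>"
      unfolding line_remainder_def line_weight_def sh gam mult.assoc ..
    finally have LI: "?LI = \<i> * line_remainder (k - 1) N \<zeta> + 2 * of_real pi * \<i> *
        (\<Sum>n<N. (-1) ^ n / fact n * (core (rp (k - 1) n) * exp (rp (k - 1) n * \<zeta>)))"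
      unfolding rp_pred(1) .
    have "line_integral (\<lambda>s. Gcd L M c d (\<beta> * s) * integrand L M \<beta> c d k \<zeta> s) \<gamma> = kap * exp (- \<zeta>) * ?LI"
      by (rule line_integral_Gcd_integrand) (use vc in \<open>auto simp: vertical_contour_def\<close>)
    hence "\<beta> * xo \<zeta> * GDptil \<gamma> k \<zeta> = CK (k - 1) * (?LI / (2 * of_real pi * \<i>))"
      unfolding GD_phitilde_def Ck_pred xof_def using kap_nz by (simp add: exp_minus field_simps)
    thus "\<beta> * xo \<zeta> * GDptil \<gamma> k \<zeta> = shifted_repr (k - 1) N \<zeta>"
      unfolding shifted_repr_def LI gen phi_term_eq sum_distrib_left[symmetric] .
  next
    fix N p assume "N \<ge> N0" "p \<in> LP"
    thus "Re p < line_re k N" using N0(2) by (simp add: line_re_def)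
  qed
qed

text \<open>The contours of k and of k - 1 need not be related, but for a common large N both yield
  the same contour-free expression.\<close>

lemma vertical_GD:
  assumes vc: "\<And>k. vertical_contour L \<beta> c k (\<gamma> k)" and \<zeta>: "\<bar>Im \<zeta>\<bar> < half_angle"
  shows "\<beta> * xo \<zeta> * GDptil (\<gamma> k) k \<zeta> = ptil (\<gamma> (k - 1)) (k - 1) \<zeta>"
proof -
  obtain N1 where N1: "\<And>N. N \<ge> N1 \<Longrightarrow> \<beta> * xo \<zeta> * GDptil (\<gamma> k) k \<zeta> = shifted_repr (k - 1) N \<zeta>"
    using vertical_representation[OF vc, of k] \<zeta> by metis
  obtain N2 where N2: "\<And>N. N \<ge> N2 \<Longrightarrow> ptil (\<gamma> (k - 1)) (k - 1) \<zeta> = shifted_repr (k - 1) N \<zeta>"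
    using vertical_representation[OF vc, of "k - 1"] \<zeta> by metis
  show ?thesis using N1[of "max N1 N2"] N2[of "max N1 N2"] by simp
qed

text \<open>The representation of phitilde_k with N + 1 residues is differentiated and matched with
  that of phitilde_(k-1) with N residues. Both use the same line, so integral and finite sum can be
  compared separately.\<close>

lemma vertical_derivative:
  assumes vc: "\<And>k. vertical_contour L \<beta> c k (\<gamma> k)" and \<zeta>: "\<bar>Im \<zeta>\<bar> < half_angle"
  shows "\<exists>D. (ptil (\<gamma> k) k has_field_derivative D) (at \<zeta>) \<and>
     \<beta> * (D + of_int (k - 1) * ptil (\<gamma> k) k \<zeta>) = ptil (\<gamma> (k - 1)) (k - 1) \<zeta>"
proof -
  obtain N1 where N1: "\<And>N \<zeta>. N \<ge> N1 \<Longrightarrow> \<bar>Im \<zeta>\<bar> < half_angle \<Longrightarrow> ptil (\<gamma> k) k \<zeta> = shifted_repr k N \<zeta>"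
    "\<And>N p. N \<ge> N1 \<Longrightarrow> p \<in> LP \<Longrightarrow> Re p < line_re k N"
    using vertical_representation[OF vc, of k] by metis
  obtain N2 where N2: "\<And>N. N \<ge> N2 \<Longrightarrow> ptil (\<gamma> (k - 1)) (k - 1) \<zeta> = shifted_repr (k - 1) N \<zeta>"
    using vertical_representation[OF vc, of "k - 1"] \<zeta> by metis
  \<comment> \<open>N must be admissible for the contour of k - 1, and N + 1 for that of k.\<close>
  define N where "N = max N1 N2"
  have SN: "Suc N \<ge> N1" by (simp add: N_def)
  define b where "b = line_re k (Suc N)"
  define h where "h = line_weight k (Suc N)"
  define C where "C = CK k"
  define ph where "ph = (\<lambda>n z. pterm k (xo z) n)"
  note J = has_field_derivative_vertical_exp_integral[OF continuous_line_weight[OF N1(2)[OF SN]] line_weight_bound[OF N1(2)[OF SN]] \<zeta>,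
      where b = b, folded h_def]
  define J' where "J' = integral UNIV (\<lambda>t. Complex b t * (h t * exp (Complex b t * \<zeta>)))"
  have DJ: "(line_remainder k (Suc N) has_field_derivative J') (at \<zeta>)"
    using J(1) unfolding line_remainder_def[abs_def] J'_def h_def b_def by simp
  have Dph: "(ph n has_field_derivative rp k n * ph n \<zeta>) (at \<zeta>)" for n
    unfolding ph_def phi_term_eq[abs_def] by (auto intro!: derivative_eq_intros)
  define D where "D = C / (2 * of_real pi) * J' + (\<Sum>n<Suc N. rp k n * ph n \<zeta>)"
  have "((\<lambda>z. C / (2 * of_real pi) * line_remainder k (Suc N) z + (\<Sum>n<Suc N. ph n z)) has_field_derivative D) (at \<zeta>)"
    unfolding D_def by (intro DERIV_add DERIV_cmult DJ DERIV_sum Dph)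
  moreover have "open {z. \<bar>Im z\<bar> < half_angle}" by (intro open_Collect_less continuous_intros)
  ultimately have der: "(ptil (\<gamma> k) k has_field_derivative D) (at \<zeta>)"
    by (rule has_field_derivative_transform_within_open) (use \<zeta> N1(1)[OF SN] in \<open>auto simp: C_def ph_def shifted_repr_def\<close>)
  have Jrel: "J' + of_int (k - 1) * line_remainder k (Suc N) \<zeta> = - line_remainder (k - 1) N \<zeta>"
  proof -
    have "J' + of_int (k - 1) * line_remainder k (Suc N) \<zeta> =
        integral UNIV (\<lambda>t. Complex b t * (h t * exp (Complex b t * \<zeta>)) + of_int (k - 1) * (h t * exp (Complex b t * \<zeta>)))"
      unfolding J'_def line_remainder_def h_def[symmetric] b_def[symmetric]
      by (subst integral_add[OF J(3)]) (auto intro!: integrable_on_mult_right J(2))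
    also have "\<dots> = integral UNIV (\<lambda>t. - (line_weight (k - 1) N t * exp (Complex (line_re (k - 1) N) t * \<zeta>)))"
    proof (rule arg_cong[where f = "integral UNIV"], rule ext)
      fix t
      have "Complex b t * (h t * exp (Complex b t * \<zeta>)) + of_int (k - 1) * (h t * exp (Complex b t * \<zeta>))
          = ((Complex b t + of_int (k - 1)) * h t) * exp (Complex b t * \<zeta>)" by (simp only: distrib_right mult.assoc)
      also have "\<dots> = - (line_weight (k - 1) N t * exp (Complex (line_re (k - 1) N) t * \<zeta>))"
        unfolding h_def b_def line_weight_pred line_re_pred(2) by simp
      finally show "Complex b t * (h t * exp (Complex b t * \<zeta>)) + of_int (k - 1) * (h t * exp (Complex b t * \<zeta>))
          = - (line_weight (k - 1) N t * exp (Complex (line_re (k - 1) N) t * \<zeta>))" .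
    qed
    also have "\<dots> = - line_remainder (k - 1) N \<zeta>" unfolding line_remainder_def by simp
    finally show ?thesis .
  qed
  \<comment> \<open>D + k - 1 multiplies the n-th term by n, which removes n = 0 and leaves N of the
    N + 1 terms.\<close>
  have Srel: "\<beta> * ((\<Sum>n<Suc N. rp k n * ph n \<zeta>) + of_int (k - 1) * (\<Sum>n<Suc N. ph n \<zeta>))
      = (\<Sum>n<N. pterm (k - 1) (xo \<zeta>) n)"
  proof -
    have "\<beta> * ((\<Sum>n<Suc N. rp k n * ph n \<zeta>) + of_int (k - 1) * (\<Sum>n<Suc N. ph n \<zeta>)) = (\<Sum>n<Suc N. \<beta> * of_nat n * ph n \<zeta>)"
      unfolding sum_distrib_left sum.distrib[symmetric] by (intro sum.cong refl) (simp add: algebra_simps)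
    also have "\<dots> = (\<Sum>n<N. \<beta> * of_nat (Suc n) * ph (Suc n) \<zeta>)" by (subst sum.lessThan_Suc_shift) simp
    finally show ?thesis unfolding ph_def phi_term_pred .
  qed
  have "ptil (\<gamma> (k - 1)) (k - 1) \<zeta> =
      - \<beta> * C / (2 * of_real pi) * line_remainder (k - 1) N \<zeta> + (\<Sum>n<N. pterm (k - 1) (xo \<zeta>) n)"
    using N2[of N] unfolding shifted_repr_def Ck_pred C_def by (simp add: N_def)
  also have "\<dots> = \<beta> * C / (2 * of_real pi) * (J' + of_int (k - 1) * line_remainder k (Suc N) \<zeta>)
      + \<beta> * ((\<Sum>n<Suc N. rp k n * ph n \<zeta>) + of_int (k - 1) * (\<Sum>n<Suc N. ph n \<zeta>))"
    unfolding Jrel Srel by simp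
  also have "\<dots> = \<beta> * (D + of_int (k - 1) * (C / (2 * of_real pi) * line_remainder k (Suc N) \<zeta> + (\<Sum>n<Suc N. ph n \<zeta>)))"
  proof -
    have "\<beta> * C / p * (a + e * j) + \<beta> * (s1 + e * s2) = \<beta> * ((C / p * a + s1) + e * (C / p * j + s2))"
      for a e j s1 s2 p by (simp add: divide_inverse algebra_simps)
    thus ?thesis unfolding D_def by blast
  qed
  also have "C / (2 * of_real pi) * line_remainder k (Suc N) \<zeta> + (\<Sum>n<Suc N. ph n \<zeta>) = ptil (\<gamma> k) k \<zeta>"
    using N1(1)[OF SN \<zeta>] by (simp add: C_def ph_def shifted_repr_def)
  finally show ?thesis using der by metis
qed

lemma vertical_relations:
  assumes vc: "\<And>k. vertical_contour L \<beta> c k (\<gamma> k)"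
  shows "relations_hold L M \<beta> c d \<gamma> {\<zeta>. \<bar>Im \<zeta>\<bar> < half_angle}"
  using vertical_derivative[OF vc] vertical_GD[OF vc] by (intro relations_holdI) auto

text \<open>A rate strictly between the angle and \<open>half_angle\<close> leaves an integrable
  exponential in t, so a single constant serves every zeta of the closed sector.\<close>

lemma norm_line_remainder_le:
  assumes b: "\<And>p. p \<in> LP \<Longrightarrow> Re p < line_re k N" and \<theta>: "\<theta> < half_angle"
  obtains C where "C \<ge> 0" "\<And>\<zeta>. \<bar>Im \<zeta>\<bar> \<le> \<theta> \<Longrightarrow> norm (line_remainder k N \<zeta>) \<le> C * exp (line_re k N * Re \<zeta>)"
proof -
  obtain \<nu> where \<nu>: "\<theta> < \<nu>" "\<nu> < half_angle" using dense[OF \<theta>] by blast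
  obtain C where C: "\<And>t. norm (line_weight k N t) \<le> C * exp (- \<nu> * \<bar>t\<bar>)" using line_weight_bound[OF b \<nu>(2)] by blast
  have C0: "C \<ge> 0" using order_trans[OF norm_ge_zero C[of 0]] by simp
  define K where "K = integral UNIV (\<lambda>t. exp (- (\<nu> - \<theta>) * \<bar>t\<bar>))"
  have intK: "(\<lambda>t. exp (- (\<nu> - \<theta>) * \<bar>t\<bar>)) integrable_on UNIV" using \<nu> by (intro integrable_exp_minus_abs) auto
  have K0: "K \<ge> 0" unfolding K_def by (intro integral_nonneg intK) auto
  show ?thesis
  proof (rule that[of "C * K"])
    fix \<zeta> :: complex assume \<zeta>: "\<bar>Im \<zeta>\<bar> \<le> \<theta>"
    have "norm (line_remainder k N \<zeta>) \<le> integral UNIV (\<lambda>t. C * exp (line_re k N * Re \<zeta>) * exp (- (\<nu> - \<theta>) * \<bar>t\<bar>))"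
      unfolding line_remainder_def
    proof (rule integral_norm_bound_integral)
      show "(\<lambda>t. line_weight k N t * exp (Complex (line_re k N) t * \<zeta>)) integrable_on UNIV"
        by (rule has_field_derivative_vertical_exp_integral(2)[OF continuous_line_weight[OF b] line_weight_bound[OF b]])
           (use \<zeta> \<theta> in auto)
      show "(\<lambda>t. C * exp (line_re k N * Re \<zeta>) * exp (- (\<nu> - \<theta>) * \<bar>t\<bar>)) integrable_on UNIV"
        by (intro integrable_on_mult_right intK)
      show "norm (line_weight k N t * exp (Complex (line_re k N) t * \<zeta>)) \<le> C * exp (line_re k N * Re \<zeta>) * exp (- (\<nu> - \<theta>) * \<bar>t\<bar>)" for t
        by (rule norm_mult_vertical_exp_le[OF C \<zeta> C0])
    qed
    also have "\<dots> = C * K * exp (line_re k N * Re \<zeta>)" unfolding K_def integral_mult_right by (simp only: mult_ac)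
    finally show "norm (line_remainder k N \<zeta>) \<le> C * K * exp (line_re k N * Re \<zeta>)" .
  qed (use C0 K0 in auto)
qed

text \<open>The same unit step as for \<open>reflected_term\<close>; the minus sign appears because
  Gamma(1 - k - s) replaces rGamma(k + s).\<close>

lemma line_weight_Suc:
  fixes t :: real and k :: int and N :: nat
  defines "s \<equiv> Complex (line_re k N) t"
  assumes "regular_at k s"
  shows "line_weight k (Suc N) t * exp (Complex (line_re k (Suc N)) t * \<zeta>) =
     - (exp \<zeta> * step_ratio k s) * (line_weight k N t * exp (s * \<zeta>))"
proof -
  have s1: "Complex (line_re k (Suc N)) t = s + 1" by (simp add: s_def line_re_def complex_eq_iff)
  have "of_int (- k) - s \<notin> \<int>" using Re_line_re_not_int[of s k N "- k"] by (simp add: s_def)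
  hence "of_int (- k) - s \<notin> \<int>\<^sub>\<le>\<^sub>0" using nonpos_Ints_subset_Ints by blast
  hence "Gamma (of_int (- k) - s + 1) = (of_int (- k) - s) * Gamma (of_int (- k) - s)"
    by (rule Gamma_plus1)
  moreover have "of_int (- k) - s + 1 = 1 - of_int k - s" "of_int (- k) - s = - (of_int k + s)"
    "1 - of_int k - (s + 1) = - (of_int k + s)" by simp_all
  ultimately have g: "Gamma (1 - of_int k - s) = - ((of_int k + s) * Gamma (1 - of_int k - (s + 1)))"
    by (simp only: mult_minus_left)
  have e: "exp ((s + 1) * \<zeta>) = exp (s * \<zeta>) * exp \<zeta>" by (simp add: distrib_right exp_add)
  show ?thesis
    unfolding line_weight_def s1 s_def[symmetric] g core_plus1[OF assms(2)] e
    by (simp only: mult_ac mult_minus_left mult_minus_right minus_minus)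
qed

text \<open>Each unit move of the line contracts the integrand at every height t by the factor q.
  Starting from one integrable majorant, the remainder integral tends to 0 geometrically.\<close>

lemma vertical_sums:
  assumes vc: "vertical_contour L \<beta> c k \<gamma>" and \<zeta>: "\<zeta> \<in> convergence_domain" "\<bar>Im \<zeta>\<bar> < half_angle"
  shows "pterm k (xo \<zeta>) sums ptil \<gamma> k \<zeta>"
proof -
  obtain N0 where N0: "\<And>N. N \<ge> N0 \<Longrightarrow> ptil \<gamma> k \<zeta> = shifted_repr k N \<zeta>"
    "\<And>N p. N \<ge> N0 \<Longrightarrow> p \<in> LP \<Longrightarrow> Re p < line_re k N"
    using vertical_representation[OF vc] \<zeta>(2) by metis
  obtain q R where q: "0 < q" "q < 1" and R: "\<And>s. Re s \<ge> R \<Longrightarrow> regular_at k s \<and> norm (exp \<zeta> * step_ratio k s) \<le> q"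
    using contraction_right[OF \<zeta>(1)] by metis
  \<comment> \<open>From here on the lines lie right of R, where the contraction holds at every
    height.\<close>
  define N1 where "N1 = max N0 (nat \<lceil>\<bar>R\<bar> + \<bar>of_int k\<bar> + 1\<rceil>)"
  have N1: "N1 \<ge> N0" by (simp add: N1_def)
  have "real N1 \<ge> \<bar>R\<bar> + \<bar>of_int k\<bar> + 1" unfolding N1_def by linarith
  hence blR: "line_re k (N1 + n) \<ge> R" for n by (simp add: line_re_def)
  obtain \<nu> where \<nu>: "\<bar>Im \<zeta>\<bar> < \<nu>" "\<nu> < half_angle" using dense[OF \<zeta>(2)] by blast
  obtain C where C: "\<And>t. norm (line_weight k N1 t) \<le> C * exp (- \<nu> * \<bar>t\<bar>)" using line_weight_bound[OF N0(2)[OF N1] \<nu>(2)] by blast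
  have C0: "C \<ge> 0" using order_trans[OF norm_ge_zero C[of 0]] by simp
  define g where "g = (\<lambda>n t. line_weight k (N1 + n) t * exp (Complex (line_re k (N1 + n)) t * \<zeta>))"
  define \<delta> where "\<delta> = \<nu> - \<bar>Im \<zeta>\<bar>"
  define C1 where "C1 = C * exp (line_re k N1 * Re \<zeta>)"
  have \<delta>: "\<delta> > 0" using \<nu> by (simp add: \<delta>_def)
  have bound: "norm (g n t) \<le> q ^ n * C1 * exp (- \<delta> * \<bar>t\<bar>)" for n t
  proof (induction n)
    case 0
    show ?case using norm_mult_vertical_exp_le[OF C order_refl C0, where t = t and \<zeta> = \<zeta> and b = "line_re k N1"] by (simp add: g_def C1_def \<delta>_def)
  next
    case (Suc n)
    have Rs: "Re (Complex (line_re k (N1 + n)) t) \<ge> R" using blR by simp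
    have "norm (g (Suc n) t) = norm (exp \<zeta> * step_ratio k (Complex (line_re k (N1 + n)) t)) * norm (g n t)"
      unfolding g_def add_Suc_right using R[OF Rs] by (subst line_weight_Suc) (auto simp: norm_mult)
    also have "\<dots> \<le> q * (q ^ n * C1 * exp (- \<delta> * \<bar>t\<bar>))"
      using R[OF Rs] Suc q by (intro mult_mono) auto
    finally show ?case by (simp add: mult.assoc)
  qed
  define K where "K = integral UNIV (\<lambda>t. exp (- \<delta> * \<bar>t\<bar>))"
  have Jbound: "norm (line_remainder k (n + N1) \<zeta>) \<le> q ^ n * (C1 * K)" for n
  proof -
    have "norm (line_remainder k (N1 + n) \<zeta>) \<le> integral UNIV (\<lambda>t. q ^ n * C1 * exp (- \<delta> * \<bar>t\<bar>))"
      unfolding line_remainder_def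
    proof (rule integral_norm_bound_integral)
      have b: "\<And>p. p \<in> LP \<Longrightarrow> Re p < line_re k (N1 + n)" using N0(2)[of "N1 + n"] N1 by auto
      show "(\<lambda>t. line_weight k (N1 + n) t * exp (Complex (line_re k (N1 + n)) t * \<zeta>)) integrable_on UNIV"
        by (rule has_field_derivative_vertical_exp_integral(2)[OF continuous_line_weight[OF b] line_weight_bound[OF b] \<zeta>(2)])
      show "(\<lambda>t. q ^ n * C1 * exp (- \<delta> * \<bar>t\<bar>)) integrable_on UNIV"
        by (intro integrable_on_mult_right integrable_exp_minus_abs \<delta>)
    qed (use bound in \<open>simp add: g_def\<close>)
    thus ?thesis unfolding K_def integral_mult_right by (simp add: mult_ac add_ac)
  qed
  have "(\<lambda>n. line_remainder k (n + N1) \<zeta>) \<longlonglongrightarrow> 0"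
  proof (rule Lim_null_comparison)
    show "\<forall>\<^sub>F n in sequentially. norm (line_remainder k (n + N1) \<zeta>) \<le> q ^ n * (C1 * K)" using Jbound by simp
    show "(\<lambda>n. q ^ n * (C1 * K)) \<longlonglongrightarrow> 0"
      using q by (intro tendsto_mult_left_zero LIMSEQ_realpow_zero) auto
  qed
  hence "(\<lambda>n. ptil \<gamma> k \<zeta> - CK k / (2 * of_real pi) * line_remainder k (n + N1) \<zeta>) \<longlonglongrightarrow>
      ptil \<gamma> k \<zeta> - CK k / (2 * of_real pi) * 0"
    by (intro tendsto_intros)
  moreover have "ptil \<gamma> k \<zeta> - CK k / (2 * of_real pi) * line_remainder k (n + N1) \<zeta>
      = (\<Sum>i<n + N1. pterm k (xo \<zeta>) i)" for n
    using N0(1)[of "n + N1"] N1 by (simp add: shifted_repr_def)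
  ultimately have "(\<lambda>n. \<Sum>i<n + N1. pterm k (xo \<zeta>) i) \<longlonglongrightarrow> ptil \<gamma> k \<zeta>"
    by simp
  thus ?thesis unfolding sums_def by (rule LIMSEQ_offset)
qed

text \<open>Translates exponential bounds in Re zeta into powers of |x|, the constant being a power
  of |kappa|.\<close>

lemma norm_xof_powi: "norm (kap) powi m * norm (xo \<zeta> powi m) = exp (of_int m * Re \<zeta>)"
proof -
  have "norm kap powi m * norm (xo \<zeta> powi m) = norm ((- kap * xo \<zeta>) powi m)"
    by (simp add: norm_power_int norm_mult power_int_mult_distrib)
  also have "\<dots> = exp (of_int m * Re \<zeta>)"
    unfolding exp_eq_xof[symmetric] by (simp add: norm_power_int exp_power_int)
  finally show ?thesis .
qed

text \<open>In the logarithmic variable, x -> 0 in a closed subsector means Re zeta -> -infinity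
  with Im zeta in a compact interval. The contour is moved past more than N poles; the residues
  numbered N or higher and the remainder integral are all of the required order.\<close>

lemma vertical_asymptotic:
  assumes vc: "vertical_contour L \<beta> c k \<gamma>" and \<theta>: "0 < \<theta>1" "\<theta>2 < half_angle"
  shows "(\<lambda>\<zeta>. ptil \<gamma> k \<zeta> - (\<Sum>j<N. pterm k (xo \<zeta>) j))
     \<in> O[inf (filtercomap Re at_bot) (principal {\<zeta>. \<theta>1 \<le> Im \<zeta> \<and> Im \<zeta> \<le> \<theta>2})](\<lambda>\<zeta>. xo \<zeta> powi (int N + 1 - k))"
proof -
  obtain N0 where N0: "\<And>N \<zeta>. N \<ge> N0 \<Longrightarrow> \<bar>Im \<zeta>\<bar> < half_angle \<Longrightarrow> ptil \<gamma> k \<zeta> = shifted_repr k N \<zeta>"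
    "\<And>N p. N \<ge> N0 \<Longrightarrow> p \<in> LP \<Longrightarrow> Re p < line_re k N"
    using vertical_representation[OF vc] by metis
  \<comment> \<open>N itself may be inadmissible for the contour, and its line has abscissa m - 1/2,
    half a unit short of the required order m. From N + 1 on the abscissa is at least m +
    1/2.\<close>
  define N' where "N' = max N0 (Suc N)"
  have N': "N' \<ge> N0" "N' \<ge> Suc N" by (auto simp: N'_def)
  define m where "m = int N + 1 - k"
  obtain C where C: "C \<ge> 0" "\<And>\<zeta>. \<bar>Im \<zeta>\<bar> \<le> \<theta>2 \<Longrightarrow> norm (line_remainder k N' \<zeta>) \<le> C * exp (line_re k N' * Re \<zeta>)"
    using norm_line_remainder_le[OF N0(2)[OF N'(1)] \<theta>(2)] by metis
  define a where "a = (\<lambda>j. norm (CK k * ((-1) ^ j / fact j * core (rp k j))))"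
  define c1 where "c1 = norm (CK k / (2 * of_real pi)) * C"
  define T where "T = c1 + (\<Sum>j\<in>{N..<N'}. a j)"
  have main: "norm (ptil \<gamma> k \<zeta> - (\<Sum>j<N. pterm k (xo \<zeta>) j))
       \<le> T * norm kap powi m * norm (xo \<zeta> powi m)"
    if \<zeta>: "Re \<zeta> \<le> 0" "\<theta>1 \<le> Im \<zeta>" "Im \<zeta> \<le> \<theta>2" for \<zeta>
  proof -
    define E where "E = exp (of_int m * Re \<zeta>)"
    \<comment> \<open>Re zeta <= 0 reverses the order of exponents: a larger power of |x| is
      smaller.\<close>
    have mono: "exp (x * Re \<zeta>) \<le> E" if "x \<ge> of_int m" for x
      unfolding E_def using that \<zeta>(1) by (auto intro: mult_right_mono_neg)
    have Im: "\<bar>Im \<zeta>\<bar> < half_angle" "\<bar>Im \<zeta>\<bar> \<le> \<theta>2" using \<zeta> \<theta> by auto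
    have "(\<Sum>n<N'. pterm k (xo \<zeta>) n) =
       (\<Sum>j<N. pterm k (xo \<zeta>) j) + (\<Sum>j\<in>{N..<N'}. pterm k (xo \<zeta>) j)"
      using sum.atLeastLessThan_concat[of 0 N N' "pterm k (xo \<zeta>)"] N'
      by (simp add: atLeast0LessThan)
    hence eq: "ptil \<gamma> k \<zeta> - (\<Sum>j<N. pterm k (xo \<zeta>) j)
      = CK k / (2 * of_real pi) * line_remainder k N' \<zeta> + (\<Sum>j\<in>{N..<N'}. pterm k (xo \<zeta>) j)"
      using N0(1)[OF N'(1) Im(1)] by (simp add: shifted_repr_def)
    have "norm (ptil \<gamma> k \<zeta> - (\<Sum>j<N. pterm k (xo \<zeta>) j))
        \<le> norm (CK k / (2 * of_real pi) * line_remainder k N' \<zeta>) +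
        (\<Sum>j\<in>{N..<N'}. norm (pterm k (xo \<zeta>) j))"
      unfolding eq by (intro order_trans[OF norm_triangle_ineq] add_mono order_refl norm_sum)
    also have "\<dots> \<le> c1 * E + (\<Sum>j\<in>{N..<N'}. a j * E)"
    proof (intro add_mono sum_mono)
      have "norm (line_remainder k N' \<zeta>) \<le> C * exp (line_re k N' * Re \<zeta>)" by (rule C(2)[OF Im(2)])
      also have "\<dots> \<le> C * E"
      proof (intro mult_left_mono mono C)
        have "real N' \<ge> real N + 1" using N'(2) by linarith
        thus "of_int m \<le> line_re k N'" by (simp add: m_def line_re_def)
      qed
      finally show "norm (CK k / (2 * of_real pi) * line_remainder k N' \<zeta>) \<le> c1 * E"
        unfolding norm_mult c1_def mult.assoc by (intro mult_left_mono) auto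
    next
      fix j assume j: "j \<in> {N..<N'}"
      have "Re (rp k j * \<zeta>) = (1 - of_int k + real j) * Re \<zeta>" by simp
      hence "norm (pterm k (xo \<zeta>) j) = a j * exp ((1 - of_int k + real j) * Re \<zeta>)"
        unfolding phi_term_eq a_def norm_mult norm_exp_eq_Re by simp
      also have "\<dots> \<le> a j * E"
        using j by (intro mult_left_mono mono) (auto simp: a_def m_def)
      finally show "norm (pterm k (xo \<zeta>) j) \<le> a j * E" .
    qed
    also have "\<dots> = T * E" by (simp add: T_def distrib_right sum_distrib_right)
    finally show ?thesis unfolding E_def norm_xof_powi[symmetric] by (simp add: mult.assoc)
  qed
  show ?thesis
  proof (rule bigoI)
    have "\<forall>\<^sub>F \<zeta> in filtercomap Re at_bot. Re \<zeta> \<le> 0"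
      by (rule eventually_filtercomapI[OF eventually_le_at_bot])
    thus "\<forall>\<^sub>F \<zeta> in inf (filtercomap Re at_bot) (principal {\<zeta>. \<theta>1 \<le> Im \<zeta> \<and> Im \<zeta> \<le> \<theta>2}).
       norm (ptil \<gamma> k \<zeta> - (\<Sum>j<N. pterm k (xo \<zeta>) j))
       \<le> T * norm kap powi m * norm (xo \<zeta> powi (int N + 1 - k))"
      unfolding eventually_inf_principal by eventually_elim (use main in \<open>auto simp: m_def\<close>)
  qed
qed

end

theorem theorem3p1:
  fixes L M :: nat and \<beta> :: complex and c d :: "nat \<Rightarrow> complex"
    and \<gamma>H \<gamma>V :: "int \<Rightarrow> real \<Rightarrow> complex"
  assumes beta: "\<beta> \<noteq> 0"
    and c_nz: "\<forall>l<L. c l \<noteq> 0" and d_nz: "\<forall>m<M. d m \<noteq> 0"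
    and c_gen: "\<forall>l<L. 1 / (\<beta> * c l) \<notin> \<int>"
    and d_gen: "\<forall>m<M. 1 / (\<beta> * d m) \<notin> \<int>"
    and hankel: "L \<le> M + 1 \<Longrightarrow> \<forall>k. hankel_contour L \<beta> c k (\<gamma>H k)"
    and vertical: "M + 1 \<le> L \<Longrightarrow> \<forall>k. vertical_contour L \<beta> c k (\<gamma>V k)"
  shows
    "(L \<le> M \<longrightarrow> relations_hold L M \<beta> c d \<gamma>H UNIV)
   \<and> (L = M + 1 \<longrightarrow> relations_hold L M \<beta> c d \<gamma>H {\<zeta>. Re \<zeta> < 0})
   \<and> (M + 1 \<le> L \<longrightarrow> relations_hold L M \<beta> c d \<gamma>V
          {\<zeta>. \<bar>Im \<zeta>\<bar> < real (L - M + 1) * pi / 2})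
   \<and> (L \<le> M \<longrightarrow>
        (\<forall>k x. x \<noteq> 0 \<longrightarrow> summable (\<lambda>j. norm (phi_term L M \<beta> c d k x j))) \<and>
        (\<forall>k \<zeta>. phitilde L M \<beta> c d (\<gamma>H k) k \<zeta> = phi L M \<beta> c d k (xof L M \<beta> c d \<zeta>)))
   \<and> (L = M + 1 \<longrightarrow>
        (\<forall>k \<zeta>. Re \<zeta> < 0 \<longrightarrow>
           (phi_term L M \<beta> c d k (xof L M \<beta> c d \<zeta>)) sums (phitilde L M \<beta> c d (\<gamma>H k) k \<zeta>)) \<and>
        (\<forall>k \<zeta>. Re \<zeta> < 0 \<longrightarrow> \<bar>Im \<zeta>\<bar> < pi \<longrightarrow>
           (phi_term L M \<beta> c d k (xof L M \<beta> c d \<zeta>)) sums (phitilde L M \<beta> c d (\<gamma>V k) k \<zeta>)))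
   \<and> (M + 1 < L \<longrightarrow>
        (\<forall>k (N::nat) \<theta>1 \<theta>2. 0 < \<theta>1 \<longrightarrow> \<theta>1 \<le> \<theta>2 \<longrightarrow> \<theta>2 < real (L - M + 1) * pi / 2 \<longrightarrow>
           (\<lambda>\<zeta>. phitilde L M \<beta> c d (\<gamma>V k) k \<zeta>
                   - (\<Sum>j<N. phi_term L M \<beta> c d k (xof L M \<beta> c d \<zeta>) j))
           \<in> O[inf (filtercomap Re at_bot) (principal {\<zeta>. \<theta>1 \<le> Im \<zeta> \<and> Im \<zeta> \<le> \<theta>2})](\<lambda>\<zeta>. xof L M \<beta> c d \<zeta> powi (int N + 1 - k))))"
proof -
  interpret mellin_barnes L M \<beta> c d
    by unfold_locales (fact beta c_nz d_nz c_gen d_gen)+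
  \<comment> \<open>The statement subtracts in the natural numbers, \<open>half_angle\<close> in the
    reals; they agree in this range.\<close>
  have half_angle_eq: "half_angle = real (L - M + 1) * pi / 2" if "M + 1 \<le> L"
    using that by (simp add: half_angle_def of_nat_diff)
  have H: "hankel_contour L \<beta> c k (\<gamma>H k)" if "L \<le> M + 1" for k
    using hankel[OF that] by blast
  have V: "vertical_contour L \<beta> c k (\<gamma>V k)" if "M + 1 \<le> L" for k
    using vertical[OF that] by blast
  have dom1: "convergence_domain = UNIV" if "L \<le> M" using that by (simp add: convergence_domain_def)
  have dom2: "convergence_domain = {\<zeta>. Re \<zeta> < 0}" if "L = M + 1"
    unfolding convergence_domain_def using that by simp
  have r1: "relations_hold L M \<beta> c d \<gamma>H UNIV" if "L \<le> M"
    using hankel_relations[of \<gamma>H] H that unfolding dom1[OF that] by simp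
  have r2: "relations_hold L M \<beta> c d \<gamma>H {\<zeta>. Re \<zeta> < 0}" if "L = M + 1"
    using hankel_relations[of \<gamma>H] H that unfolding dom2[OF that] by simp
  have r3: "relations_hold L M \<beta> c d \<gamma>V {\<zeta>. \<bar>Im \<zeta>\<bar> < real (L - M + 1) * pi / 2}" if "M + 1 \<le> L"
    using vertical_relations[OF V[OF that]] unfolding half_angle_eq[OF that] .
  have r4: "summable (\<lambda>j. norm (phi_term L M \<beta> c d k x j))" if "L \<le> M" "x \<noteq> 0" for k x
  proof -
    \<comment> \<open>Any logarithm of -kappa x represents x, so convergence in zeta covers every
      nonzero x.\<close>
    have "xof L M \<beta> c d (Ln (- kap * x)) = x"
      using that(2) kap_nz by (simp add: xof_def)
    thus ?thesis using summable_phi_term[of "Ln (- kap * x)" k] dom1[OF that(1)] by simp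
  qed
  have r5: "phitilde L M \<beta> c d (\<gamma>H k) k \<zeta> = phi L M \<beta> c d k (xof L M \<beta> c d \<zeta>)" if "L \<le> M" for k \<zeta>
    using sums_unique[OF hankel_sums[OF H, where k = k and \<zeta> = \<zeta>]] that dom1[OF that] by (simp add: phi_def)
  have r6: "phi_term L M \<beta> c d k (xof L M \<beta> c d \<zeta>) sums phitilde L M \<beta> c d (\<gamma>H k) k \<zeta>"
    if "L = M + 1" "Re \<zeta> < 0" for k \<zeta>
    using hankel_sums[OF H, where k = k and \<zeta> = \<zeta>] that dom2[OF that(1)] by simp
  have r7: "phi_term L M \<beta> c d k (xof L M \<beta> c d \<zeta>) sums phitilde L M \<beta> c d (\<gamma>V k) k \<zeta>"
    if "L = M + 1" "Re \<zeta> < 0" "\<bar>Im \<zeta>\<bar> < pi" for k \<zeta>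
    by (rule vertical_sums[OF V]) (use that dom2[OF that(1)] half_angle_eq in auto)
  have r8: "(\<lambda>\<zeta>. phitilde L M \<beta> c d (\<gamma>V k) k \<zeta> - (\<Sum>j<N. phi_term L M \<beta> c d k (xof L M \<beta> c d \<zeta>) j))
     \<in> O[inf (filtercomap Re at_bot) (principal {\<zeta>. \<theta>1 \<le> Im \<zeta> \<and> Im \<zeta> \<le> \<theta>2})](\<lambda>\<zeta>. xof L M \<beta> c d \<zeta> powi (int N + 1 - k))"
    if "M + 1 < L" "0 < \<theta>1" "\<theta>2 < real (L - M + 1) * pi / 2" for k N \<theta>1 \<theta>2
    by (rule vertical_asymptotic[OF V]) (use that half_angle_eq in auto)
  show ?thesis by (intro conjI allI impI r1 r2 r3 r4 r5 r6 r7 r8)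
qed

end
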